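(* Let $\Omega_2\subset\{0,1,2\}^{\mathbb N}$ be the set of sequences in which at least two of the symbols $0,1,2$ occur infinitely many times. For every $\omega\in\Omega_2$ there exists a family of cardinality $2^{\aleph_0}$ of pairwise non-isomorphic amenable groups $G$ such that each $G$ in the family is generated by four involutions $\tilde a,\tilde b,\tilde c,\tilde d$ satisfying $\tilde b\tilde c\tilde d=1$, covers $G_\omega$ (that is, there is a surjective homomorphism $G\to G_\omega$ with $\tilde a\mapsto a$, $\tilde b\mapsto b_\omega$, $\tilde c\mapsto c_\omega$, $\tilde d\mapsto d_\omega$), and, with respect to the generating set $\{\tilde a,\tilde b,\tilde c,\tilde d\}$, has spectrum $\mathrm{sp}(G)=[-\tfrac12,0]\cup[\tfrac12,1]$.
   Context: Spectrum of a group. For a group $G$ with a finite symmetric generating set $S=S^{-1}$, the Markov operator on $l^2(G)$ is $(Mf)(g)=\frac1{|S|}\sum_{s\in S}f(s^{-1}g)$, and $\mathrm{sp}(G)$ denotes the spectrum of $M$ (with respect to the specified $S$). An involution is an element of order 2. The groups $G_\omega$. Let $T$ be the binary rooted tree whose vertices are the finite words over $\{0,1\}$ (the root is the empty word), where two words are joined by an edge iff one is obtained from the other by appending one letter at the end. Put $w_0=\varnothing$ (the empty word) and $w_n=1^{n-1}0$ for $n\ge1$. Let $\sigma_n$ be the automorphism of $T$ given by $\sigma_n(w_n0v)=w_n1v$, $\sigma_n(w_n1v)=w_n0v$ for every finite word $v$, and $\sigma_n(u)=u$ for all other vertices $u$. Associate to the symbols the columns in the alphabet $\{\Pi,\mathrm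 I\}$: $\overline 0=(\Pi,\Pi,\mathrm I)^{T}$, $\overline 1=(\Pi,\mathrm I,\Pi)^{T}$, $\overline 2=(\mathrm I,\Pi,\Pi)^{T}$. For $\omega=\omega_1\omega_2\cdots\in\{0,1,2\}^{\mathbb N}$ let $\beta_1<\beta_2<\cdots$ (respectively $\gamma_1<\gamma_2<\cdots$, $\delta_1<\delta_2<\cdots$) be the indices $n\geq 1$ for which the first (respectively second, third) entry of $\overline{\omega_n}$ is $\Pi$. Define automorphisms of $T$ by $a=\sigma_0$, $b_\omega=\prod_i\sigma_{\beta_i}$, $c_\omega=\prod_i\sigma_{\gamma_i}$, $d_\omega=\prod_i\sigma_{\delta_i}$ (the factors in each product commute). $G_\omega$ is the group of automorphisms of $T$ generated by $a,b_\omega,c_\omega,d_\omega$. One has $a^2=b_\omega^2=c_\omega^2=d_\omega^2=b_\omega c_\omega d_\omega=1$. *)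

theory Defs
  imports
    "HOL-Analysis.Infinite_Sum"
    "HOL-Library.Equipollence"
    "HOL-Algebra.Generated_Groups"
    "HOL-Algebra.Multiplicative_Group"
begin

section \<open>The operator \<open>M\<close> on \<open>l\<^sup>2\<close> of a group and its spectrum\<close>

text \<open>Elements of \<open>l\<^sup>2(A)\<close>, for a subset \<open>A\<close> of a type, are represented by functions on the whole
  type that vanish outside \<open>A\<close>, so that equality of vectors is equality of functions.\<close>

definition l2_space :: "'a set \<Rightarrow> ('a \<Rightarrow> complex) set" where
  "l2_space A = {f. (\<forall>x. x \<notin> A \<longrightarrow> f x = 0) \<and> (\<lambda>x. (cmod (f x))\<^sup>2) summable_on A}"

definition l2_norm :: "'a set \<Rightarrow> ('a \<Rightarrow> complex) \<Rightarrow> real" where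
  "l2_norm A f = sqrt (\<Sum>\<^sub>\<infinity>x\<in>A. (cmod (f x))\<^sup>2)"

definition l2_bounded_operator :: "'a set \<Rightarrow> (('a \<Rightarrow> complex) \<Rightarrow> ('a \<Rightarrow> complex)) \<Rightarrow> bool" where
  "l2_bounded_operator A T \<longleftrightarrow>
     (\<forall>f\<in>l2_space A. T f \<in> l2_space A) \<and>
     (\<forall>f\<in>l2_space A. \<forall>g\<in>l2_space A. T (\<lambda>x. f x + g x) = (\<lambda>x. T f x + T g x)) \<and>
     (\<forall>f\<in>l2_space A. \<forall>c. T (\<lambda>x. c * f x) = (\<lambda>x. c * T f x)) \<and>
     (\<exists>K. \<forall>f\<in>l2_space A. l2_norm A (T f) \<le> K * l2_norm A f)"

text \<open>The spectrum is the set of those \<open>z\<close> for which \<open>T - z\<close> has no bounded two-sided inverse.\<close>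

definition l2_spectrum :: "'a set \<Rightarrow> (('a \<Rightarrow> complex) \<Rightarrow> ('a \<Rightarrow> complex)) \<Rightarrow> complex set" where
  "l2_spectrum A T = {z. \<not> (\<exists>R. l2_bounded_operator A R \<and>
     (\<forall>f\<in>l2_space A. R (\<lambda>x. T f x - z * f x) = f \<and> (\<lambda>x. T (R f) x - z * R f x) = f))}"

definition markov_operator ::
  "('a, 'b) monoid_scheme \<Rightarrow> 'a set \<Rightarrow> ('a \<Rightarrow> complex) \<Rightarrow> ('a \<Rightarrow> complex)" where
  "markov_operator G S f = (\<lambda>g. if g \<in> carrier G
     then (1 / of_nat (card S)) * (\<Sum>s\<in>S. f (inv\<^bsub>G\<^esub> s \<otimes>\<^bsub>G\<^esub> g)) else 0)"

definition sp :: "('a, 'b) monoid_scheme \<Rightarrow> 'a set \<Rightarrow> complex set" where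
  "sp G S = l2_spectrum (carrier G) (markov_operator G S)"


section \<open>Amenability\<close>

text \<open>A discrete group is amenable if it carries a finitely additive, left-invariant probability
  measure defined on all of its subsets.\<close>

definition amenable :: "('a, 'b) monoid_scheme \<Rightarrow> bool" where
  "amenable G \<longleftrightarrow> (\<exists>\<mu> :: 'a set \<Rightarrow> real.
     (\<forall>A. A \<subseteq> carrier G \<longrightarrow> 0 \<le> \<mu> A) \<and>
     \<mu> (carrier G) = 1 \<and>
     (\<forall>A B. A \<subseteq> carrier G \<longrightarrow> B \<subseteq> carrier G \<longrightarrow> A \<inter> B = {} \<longrightarrow> \<mu> (A \<union> B) = \<mu> A + \<mu> B) \<and>
     (\<forall>g\<in>carrier G. \<forall>A. A \<subseteq> carrier G \<longrightarrow> \<mu> ((\<lambda>x. g \<otimes>\<^bsub>G\<^esub> x) ` A) = \<mu> A))"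


section \<open>The binary tree and its automorphisms\<close>

text \<open>Vertices are words over \<open>{0,1}\<close>, written as Boolean lists with \<open>False\<close> for 0 and \<open>True\<close>
  for 1.\<close>

definition tree_adj :: "bool list \<Rightarrow> bool list \<Rightarrow> bool" where
  "tree_adj u v \<longleftrightarrow> (\<exists>x. v = u @ [x] \<or> u = v @ [x])"

text \<open>The root is the only vertex of degree 2, so a graph automorphism fixes it.\<close>

definition tree_aut :: "(bool list \<Rightarrow> bool list) monoid" where
  "tree_aut = \<lparr>carrier = {f. bij f \<and> (\<forall>u v. tree_adj (f u) (f v) \<longleftrightarrow> tree_adj u v)},
     mult = (\<circ>), one = id\<rparr>"

definition tree_word :: "nat \<Rightarrow> bool list" where
  "tree_word n = (if n = 0 then [] else replicate (n - 1) True @ [False])"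

text \<open>\<open>tree_word n\<close> is \<open>w\<^sub>n\<close>, of length \<open>n\<close>; \<open>\<sigma> n\<close> flips the letter that follows a proper prefix \<open>tree_word n\<close>.\<close>

definition \<sigma> :: "nat \<Rightarrow> bool list \<Rightarrow> bool list" where
  "\<sigma> n u = (if n < length u \<and> take n u = tree_word n then u[n := \<not> u ! n] else u)"

text \<open>The infinite product of the \<open>\<sigma> n\<close> over \<open>n \<in> N\<close> is the pointwise limit of the finite
  products over \<open>n \<in> N\<close>, \<open>n < k\<close>, the vertex set being discrete.  These stabilise at each
  vertex: see \<open>\<sigma>_prod_eq\<close> below.\<close>

primrec \<sigma>_partial_prod :: "nat set \<Rightarrow> nat \<Rightarrow> bool list \<Rightarrow> bool list" where
  "\<sigma>_partial_prod N 0 = id"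
| "\<sigma>_partial_prod N (Suc k) =
     (if k \<in> N then \<sigma>_partial_prod N k \<circ> \<sigma> k else \<sigma>_partial_prod N k)"

definition \<sigma>_prod :: "nat set \<Rightarrow> bool list \<Rightarrow> bool list" where
  "\<sigma>_prod N u = (THE v. \<forall>\<^sub>F k in sequentially. \<sigma>_partial_prod N k u = v)"


section \<open>The groups \<open>G\<^sub>\<omega>\<close>\<close>

datatype symbol = Sym0 | Sym1 | Sym2

datatype entry = Ent_Pi | Ent_I

primrec column :: "symbol \<Rightarrow> entry \<times> entry \<times> entry" where
  "column Sym0 = (Ent_Pi, Ent_Pi, Ent_I)"
| "column Sym1 = (Ent_Pi, Ent_I, Ent_Pi)"
| "column Sym2 = (Ent_I, Ent_Pi, Ent_Pi)"

text \<open>A sequence \<open>\<omega>\<^sub>1\<omega>\<^sub>2\<dots>\<close> is a function on \<open>nat\<close> whose value at 0 is never used.\<close>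

type_synonym symbol_seq = "nat \<Rightarrow> symbol"

definition gen_a :: "bool list \<Rightarrow> bool list" where
  "gen_a = \<sigma> 0"

definition gen_b :: "symbol_seq \<Rightarrow> bool list \<Rightarrow> bool list" where
  "gen_b \<omega> = \<sigma>_prod {n. 1 \<le> n \<and> fst (column (\<omega> n)) = Ent_Pi}"

definition gen_c :: "symbol_seq \<Rightarrow> bool list \<Rightarrow> bool list" where
  "gen_c \<omega> = \<sigma>_prod {n. 1 \<le> n \<and> fst (snd (column (\<omega> n))) = Ent_Pi}"

definition gen_d :: "symbol_seq \<Rightarrow> bool list \<Rightarrow> bool list" where
  "gen_d \<omega> = \<sigma>_prod {n. 1 \<le> n \<and> snd (snd (column (\<omega> n))) = Ent_Pi}"

definition G_omega :: "symbol_seq \<Rightarrow> (bool list \<Rightarrow> bool list) monoid" where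
  "G_omega \<omega> = tree_aut\<lparr>carrier := generate tree_aut {gen_a, gen_b \<omega>, gen_c \<omega>, gen_d \<omega>}\<rparr>"

definition Omega2 :: "symbol_seq set" where
  "Omega2 = {\<omega>. \<exists>x y. x \<noteq> y \<and> infinite {n. 1 \<le> n \<and> \<omega> n = x} \<and> infinite {n. 1 \<le> n \<and> \<omega> n = y}}"


section \<open>Well-definedness of the constructions\<close>

lemma length_tree_word [simp]: "length (tree_word n) = n"
  by (simp add: tree_word_def)

lemma length_\<sigma> [simp]: "length (\<sigma> n u) = length u"
  by (simp add: \<sigma>_def)

lemma \<sigma>_swap [simp]:
  "\<sigma> n (tree_word n @ False # v) = tree_word n @ True # v" "\<sigma> n (tree_word n @ True # v) = tree_word n @ False # v"
  by (simp_all add: \<sigma>_def nth_append list_update_append)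

lemma \<sigma>_other:
  assumes "\<And>x v. u \<noteq> tree_word n @ x # v"
  shows "\<sigma> n u = u"
proof -
  have False if "n < length u" "take n u = tree_word n"
    using assms[of "u ! n" "drop (Suc n) u"] id_take_nth_drop[OF that(1)] that(2) by simp
  then show ?thesis by (auto simp: \<sigma>_def)
qed

lemma \<sigma>_involution [simp]: "\<sigma> n (\<sigma> n u) = u"
  by (auto simp: \<sigma>_def)

lemma \<sigma>_short: "length u \<le> n \<Longrightarrow> \<sigma> n u = u"
  by (simp add: \<sigma>_def)

lemma \<sigma>_butlast: "\<sigma> n (u @ [x]) = \<sigma> n u @ [if u = tree_word n then \<not> x else x]"
  by (auto simp: \<sigma>_def nth_append list_update_append less_Suc_eq)

lemma tree_adjI: "tree_adj u (u @ [x])" "tree_adj (u @ [x]) u"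
  by (auto simp: tree_adj_def)

lemma tree_adj_\<sigma>_imp: "tree_adj u v \<Longrightarrow> tree_adj (\<sigma> n u) (\<sigma> n v)"
  by (auto simp: tree_adj_def \<sigma>_butlast)

lemma tree_adj_\<sigma> [simp]: "tree_adj (\<sigma> n u) (\<sigma> n v) \<longleftrightarrow> tree_adj u v"
  using tree_adj_\<sigma>_imp[of u v n] tree_adj_\<sigma>_imp[of "\<sigma> n u" "\<sigma> n v" n] by auto

lemma bij_\<sigma>: "bij (\<sigma> n)"
  by (rule o_bij[of "\<sigma> n"]) (auto simp: fun_eq_iff)

lemma \<sigma>_partial_prod_stable:
  "length u \<le> k \<Longrightarrow> \<sigma>_partial_prod N k u = \<sigma>_partial_prod N (length u) u"
  by (induction k rule: dec_induct) (auto simp: \<sigma>_short)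

lemma \<sigma>_prod_eq:
  assumes "length u \<le> k"
  shows "\<sigma>_prod N u = \<sigma>_partial_prod N k u"
proof -
  have ev: "\<forall>\<^sub>F j in sequentially. \<sigma>_partial_prod N j u = \<sigma>_partial_prod N k u"
    using eventually_ge_at_top[of "length u"]
    by eventually_elim (rule trans[OF \<sigma>_partial_prod_stable \<sigma>_partial_prod_stable[OF assms, symmetric]])
  have uniq: "v = \<sigma>_partial_prod N k u"
    if "\<forall>\<^sub>F j in sequentially. \<sigma>_partial_prod N j u = v" for v
  proof -
    have "\<forall>\<^sub>F j::nat in sequentially. v = \<sigma>_partial_prod N k u"
      using that ev by eventually_elim simp
    then show ?thesis by simp
  qed
  show ?thesis
    unfolding \<sigma>_prod_def by (rule the_equality) (fact ev, rule uniq)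
qed

lemma length_\<sigma>_partial_prod [simp]: "length (\<sigma>_partial_prod N k u) = length u"
  by (induction k arbitrary: u) auto

lemma bij_\<sigma>_partial_prod: "bij (\<sigma>_partial_prod N k)"
proof (induction k)
  case (Suc k)
  then show ?case using bij_comp[OF bij_\<sigma> Suc, of k] by simp
qed (simp add: bij_id[unfolded id_def])

lemma tree_adj_\<sigma>_partial_prod:
  "tree_adj (\<sigma>_partial_prod N k u) (\<sigma>_partial_prod N k v) \<longleftrightarrow> tree_adj u v"
  by (induction k arbitrary: u v) auto

lemma \<sigma>_in_tree_aut: "\<sigma> n \<in> carrier tree_aut"
  by (simp add: tree_aut_def bij_\<sigma>)

lemma \<sigma>_prod_in_tree_aut: "\<sigma>_prod N \<in> carrier tree_aut"
proof -
  have len: "length (\<sigma>_prod N u) = length u" for u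
    using \<sigma>_prod_eq[of u "length u" N] by simp
  have adj: "tree_adj (\<sigma>_prod N u) (\<sigma>_prod N v) \<longleftrightarrow> tree_adj u v" for u v
    using \<sigma>_prod_eq[of u "max (length u) (length v)" N]
      \<sigma>_prod_eq[of v "max (length u) (length v)" N] by (simp add: tree_adj_\<sigma>_partial_prod)
  have "inj (\<sigma>_prod N)"
  proof (rule injI)
    fix u v assume eq: "\<sigma>_prod N u = \<sigma>_prod N v"
    then have "length u = length v" by (metis len)
    then have "\<sigma>_partial_prod N (length u) u = \<sigma>_partial_prod N (length u) v"
      using eq by (simp add: \<sigma>_prod_eq[of u "length u"] \<sigma>_prod_eq[of v "length u"])
    then show "u = v" using bij_\<sigma>_partial_prod by (metis bij_pointE)
  qed
  moreover have "surj (\<sigma>_prod N)"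
  proof (rule surjI)
    fix v
    let ?u = "inv_into UNIV (\<sigma>_partial_prod N (length v)) v"
    have eq: "\<sigma>_partial_prod N (length v) ?u = v"
      using bij_\<sigma>_partial_prod by (metis bij_is_surj surj_f_inv_f)
    then have "length ?u = length v" by (metis length_\<sigma>_partial_prod)
    then show "\<sigma>_prod N ?u = v" using eq by (simp add: \<sigma>_prod_eq[of ?u "length v"])
  qed
  ultimately show ?thesis using adj by (simp add: tree_aut_def bij_def)
qed

lemma group_tree_aut: "group tree_aut"
proof (rule groupI)
  fix f assume f: "f \<in> carrier tree_aut"
  then have b: "bij f" by (simp add: tree_aut_def)
  have "tree_adj (inv_into UNIV f u) (inv_into UNIV f v) \<longleftrightarrow> tree_adj u v" for u v
  proof -
    have "tree_adj (f (inv_into UNIV f u)) (f (inv_into UNIV f v)) \<longleftrightarrow> tree_adj (inv_into UNIV f u) (inv_into UNIV f v)"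
      using f unfolding tree_aut_def by simp
    then show ?thesis using b by (simp add: bij_is_surj surj_f_inv_f)
  qed
  then have "inv_into UNIV f \<in> carrier tree_aut" using b by (simp add: tree_aut_def bij_imp_bij_inv)
  moreover have "inv_into UNIV f \<otimes>\<^bsub>tree_aut\<^esub> f = \<one>\<^bsub>tree_aut\<^esub>"
    using b by (simp add: tree_aut_def bij_is_inj)
  ultimately show "\<exists>g\<in>carrier tree_aut. g \<otimes>\<^bsub>tree_aut\<^esub> f = \<one>\<^bsub>tree_aut\<^esub>" by blast
qed (auto simp: tree_aut_def bij_comp)

lemma generators_in_tree_aut:
  "{gen_a, gen_b \<omega>, gen_c \<omega>, gen_d \<omega>} \<subseteq> carrier tree_aut"
  by (simp add: gen_a_def gen_b_def gen_c_def gen_d_def \<sigma>_in_tree_aut \<sigma>_prod_in_tree_aut)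

lemma group_G_omega: "group (G_omega \<omega>)"
  unfolding G_omega_def
  by (intro subgroup.subgroup_is_group group.generate_is_subgroup group_tree_aut
      generators_in_tree_aut)

end

theory Submission
  imports
    Defs
    "HOL-Analysis.Function_Topology"
    "HOL-Analysis.L2_Norm"
    "HOL-Analysis.Complex_Transcendental"
    "HOL-Library.Countable"
begin

text \<open>
  Upper bound for the spectrum.  Let \<open>J = (b + c + d - 1) / 2\<close>, acting on square-summable functions; \<open>a\<close> and \<open>J\<close> are
  isometric involutions, and \<open>4 * M - 1 = a + 2 * J\<close>.  Hence \<open>(4 * M - 1)^2 = 5 + 2 * (U + U^-1)\<close> for the isometry
  \<open>U = a * J\<close>, which confines the spectrum of \<open>M\<close> to the two intervals, for every group generated by an involution
  and a Klein four-group (\<open>spectrum_subset\<close>).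

  Lower bound.  On a level of the tree the generators act along a path, with steps by \<open>a\<close> and by two of the letters
  \<open>b, c, d\<close> in turn, while the third one of these fixes the vertex.  For every point of the two intervals the
  corresponding operator on an infinite path has an eigenfunction of constant modulus.  Pulled back along
  an orbit and cut off to a Folner set it gives approximate eigenvectors in any amenable group that
  covers \<open>G_omega\<close> (\<open>approximate_eigenvalue_in_spectrum\<close>, \<open>local_eigenfunctions\<close>).

  Amenability of \<open>G_omega\<close>.  Measure elements by the number of letters \<open>b, c, d\<close>.  Passing to sections does not
  increase the total length, and passing down two levels whose symbols differ decreases it by a fixed proportion,
  except for words that almost avoid two of the three letters; such words are rare.  So the growth is
  subexponential (\<open>growth_bounded\<close>), and some balls are Folner sets (\<open>tree_folner\<close>).

  The family.  Attach to every vertex of depth \<open>n\<close> a cycle of length \<open>p n\<close> on which the generators act as a dihedral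
  group; the period 1 means no decoration.  A word that is trivial in \<open>G_omega\<close> acts trivially at all large
  depths, whatever the decorations are (\<open>trivial_word_eventually_trivial\<close>).  The group acting on the decorated
  tree is therefore an extension of \<open>G_omega\<close> by a locally finite group, and Folner sets lift to it (\<open>layer_folner\<close>).
  The decorated depths can be chosen as independent switches: for each of them there is a word that is trivial
  in \<open>G_omega\<close> and acts nontrivially on the decorations of that depth only (\<open>separating_words\<close>).  Thus every
  set of natural numbers gives a cover, and the set can be recovered from the relations between the generators.
  A countable group has only countably many quadruples of generators, so every isomorphism class
  contains only countably many of these covers, and continuum many classes remain
  (\<open>countable_isomorphic_members\<close>).
\<close>

section \<open>Folner sets and amenability\<close>

definition folner :: "('a, 'b) monoid_scheme \<Rightarrow> 'a set \<Rightarrow> bool" where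
  "folner G S \<longleftrightarrow> (\<forall>\<epsilon>>0. \<exists>\<Phi>. finite \<Phi> \<and> \<Phi> \<noteq> {} \<and> \<Phi> \<subseteq> carrier G \<and>
     (\<forall>s\<in>S. real (card ((\<lambda>x. s \<otimes>\<^bsub>G\<^esub> x) ` \<Phi> - \<Phi>)) \<le> \<epsilon> * real (card \<Phi>)))"

lemma (in group) inj_on_translation: "g \<in> carrier G \<Longrightarrow> A \<subseteq> carrier G \<Longrightarrow> inj_on (\<lambda>x. g \<otimes> x) A"
  by (rule inj_onI) (metis Units_eq Units_l_cancel subsetD)

lemma compact_functions_to_unit_interval: "compact {m :: 'i \<Rightarrow> real. \<forall>i. m i \<in> {0..1}}"
proof -
  have "compactin (product_topology (\<lambda>i::'i. euclidean :: real topology) UNIV) (PiE UNIV (\<lambda>i. {0..1}))"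
    by (subst compactin_PiE) simp
  moreover have "PiE UNIV (\<lambda>i::'i. {0..1::real}) = {m. \<forall>i. m i \<in> {0..1}}"
    by (auto simp: PiE_def Pi_def)
  ultimately show ?thesis
    by (simp add: euclidean_product_topology)
qed

lemma closed_coordinate_conditions:
  fixes c k :: real and A B D :: 'i
  shows "closed {m :: 'i \<Rightarrow> real. m A = c}" "closed {m :: 'i \<Rightarrow> real. m D = m A + m B}"
    "closed {m :: 'i \<Rightarrow> real. \<bar>m A - m B\<bar> \<le> k}"
  by (intro closed_Collect_eq closed_Collect_le continuous_on_product_coordinates continuous_on_add
      continuous_on_diff continuous_on_rabs continuous_on_const)+

text \<open>The normalised counting measure of a Folner set is finitely additive and changes by at most \<open>\<epsilon>\<close> under
translation by an element of \<open>S\<close>.  The set functions with these two properties form a closed subset of a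
power of \<open>{0..1}\<close>, and these subsets decrease with \<open>\<epsilon>\<close>; by Tychonoff's theorem some set function lies in
all of them.  It is invariant under \<open>S\<close>, hence under the group generated by \<open>S\<close>.\<close>

theorem (in group) amenable_if_folner:
  assumes S: "S \<subseteq> carrier G" and gen: "generate G S = carrier G" and fol: "folner G S"
  shows "amenable G"
proof -
  let ?t = "\<lambda>s A. (\<lambda>x. s \<otimes> x) ` A"
  define additive :: "('a set \<Rightarrow> real) set" where
    "additive = {m. m (carrier G) = 1} \<inter>
       (\<Inter>(A, B) \<in> {(A, B). A \<subseteq> carrier G \<and> B \<subseteq> carrier G \<and> A \<inter> B = {}}. {m. m (A \<union> B) = m A + m B})"
  define almost_inv :: "real \<Rightarrow> ('a set \<Rightarrow> real) set" where
    "almost_inv \<epsilon> = additive \<inter> (\<Inter>s\<in>S. \<Inter>A\<in>Pow (carrier G). {m. \<bar>m (?t s A) - m A\<bar> \<le> \<epsilon>})" for \<epsilon>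
  have cl: "closed (almost_inv \<epsilon>)" for \<epsilon>
    unfolding almost_inv_def additive_def
    by (intro closed_Int closed_INT ballI) (simp only: split_beta, rule closed_coordinate_conditions | rule closed_coordinate_conditions)+
  have ne: "\<exists>m. (\<forall>A. m A \<in> {0..1}) \<and> m \<in> almost_inv \<epsilon>" if "\<epsilon> > 0" for \<epsilon>
  proof -
    obtain \<Phi> where \<Phi>: "finite \<Phi>" "\<Phi> \<noteq> {}" "\<Phi> \<subseteq> carrier G"
      and small: "\<And>s. s \<in> S \<Longrightarrow> real (card (?t s \<Phi> - \<Phi>)) \<le> \<epsilon> * real (card \<Phi>)"
      using fol[unfolded folner_def, rule_format, OF \<open>\<epsilon> > 0\<close>] by metis
    define m where "m A = real (card (A \<inter> \<Phi>)) / real (card \<Phi>)" for A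
    have pos: "0 < real (card \<Phi>)"
      using \<Phi> by (simp add: card_gt_0_iff)
    have le: "card (A \<inter> \<Phi>) \<le> card \<Phi>" for A
      using \<Phi> by (simp add: card_mono)
    have m01: "m A \<in> {0..1}" for A
      using pos le[of A] unfolding m_def by (simp add: divide_simps)
    have "m (carrier G) = 1"
      using \<Phi> pos by (simp add: m_def Int_absorb1)
    moreover have "m (A \<union> B) = m A + m B" if "A \<inter> B = {}" for A B
    proof -
      have "card ((A \<union> B) \<inter> \<Phi>) = card (A \<inter> \<Phi>) + card (B \<inter> \<Phi>)"
        using \<Phi>(1) that by (subst card_Un_disjoint[symmetric]) (auto simp: Int_Un_distrib2)
      then show ?thesis by (simp add: m_def add_divide_distrib)
    qed
    ultimately have "m \<in> additive" by (auto simp: additive_def)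
    moreover have "\<bar>m (?t s A) - m A\<bar> \<le> \<epsilon>" if s: "s \<in> S" and A: "A \<subseteq> carrier G" for s A
    proof -
      have sG: "s \<in> carrier G" using S s by auto
      have fin: "finite (?t s \<Phi>)" using \<Phi> by simp
      have card_t: "card (?t s B) = card B" if "B \<subseteq> carrier G" for B
        using inj_on_translation[OF sG that] by (rule card_image)
      have tInt: "?t s A \<inter> ?t s \<Phi> = ?t s (A \<inter> \<Phi>)"
        using inj_on_image_Int[OF inj_on_translation[OF sG subset_refl] A \<Phi>(3)] by simp
      have eq: "card (?t s A \<inter> ?t s \<Phi>) = card (A \<inter> \<Phi>)"
        unfolding tInt using A by (intro card_t) auto
      have "card (?t s \<Phi> - \<Phi>) + card (?t s \<Phi> \<inter> \<Phi>) = card (\<Phi> - ?t s \<Phi>) + card (?t s \<Phi> \<inter> \<Phi>)"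
        using card_t[OF \<Phi>(3)] card_Diff_subset_Int[of "?t s \<Phi>" \<Phi>] card_Diff_subset_Int[of \<Phi> "?t s \<Phi>"] \<Phi>(1)
        by (simp add: Int_commute)
      then have bdry: "card (\<Phi> - ?t s \<Phi>) = card (?t s \<Phi> - \<Phi>)" by simp
      have "card (?t s A \<inter> ?t s \<Phi>) \<le> card ((?t s A \<inter> \<Phi>) \<union> (?t s \<Phi> - \<Phi>))"
        using \<Phi>(1) fin by (intro card_mono) auto
      also have "\<dots> \<le> card (?t s A \<inter> \<Phi>) + card (?t s \<Phi> - \<Phi>)"
        by (rule card_Un_le)
      finally have 1: "card (A \<inter> \<Phi>) \<le> card (?t s A \<inter> \<Phi>) + card (?t s \<Phi> - \<Phi>)"
        by (simp add: eq)
      have "card (?t s A \<inter> \<Phi>) \<le> card ((?t s A \<inter> ?t s \<Phi>) \<union> (\<Phi> - ?t s \<Phi>))"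
        using \<Phi>(1) fin by (intro card_mono) auto
      also have "\<dots> \<le> card (?t s A \<inter> ?t s \<Phi>) + card (\<Phi> - ?t s \<Phi>)"
        by (rule card_Un_le)
      finally have 2: "card (?t s A \<inter> \<Phi>) \<le> card (A \<inter> \<Phi>) + card (?t s \<Phi> - \<Phi>)"
        by (simp add: eq bdry)
      have "\<bar>real (card (?t s A \<inter> \<Phi>)) - real (card (A \<inter> \<Phi>))\<bar> \<le> \<epsilon> * real (card \<Phi>)"
        using 1 2 small[OF s] by linarith
      then show ?thesis
        unfolding m_def using pos by (simp add: diff_divide_distrib[symmetric] abs_divide divide_le_eq)
    qed
    ultimately show ?thesis using m01 by (auto simp: almost_inv_def)
  qed
  have mono: "almost_inv \<epsilon> \<subseteq> almost_inv \<delta>" if "\<epsilon> \<le> \<delta>" for \<epsilon> \<delta>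
    unfolding almost_inv_def using that by (auto dest!: bspec intro: order_trans)
  have "{m. \<forall>A. m A \<in> {0..1}} \<inter> (\<Inter>\<epsilon>\<in>{0<..}. almost_inv \<epsilon>) \<noteq> {}"
  proof (rule compact_imp_fip_image[OF compact_functions_to_unit_interval])
    fix I' :: "real set" assume I': "finite I'" "I' \<subseteq> {0<..}"
    define \<epsilon> where "\<epsilon> = Min (insert 1 I')"
    have "\<epsilon> > 0" using I' by (auto simp: \<epsilon>_def)
    then obtain m where "\<forall>A. m A \<in> {0..1}" "m \<in> almost_inv \<epsilon>" using ne by blast
    moreover have "almost_inv \<epsilon> \<subseteq> almost_inv \<delta>" if "\<delta> \<in> I'" for \<delta>
      using I' that by (intro mono) (simp add: \<epsilon>_def)
    ultimately show "{m. \<forall>A. m A \<in> {0..1}} \<inter> (\<Inter>\<epsilon>\<in>I'. almost_inv \<epsilon>) \<noteq> {}" by blast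
  qed (rule cl)
  then obtain m where m01: "\<And>A. m A \<in> {0..1}" and m: "\<And>\<epsilon>. \<epsilon> > 0 \<Longrightarrow> m \<in> almost_inv \<epsilon>" by auto
  from m[of 1] have add: "m \<in> additive" by (simp add: almost_inv_def)
  have inv_S: "m (?t s A) = m A" if s: "s \<in> S" and A: "A \<subseteq> carrier G" for s A
  proof -
    have "\<bar>m (?t s A) - m A\<bar> \<le> 0"
    proof (rule field_le_epsilon)
      fix e :: real assume "e > 0"
      from m[OF this] show "\<bar>m (?t s A) - m A\<bar> \<le> 0 + e" using s A by (auto simp: almost_inv_def)
    qed
    then show ?thesis by simp
  qed
  have t_t: "?t g (?t h A) = ?t (g \<otimes> h) A"
    if "g \<in> carrier G" "h \<in> carrier G" "A \<subseteq> carrier G" for g h A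
    using that by (force simp: image_image m_assoc)
  have t_sub: "?t g A \<subseteq> carrier G" if "g \<in> carrier G" "A \<subseteq> carrier G" for g A
    using that by auto
  have t_one: "?t \<one> A = A" if "A \<subseteq> carrier G" for A
    using that by force
  have "\<forall>A. A \<subseteq> carrier G \<longrightarrow> m (?t g A) = m A" if "g \<in> generate G S" for g
    using that
  proof induction
    case one
    then show ?case by (simp add: t_one)
  next
    case (incl s)
    then show ?case by (simp add: inv_S)
  next
    case (inv s)
    show ?case
    proof (intro allI impI)
      fix A assume A: "A \<subseteq> carrier G"
      have s: "s \<in> carrier G" "inv s \<in> carrier G" using inv S by auto
      have "m (?t s (?t (inv s) A)) = m (?t (inv s) A)"
        using inv t_sub[OF s(2) A] by (rule inv_S)
      moreover have "?t s (?t (inv s) A) = A"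
        using s A by (simp add: t_t t_one)
      ultimately show "m (?t (inv s) A) = m A" by simp
    qed
  next
    case (eng g h)
    have "g \<in> carrier G" "h \<in> carrier G" using eng gen by auto
    then show ?case using eng.IH by (metis t_t t_sub)
  qed
  then have invG: "m (?t g A) = m A" if "g \<in> carrier G" "A \<subseteq> carrier G" for g A
    using that gen by auto
  show ?thesis
    unfolding amenable_def
    using add m01 invG by (intro exI[of _ m]) (auto simp: additive_def)
qed

section \<open>Operators on square-summable functions\<close>

text \<open>A norm bound stated through finite partial sums: Minkowski's inequality for finite sums applies directly,
and the bound survives pointwise limits.\<close>

definition l2_le :: "'a set \<Rightarrow> ('a \<Rightarrow> complex) \<Rightarrow> real \<Rightarrow> bool" where
  "l2_le A f C \<longleftrightarrow> (\<forall>x. x \<notin> A \<longrightarrow> f x = 0) \<and> 0 \<le> C \<and>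
     (\<forall>F. finite F \<longrightarrow> F \<subseteq> A \<longrightarrow> L2_set (\<lambda>x. cmod (f x)) F \<le> C)"

lemma l2_le_iff: "l2_le A f C \<longleftrightarrow> f \<in> l2_space A \<and> l2_norm A f \<le> C"
proof
  assume f: "l2_le A f C"
  have fin: "(\<Sum>x\<in>F. (cmod (f x))\<^sup>2) \<le> C\<^sup>2" if "finite F" "F \<subseteq> A" for F
  proof -
    have "L2_set (\<lambda>x. cmod (f x)) F \<le> C" "0 \<le> C" using f that by (auto simp: l2_le_def)
    then have "(L2_set (\<lambda>x. cmod (f x)) F)\<^sup>2 \<le> C\<^sup>2" by (intro power_mono) (auto simp: L2_set_nonneg)
    then show ?thesis by (simp add: L2_set_def sum_nonneg)
  qed
  have sm: "(\<lambda>x. (cmod (f x))\<^sup>2) summable_on A"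
    by (rule nonneg_bdd_above_summable_on) (auto intro!: bdd_aboveI2 fin)
  have "(\<Sum>\<^sub>\<infinity>x\<in>A. (cmod (f x))\<^sup>2) \<le> C\<^sup>2"
    by (rule infsum_le_finite_sums[OF sm]) (rule fin)
  then have "l2_norm A f \<le> C"
    unfolding l2_norm_def using f by (intro real_le_lsqrt) (auto simp: l2_le_def infsum_nonneg)
  then show "f \<in> l2_space A \<and> l2_norm A f \<le> C"
    using sm f by (auto simp: l2_space_def l2_le_def)
next
  assume f: "f \<in> l2_space A \<and> l2_norm A f \<le> C"
  then have sm: "(\<lambda>x. (cmod (f x))\<^sup>2) summable_on A" by (simp add: l2_space_def)
  have "L2_set (\<lambda>x. cmod (f x)) F \<le> C" if "finite F" "F \<subseteq> A" for F
  proof -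
    have "(\<Sum>x\<in>F. (cmod (f x))\<^sup>2) \<le> (\<Sum>\<^sub>\<infinity>x\<in>A. (cmod (f x))\<^sup>2)"
      using sm that by (intro finite_sum_le_infsum) auto
    then show ?thesis using f unfolding L2_set_def l2_norm_def by (meson order_trans real_sqrt_le_iff)
  qed
  moreover have "0 \<le> C" using f by (auto simp: l2_norm_def infsum_nonneg elim!: order_trans[rotated])
  ultimately show "l2_le A f C" using f by (auto simp: l2_le_def l2_space_def)
qed

lemma l2_le_norm: "f \<in> l2_space A \<Longrightarrow> l2_le A f (l2_norm A f)"
  by (simp add: l2_le_iff)

lemma l2_le_imp_space: "l2_le A f C \<Longrightarrow> f \<in> l2_space A"
  by (simp add: l2_le_iff)

lemma l2_space_imp_outside: "f \<in> l2_space A \<Longrightarrow> x \<notin> A \<Longrightarrow> f x = 0"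
  by (simp add: l2_space_def)

lemma l2_le_add:
  assumes "l2_le A f C" "l2_le A g D"
  shows "l2_le A (\<lambda>x. f x + g x) (C + D)"
proof -
  have "L2_set (\<lambda>x. cmod (f x + g x)) F \<le> C + D" if "finite F" "F \<subseteq> A" for F
  proof -
    have "L2_set (\<lambda>x. cmod (f x + g x)) F \<le> L2_set (\<lambda>x. cmod (f x) + cmod (g x)) F"
      by (intro L2_set_mono norm_triangle_ineq) auto
    also have "\<dots> \<le> L2_set (\<lambda>x. cmod (f x)) F + L2_set (\<lambda>x. cmod (g x)) F"
      by (rule L2_set_triangle_ineq)
    also have "\<dots> \<le> C + D"
      using assms that by (intro add_mono) (auto simp: l2_le_def)
    finally show ?thesis .
  qed
  then show ?thesis using assms by (auto simp: l2_le_def)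
qed

lemma l2_le_scale:
  assumes "l2_le A f C"
  shows "l2_le A (\<lambda>x. c * f x) (cmod c * C)"
  using assms by (auto simp: l2_le_def norm_mult L2_set_right_distrib[symmetric] intro!: mult_left_mono)

lemma l2_le_mono: "l2_le A f C \<Longrightarrow> C \<le> D \<Longrightarrow> l2_le A f D"
  by (auto simp: l2_le_def intro: order_trans)

lemma l2_le_cmod:
  assumes "l2_le A f C"
  shows "cmod (f x) \<le> C"
proof (cases "x \<in> A")
  case True
  then have "L2_set (\<lambda>x. cmod (f x)) {x} \<le> C"
    using assms by (auto simp: l2_le_def simp del: L2_set_insert)
  then show ?thesis by (simp add: L2_set_def)
qed (use assms in \<open>simp add: l2_le_def\<close>)

lemma l2_le_pointwise_limit:
  assumes "\<And>n. l2_le A (F n) C" and lim: "\<And>x. (\<lambda>n. F n x) \<longlonglongrightarrow> f x"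
  shows "l2_le A f C"
proof -
  have "f x = 0" if "x \<notin> A" for x
  proof -
    have "(\<lambda>n. F n x) = (\<lambda>n. 0)" using assms(1) that by (auto simp: l2_le_def)
    then show ?thesis using lim[of x] by (simp add: LIMSEQ_const_iff)
  qed
  moreover have "L2_set (\<lambda>x. cmod (f x)) B \<le> C" if "finite B" "B \<subseteq> A" for B
  proof (rule LIMSEQ_le_const2)
    show "(\<lambda>n. L2_set (\<lambda>x. cmod (F n x)) B) \<longlonglongrightarrow> L2_set (\<lambda>x. cmod (f x)) B"
      unfolding L2_set_def by (intro tendsto_intros lim)
    show "\<exists>N. \<forall>n\<ge>N. L2_set (\<lambda>x. cmod (F n x)) B \<le> C"
      using assms(1) that by (auto simp: l2_le_def)
  qed
  moreover have "0 \<le> C" using assms(1) by (auto simp: l2_le_def)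
  ultimately show ?thesis by (simp add: l2_le_def)
qed

lemma l2_space_add: "f \<in> l2_space A \<Longrightarrow> g \<in> l2_space A \<Longrightarrow> (\<lambda>x. f x + g x) \<in> l2_space A"
  by (rule l2_le_imp_space[OF l2_le_add[OF l2_le_norm l2_le_norm]])

lemma l2_space_scale: "f \<in> l2_space A \<Longrightarrow> (\<lambda>x. c * f x) \<in> l2_space A"
  by (rule l2_le_imp_space[OF l2_le_scale[OF l2_le_norm]])

lemma l2_space_diff: "f \<in> l2_space A \<Longrightarrow> g \<in> l2_space A \<Longrightarrow> (\<lambda>x. f x - c * g x) \<in> l2_space A"
  using l2_space_add[OF _ l2_space_scale, of f A g "- c"] by simp

lemma l2_bounded_operatorI:
  assumes "\<And>f C. l2_le A f C \<Longrightarrow> l2_le A (T f) (K * C)"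
    and "\<And>f g. f \<in> l2_space A \<Longrightarrow> g \<in> l2_space A \<Longrightarrow> T (\<lambda>x. f x + g x) = (\<lambda>x. T f x + T g x)"
    and "\<And>f c. f \<in> l2_space A \<Longrightarrow> T (\<lambda>x. c * f x) = (\<lambda>x. c * T f x)"
  shows "l2_bounded_operator A T"
  unfolding l2_bounded_operator_def using assms by (auto simp: l2_le_iff)

lemma l2_bounded_operatorE:
  assumes "l2_bounded_operator A T"
  obtains K where "K \<ge> 0" "\<forall>f C. l2_le A f C \<longrightarrow> l2_le A (T f) (K * C)"
proof -
  from assms obtain K where K: "\<forall>f\<in>l2_space A. l2_norm A (T f) \<le> K * l2_norm A f"
    and sp: "\<forall>f\<in>l2_space A. T f \<in> l2_space A"
    unfolding l2_bounded_operator_def by blast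
  have "l2_le A (T f) (\<bar>K\<bar> * C)" if f: "l2_le A f C" for f C
  proof -
    have "l2_norm A (T f) \<le> K * l2_norm A f" using f K by (simp add: l2_le_iff)
    also have "\<dots> \<le> \<bar>K\<bar> * l2_norm A f"
      by (intro mult_right_mono) (auto simp: l2_norm_def infsum_nonneg)
    also have "\<dots> \<le> \<bar>K\<bar> * C" using f by (intro mult_left_mono) (auto simp: l2_le_iff)
    finally show ?thesis using f sp by (simp add: l2_le_iff)
  qed
  then show thesis using that[of "\<bar>K\<bar>"] by simp
qed

lemma l2_bounded_operatorD:
  assumes "l2_bounded_operator A T"
  shows "f \<in> l2_space A \<Longrightarrow> T f \<in> l2_space A"
    "f \<in> l2_space A \<Longrightarrow> g \<in> l2_space A \<Longrightarrow> T (\<lambda>x. f x + g x) = (\<lambda>x. T f x + T g x)"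
    "f \<in> l2_space A \<Longrightarrow> T (\<lambda>x. c * f x) = (\<lambda>x. c * T f x)"
    "f \<in> l2_space A \<Longrightarrow> g \<in> l2_space A \<Longrightarrow> T (\<lambda>x. f x - c * g x) = (\<lambda>x. T f x - c * T g x)"
proof -
  show "f \<in> l2_space A \<Longrightarrow> T f \<in> l2_space A"
    "f \<in> l2_space A \<Longrightarrow> T (\<lambda>x. c * f x) = (\<lambda>x. c * T f x)"
    using assms by (auto simp: l2_bounded_operator_def)
  show add: "T (\<lambda>x. f x + g x) = (\<lambda>x. T f x + T g x)"
    if "f \<in> l2_space A" "g \<in> l2_space A" for f g
    using assms that by (auto simp: l2_bounded_operator_def)
  have scale: "T (\<lambda>x. c * f x) = (\<lambda>x. c * T f x)" if "f \<in> l2_space A" for f c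
    using assms that by (auto simp: l2_bounded_operator_def)
  show "T (\<lambda>x. f x - c * g x) = (\<lambda>x. T f x - c * T g x)"
    if "f \<in> l2_space A" "g \<in> l2_space A"
    using add[OF that(1) l2_space_scale[OF that(2)], of "- c"] scale[OF that(2), of "- c"] by simp
qed

lemma l2_bounded_operator_comp:
  assumes S: "l2_bounded_operator A S" and T: "l2_bounded_operator A T"
  shows "l2_bounded_operator A (\<lambda>f. S (T f))"
proof -
  obtain K where K: "\<forall>f C. l2_le A f C \<longrightarrow> l2_le A (S f) (K * C)" using S by (rule l2_bounded_operatorE)
  obtain L where L: "\<forall>f C. l2_le A f C \<longrightarrow> l2_le A (T f) (L * C)" using T by (rule l2_bounded_operatorE)
  show ?thesis
  proof (rule l2_bounded_operatorI[where K = "K * L"])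
    show "l2_le A (S (T f)) (K * L * C)" if "l2_le A f C" for f C
      using K[rule_format, OF L[rule_format, OF that]] by (simp add: mult.assoc)
  qed (simp_all add: l2_bounded_operatorD[OF S] l2_bounded_operatorD[OF T])
qed

lemma l2_bounded_operator_add_scaled:
  assumes S: "l2_bounded_operator A S" and T: "l2_bounded_operator A T"
  shows "l2_bounded_operator A (\<lambda>f x. S f x + k * T f x)"
proof -
  obtain K where K: "\<forall>f C. l2_le A f C \<longrightarrow> l2_le A (S f) (K * C)" using S by (rule l2_bounded_operatorE)
  obtain L where L: "\<forall>f C. l2_le A f C \<longrightarrow> l2_le A (T f) (L * C)" using T by (rule l2_bounded_operatorE)
  show ?thesis
  proof (rule l2_bounded_operatorI[where K = "K + cmod k * L"])
    show "l2_le A (\<lambda>x. S f x + k * T f x) ((K + cmod k * L) * C)" if "l2_le A f C" for f C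
      using l2_le_add[OF K[rule_format, OF that] l2_le_scale[OF L[rule_format, OF that]]] by (simp add: algebra_simps)
  qed (auto simp: l2_bounded_operatorD[OF S] l2_bounded_operatorD[OF T] algebra_simps)
qed

lemma l2_bounded_operator_scaled:
  "l2_bounded_operator A T \<Longrightarrow> l2_bounded_operator A (\<lambda>f x. k * T f x)"
proof -
  assume T: "l2_bounded_operator A T"
  have "l2_bounded_operator A (\<lambda>f x. 0)"
    by (rule l2_bounded_operatorI[where K = 0]) (auto simp: l2_le_def L2_set_def)
  from l2_bounded_operator_add_scaled[OF this T] show ?thesis by simp
qed

lemma l2_bounded_operator_id: "l2_bounded_operator A (\<lambda>f. f)"
  by (rule l2_bounded_operatorI[where K = 1]) simp_all

lemma l2_bounded_operator_cong:
  assumes "l2_bounded_operator A S" and eq: "\<And>f. f \<in> l2_space A \<Longrightarrow> S f = T f"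
  shows "l2_bounded_operator A T"
  using assms(1) unfolding l2_bounded_operator_def
  by (simp add: eq[symmetric] l2_space_add l2_space_scale)

text \<open>The series \<open>\<Sum>k. \<zeta> ^ k * U ^ k\<close> inverts \<open>1 - \<zeta> * U\<close>.  It is summed pointwise, because values are bounded by norms;
the norm bounds for the partial sums pass to the limit.  The third assumption, continuity for pointwise convergence, holds for operators whose value at a point
involves finitely many other points; it carries the telescoping identity over to the limit.\<close>

lemma neumann_series:
  fixes U :: "('a \<Rightarrow> complex) \<Rightarrow> ('a \<Rightarrow> complex)"
  assumes U: "l2_bounded_operator A U"
    and contr: "\<And>f C. l2_le A f C \<Longrightarrow> l2_le A (U f) C"
    and cont: "\<And>F f x. (\<And>y. (\<lambda>n. F n y) \<longlonglongrightarrow> f y) \<Longrightarrow> (\<lambda>n. U (F n) x) \<longlonglongrightarrow> U f x"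
    and \<zeta>: "cmod \<zeta> < 1"
  obtains R where "l2_bounded_operator A R"
    "\<And>f. f \<in> l2_space A \<Longrightarrow> R (\<lambda>x. f x - \<zeta> * U f x) = f"
    "\<And>f. f \<in> l2_space A \<Longrightarrow> (\<lambda>x. R f x - \<zeta> * U (R f) x) = f"
proof
  define S where "S n f x = (\<Sum>k<n. \<zeta> ^ k * (U ^^ k) f x)" for n f x
  define R where "R f x = (\<Sum>k. \<zeta> ^ k * (U ^^ k) f x)" for f x
  have pow: "l2_bounded_operator A (U ^^ k)" for k
  proof (induction k)
    case 0
    then show ?case using l2_bounded_operator_id by (simp add: id_def)
  next
    case (Suc k)
    then show ?case using l2_bounded_operator_comp[OF U Suc] by (simp add: o_def)
  qed
  have le_pow: "l2_le A ((U ^^ k) f) C" if "l2_le A f C" for k f C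
    using that by (induction k) (auto intro: contr)
  have summ: "summable (\<lambda>k. \<zeta> ^ k * (U ^^ k) f x)" if f: "f \<in> l2_space A" for f x
  proof (rule summable_comparison_test)
    show "\<exists>N. \<forall>n\<ge>N. norm (\<zeta> ^ n * (U ^^ n) f x) \<le> cmod \<zeta> ^ n * l2_norm A f"
      using l2_le_cmod[OF le_pow[OF l2_le_norm[OF f]]]
      by (auto simp: norm_mult norm_power intro!: mult_left_mono)
    show "summable (\<lambda>n. cmod \<zeta> ^ n * l2_norm A f)"
      using \<zeta> by (intro summable_mult2 summable_geometric) simp
  qed
  have S_R: "(\<lambda>n. S n f x) \<longlonglongrightarrow> R f x" if "f \<in> l2_space A" for f x
    unfolding S_def R_def by (rule summable_LIMSEQ[OF summ[OF that]])
  have S_le: "l2_le A (S n f) (1 / (1 - cmod \<zeta>) * C)" if f: "l2_le A f C" for n f C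
  proof -
    have C: "0 \<le> C" using f by (simp add: l2_le_def)
    have "l2_le A (S n f) ((\<Sum>k<n. cmod \<zeta> ^ k) * C)"
    proof (induction n)
      case 0
      then show ?case by (simp add: S_def l2_le_def L2_set_def)
    next
      case (Suc n)
      from l2_le_add[OF Suc l2_le_scale[OF le_pow[OF f], of "\<zeta> ^ n"]] show ?case
        by (simp add: S_def[abs_def] algebra_simps norm_power)
    qed
    moreover have "(\<Sum>k<n. cmod \<zeta> ^ k) \<le> 1 / (1 - cmod \<zeta>)"
      using \<zeta> by (simp add: sum_gp_strict divide_simps)
    ultimately show ?thesis using C by (elim l2_le_mono) (rule mult_right_mono)
  qed
  have R_le: "l2_le A (R f) (1 / (1 - cmod \<zeta>) * C)" if f: "l2_le A f C" for f C
    by (rule l2_le_pointwise_limit[OF S_le[OF f] S_R[OF l2_le_imp_space[OF f]]])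
  show R: "l2_bounded_operator A R"
  proof (rule l2_bounded_operatorI[OF R_le])
    fix f g assume fg: "f \<in> l2_space A" "g \<in> l2_space A"
    show "R (\<lambda>x. f x + g x) = (\<lambda>x. R f x + R g x)"
      unfolding R_def by (simp add: fun_eq_iff l2_bounded_operatorD[OF pow] fg distrib_left suminf_add summ)
  next
    fix f c assume f: "f \<in> l2_space A"
    show "R (\<lambda>x. c * f x) = (\<lambda>x. c * R f x)"
      unfolding R_def using suminf_mult[OF summ[OF f], of c]
      by (simp add: fun_eq_iff l2_bounded_operatorD[OF pow] f mult.left_commute)
  qed
  have tail: "(\<lambda>n. f x - \<zeta> ^ n * (U ^^ n) f x) \<longlonglongrightarrow> f x" if "f \<in> l2_space A" for f x
    using tendsto_diff[OF tendsto_const summable_LIMSEQ_zero[OF summ[OF that]], of "f x" x] by simp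
  fix f assume f: "f \<in> l2_space A"
  have f': "(\<lambda>x. f x - \<zeta> * U f x) \<in> l2_space A"
    using f by (intro l2_space_diff l2_bounded_operatorD[OF U])
  have tele: "S n (\<lambda>x. f x - \<zeta> * U f x) x = f x - \<zeta> ^ n * (U ^^ n) f x" for n x
  proof (induction n)
    case (Suc n)
    have "(U ^^ n) (\<lambda>x. f x - \<zeta> * U f x) = (\<lambda>x. (U ^^ n) f x - \<zeta> * (U ^^ n) (U f) x)"
      using f by (intro l2_bounded_operatorD[OF pow] l2_bounded_operatorD[OF U])
    then show ?case using Suc by (simp add: S_def funpow_swap1 algebra_simps)
  qed (simp add: S_def)
  show "R (\<lambda>x. f x - \<zeta> * U f x) = f"
  proof
    fix x
    show "R (\<lambda>x. f x - \<zeta> * U f x) x = f x"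
      using S_R[OF f', of x] tail[OF f, of x] unfolding tele by (rule LIMSEQ_unique)
  qed
  have tele2: "(\<lambda>x. S n f x - \<zeta> * U (S n f) x) = (\<lambda>x. f x - \<zeta> ^ n * (U ^^ n) f x)" for n
  proof (induction n)
    case 0
    have "U (\<lambda>x. 0 * f x) = (\<lambda>x. 0 * U f x)" using f by (rule l2_bounded_operatorD[OF U])
    then show ?case by (simp add: S_def[abs_def])
  next
    case (Suc n)
    have Sn: "S n f \<in> l2_space A" using S_le[OF l2_le_norm[OF f]] by (rule l2_le_imp_space)
    have Un: "(U ^^ n) f \<in> l2_space A" using f by (rule l2_bounded_operatorD[OF pow])
    have eq: "S (Suc n) f = (\<lambda>x. S n f x + \<zeta> ^ n * (U ^^ n) f x)" by (simp add: S_def[abs_def])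
    have "U (S (Suc n) f) = (\<lambda>x. U (S n f) x + \<zeta> ^ n * U ((U ^^ n) f) x)"
      unfolding eq using l2_bounded_operatorD(2)[OF U Sn l2_space_scale[OF Un]]
        l2_bounded_operatorD(3)[OF U Un] by simp
    then show ?case using fun_cong[OF Suc] by (simp add: fun_eq_iff eq algebra_simps)
  qed
  show "(\<lambda>x. R f x - \<zeta> * U (R f) x) = f"
  proof
    fix x
    have "(\<lambda>n. S n f x - \<zeta> * U (S n f) x) \<longlonglongrightarrow> R f x - \<zeta> * U (R f) x"
      by (intro tendsto_intros S_R[OF f] cont)
    moreover have "(\<lambda>n. S n f x - \<zeta> * U (S n f) x) \<longlonglongrightarrow> f x"
      using tail[OF f, of x] fun_cong[OF tele2, of _ x] by simp
    ultimately show "R f x - \<zeta> * U (R f) x = f x" by (rule LIMSEQ_unique)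
  qed
qed

section \<open>The spectrum over an involution and a Klein four-group\<close>

locale klein_involution_group = group G for G (structure) +
  fixes a b c d
  assumes gens_closed [simp]: "a \<in> carrier G" "b \<in> carrier G" "c \<in> carrier G" "d \<in> carrier G"
    and squares: "a \<otimes> a = \<one>" "b \<otimes> b = \<one>" "c \<otimes> c = \<one>" "d \<otimes> d = \<one>"
    and klein: "b \<otimes> c \<otimes> d = \<one>"
    and distinct_gens: "distinct [a, b, c, d]"
begin

lemma products:
  "b \<otimes> c = d" "c \<otimes> b = d" "b \<otimes> d = c" "d \<otimes> b = c" "c \<otimes> d = b" "d \<otimes> c = b"
proof -
  have invs: "inv b = b" "inv c = c" "inv d = d"
    using squares by (simp_all add: inv_equality)
  show bc: "b \<otimes> c = d"
    using klein squares by (metis gens_closed invs(3) inv_equality m_closed inv_inv)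
  have "inv (b \<otimes> c) = inv d" using bc by simp
  then show cb: "c \<otimes> b = d" by (simp add: inv_mult_group invs)
  show bd: "b \<otimes> d = c" using bc squares by (metis gens_closed l_one m_assoc)
  show "c \<otimes> d = b" using cb squares by (metis gens_closed l_one m_assoc)
  have "inv (b \<otimes> d) = inv c" using bd by simp
  then show "d \<otimes> b = c" by (simp add: inv_mult_group invs)
  show "d \<otimes> c = b" using bc squares by (metis gens_closed r_one m_assoc)
qed

lemma act_simps:
  assumes "x \<in> carrier G"
  shows "a \<otimes> (a \<otimes> x) = x" "b \<otimes> (b \<otimes> x) = x" "c \<otimes> (c \<otimes> x) = x" "d \<otimes> (d \<otimes> x) = x"
    "b \<otimes> (c \<otimes> x) = d \<otimes> x" "c \<otimes> (b \<otimes> x) = d \<otimes> x" "b \<otimes> (d \<otimes> x) = c \<otimes> x"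
    "d \<otimes> (b \<otimes> x) = c \<otimes> x" "c \<otimes> (d \<otimes> x) = b \<otimes> x" "d \<otimes> (c \<otimes> x) = b \<otimes> x"
  using assms by (simp_all add: m_assoc[symmetric] squares products)

lemma markov_apply:
  assumes "x \<in> carrier G"
  shows "markov_operator G {a, b, c, d} f x =
    (f (a \<otimes> x) + f (b \<otimes> x) + f (c \<otimes> x) + f (d \<otimes> x)) / 4"
proof -
  have "inv a = a" "inv b = b" "inv c = c" "inv d = d"
    using squares by (simp_all add: inv_equality)
  moreover have "card {a, b, c, d} = 4" using distinct_gens by simp
  ultimately show ?thesis using assms distinct_gens by (simp add: markov_operator_def add.assoc)
qed

lemma markov_outside: "x \<notin> carrier G \<Longrightarrow> markov_operator G {a, b, c, d} f x = 0"
  by (simp add: markov_operator_def)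

definition refl_a :: "('a \<Rightarrow> complex) \<Rightarrow> 'a \<Rightarrow> complex" where
  "refl_a f x = (if x \<in> carrier G then f (a \<otimes> x) else 0)"

text \<open>If \<open>P\<close> denotes the projection \<open>(1 + b + c + d) / 4\<close> onto the functions invariant under the Klein four-group,
then this is the reflection \<open>2 * P - 1\<close>, and \<open>4 * M = 1 + refl_a + 2 * refl_V\<close>.\<close>

definition refl_V :: "('a \<Rightarrow> complex) \<Rightarrow> 'a \<Rightarrow> complex" where
  "refl_V f x = (if x \<in> carrier G then (f (b \<otimes> x) + f (c \<otimes> x) + f (d \<otimes> x) - f x) / 2 else 0)"

lemma refl_a_contraction:
  assumes "l2_le (carrier G) f C"
  shows "l2_le (carrier G) (refl_a f) C"
proof -
  have "L2_set (\<lambda>x. cmod (refl_a f x)) F \<le> C" if F: "finite F" "F \<subseteq> carrier G" for F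
  proof -
    have "L2_set (\<lambda>x. cmod (refl_a f x)) F = L2_set (\<lambda>x. cmod (f x)) ((\<otimes>) a ` F)"
      unfolding L2_set_def using F inj_on_translation[OF gens_closed(1) F(2)]
      by (subst sum.reindex) (auto simp: refl_a_def subset_iff intro!: sum.cong)
    also have "\<dots> \<le> C"
    proof -
      have "finite ((\<otimes>) a ` F)" "(\<otimes>) a ` F \<subseteq> carrier G" using F by auto
      then show ?thesis using assms unfolding l2_le_def by blast
    qed
    finally show ?thesis .
  qed
  then show ?thesis using assms by (auto simp: l2_le_def refl_a_def)
qed

lemma householder_identity:
  fixes p q r s :: complex
  shows "(cmod ((q + r + s - p) / 2))\<^sup>2 + (cmod ((p + r + s - q) / 2))\<^sup>2 +
    (cmod ((p + q + s - r) / 2))\<^sup>2 + (cmod ((p + q + r - s) / 2))\<^sup>2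
    = (cmod p)\<^sup>2 + (cmod q)\<^sup>2 + (cmod r)\<^sup>2 + (cmod s)\<^sup>2"
  unfolding cmod_power2 by (simp add: power2_eq_square field_simps)

text \<open>On an orbit of the Klein four-group the operator is a Householder reflection of a four-dimensional space.
A finite set of points is enlarged to a union of orbits, and sums over it are averaged over the group.\<close>

lemma refl_V_contraction:
  assumes "l2_le (carrier G) f C"
  shows "l2_le (carrier G) (refl_V f) C"
proof -
  have "L2_set (\<lambda>x. cmod (refl_V f x)) F \<le> C" if F: "finite F" "F \<subseteq> carrier G" for F
  proof -
    define F' where "F' = F \<union> (\<otimes>) b ` F \<union> (\<otimes>) c ` F \<union> (\<otimes>) d ` F"
    have F': "finite F'" "F' \<subseteq> carrier G" "F \<subseteq> F'" using F by (auto simp: F'_def)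
    have cl: "s \<otimes> x \<in> F'" if xF: "x \<in> F'" and s: "s \<in> {b, c, d}" for x s
    proof -
      obtain y where "y \<in> F" and y: "x = y \<or> x = b \<otimes> y \<or> x = c \<otimes> y \<or> x = d \<otimes> y"
        using xF by (auto simp: F'_def)
      then have "y \<in> carrier G" using F by auto
      then have "s \<otimes> x \<in> {y, b \<otimes> y, c \<otimes> y, d \<otimes> y}" using s y by (auto simp: act_simps)
      then show ?thesis using \<open>y \<in> F\<close> by (auto simp: F'_def)
    qed
    have shift: "(\<Sum>x\<in>F'. h (s \<otimes> x)) = (\<Sum>x\<in>F'. h x)" if "s \<in> {b, c, d}" for h :: "'a \<Rightarrow> real" and s
      by (rule sum.reindex_bij_witness[of _ "(\<otimes>) s" "(\<otimes>) s"])
         (use that cl F'(2) in \<open>auto simp: act_simps subset_iff\<close>)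
    have avg: "4 * (\<Sum>x\<in>F'. h x) = (\<Sum>x\<in>F'. h x + h (b \<otimes> x) + h (c \<otimes> x) + h (d \<otimes> x))"
      for h :: "'a \<Rightarrow> real"
      by (simp add: sum.distrib shift)
    have "4 * (\<Sum>x\<in>F'. (cmod (refl_V f x))\<^sup>2) = 4 * (\<Sum>x\<in>F'. (cmod (f x))\<^sup>2)"
      unfolding avg
    proof (rule sum.cong[OF refl])
      fix x assume "x \<in> F'"
      then have x: "x \<in> carrier G" using F' by auto
      show "(cmod (refl_V f x))\<^sup>2 + (cmod (refl_V f (b \<otimes> x)))\<^sup>2 + (cmod (refl_V f (c \<otimes> x)))\<^sup>2 +
          (cmod (refl_V f (d \<otimes> x)))\<^sup>2 =
        (cmod (f x))\<^sup>2 + (cmod (f (b \<otimes> x)))\<^sup>2 + (cmod (f (c \<otimes> x)))\<^sup>2 + (cmod (f (d \<otimes> x)))\<^sup>2"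
        using householder_identity[of "f (b \<otimes> x)" "f (c \<otimes> x)" "f (d \<otimes> x)" "f x"] x
        by (simp add: refl_V_def act_simps add_ac)
    qed
    then have eq: "L2_set (\<lambda>x. cmod (refl_V f x)) F' = L2_set (\<lambda>x. cmod (f x)) F'"
      by (simp add: L2_set_def)
    have "L2_set (\<lambda>x. cmod (refl_V f x)) F \<le> L2_set (\<lambda>x. cmod (refl_V f x)) F'"
      unfolding L2_set_def using F' by (intro real_sqrt_le_mono sum_mono2) auto
    also have "\<dots> \<le> C" unfolding eq using assms F' by (auto simp: l2_le_def)
    finally show ?thesis .
  qed
  then show ?thesis using assms by (auto simp: l2_le_def refl_V_def)
qed

lemma refl_a_op: "l2_bounded_operator (carrier G) refl_a"
  by (rule l2_bounded_operatorI[where K = 1]) (auto simp: refl_a_contraction refl_a_def)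

lemma refl_V_op: "l2_bounded_operator (carrier G) refl_V"
  by (rule l2_bounded_operatorI[where K = 1])
     (auto simp: refl_V_contraction refl_V_def fun_eq_iff field_simps)

lemma markov_op: "l2_bounded_operator (carrier G) (markov_operator G {a, b, c, d})"
proof -
  have "l2_bounded_operator (carrier G) (\<lambda>f x. (1/4) * (f x + 1 * (refl_a f x + 2 * refl_V f x)))"
    by (intro l2_bounded_operator_scaled l2_bounded_operator_add_scaled l2_bounded_operator_id
        refl_a_op refl_V_op)
  then show ?thesis
  proof (rule l2_bounded_operator_cong, intro ext)
    fix f x assume "f \<in> l2_space (carrier G)"
    from l2_space_imp_outside[OF this, of x]
    show "(1/4) * (f x + 1 * (refl_a f x + 2 * refl_V f x)) = markov_operator G {a, b, c, d} f x"
      by (cases "x \<in> carrier G") (auto simp: markov_apply markov_outside refl_a_def refl_V_def field_simps)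
  qed
qed

text \<open>The two roots have product 1, so one of them lies inside the unit circle unless both lie on it; but then
they are conjugate, and their sum \<open>\<kappa>\<close> is real of modulus at most 2.\<close>

lemma joukowski_root:
  fixes \<kappa> :: complex
  assumes "\<kappa> \<notin> complex_of_real ` {-2..2}"
  obtains \<zeta> where "\<zeta> \<noteq> 0" "cmod \<zeta> < 1" "\<zeta> * \<zeta> - \<kappa> * \<zeta> + 1 = 0"
proof -
  define s where "s = csqrt (\<kappa>\<^sup>2 - 4)"
  define u v where "u = (\<kappa> + s) / 2" and "v = (\<kappa> - s) / 2"
  have s: "s * s = \<kappa> * \<kappa> - 4"
    using power2_csqrt[of "\<kappa>\<^sup>2 - 4"] by (simp add: s_def power2_eq_square)
  have uv: "u * v = 1" and sum: "u + v = \<kappa>"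
    using s by (simp_all add: u_def v_def field_simps)
  have ne: "u \<noteq> 0" "v \<noteq> 0" using uv by auto
  have roots: "u * u - \<kappa> * u + 1 = 0" "v * v - \<kappa> * v + 1 = 0"
    using uv unfolding sum[symmetric] by (simp_all add: algebra_simps)
  have nuv: "cmod u * cmod v = 1" using uv by (simp flip: norm_mult)
  consider "cmod u < 1" | "cmod v < 1" | "cmod u = 1"
    using nuv ne by (metis less_1_mult linorder_neqE_linordered_idom mult.commute mult_1 nless_le)
  then show thesis
  proof cases
    case 3
    have "v = cnj u"
      using uv 3 ne complex_norm_square[of u] by (metis mult_cancel_left of_real_1 one_power2)
    then have "\<kappa> = complex_of_real (2 * Re u)" using sum by (simp add: complex_eq_iff)
    moreover have "\<bar>Re u\<bar> \<le> 1" using abs_Re_le_cmod[of u] 3 by simp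
    ultimately show thesis using assms by (auto simp: abs_le_iff intro: image_eqI[of _ _ "2 * Re u"])
  qed (use that ne roots in auto)
qed

lemma mem_bands_if_square_bound:
  assumes "((4 * z - 1)\<^sup>2 - 5) / 2 \<in> complex_of_real ` {-2..2}"
  shows "z \<in> complex_of_real ` ({- 1/2..0} \<union> {1/2..1})"
proof -
  obtain k where k: "-2 \<le> k" "k \<le> 2" "((4 * z - 1)\<^sup>2 - 5) / 2 = complex_of_real k"
    using assms by auto
  define m where "m = sqrt (2 * k + 5)"
  have m: "1 \<le> m" "m \<le> 3" "m\<^sup>2 = 2 * k + 5"
    using k by (auto simp: m_def real_le_rsqrt real_le_lsqrt)
  have "(4 * z - 1)\<^sup>2 = complex_of_real (2 * k + 5)"
    using k(3) by (simp add: field_simps)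
  also have "\<dots> = (complex_of_real m)\<^sup>2" by (simp add: m(3)[symmetric])
  finally have "4 * z - 1 = complex_of_real m \<or> 4 * z - 1 = - complex_of_real m"
    by (simp add: power2_eq_iff)
  then have "z = complex_of_real ((1 + m) / 4) \<or> z = complex_of_real ((1 - m) / 4)"
    by (auto simp: field_simps)
  moreover have "(1 + m) / 4 \<in> {- 1/2..0} \<union> {1/2..1}" "(1 - m) / 4 \<in> {- 1/2..0} \<union> {1/2..1}"
    using m by auto
  ultimately show ?thesis by blast
qed

text \<open>With \<open>A = refl_a\<close>, \<open>J = refl_V\<close>, both involutions, and \<open>U = A * J\<close>, the operator \<open>4 * M - 1 = A + 2 * J\<close> has the square
\<open>5 + 2 * (U + U^-1)\<close>.  Hence \<open>M - z\<close> is invertible once \<open>U + U^-1 - \<kappa>\<close> is, where \<open>\<kappa> = ((4 * z - 1)^2 - 5) / 2\<close>.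
For \<open>\<kappa>\<close> outside \<open>[-2, 2]\<close> write \<open>\<kappa> = \<zeta> + 1 / \<zeta>\<close> with \<open>cmod \<zeta> < 1\<close>; then
\<open>- \<zeta> * (U + U^-1 - \<kappa>) = (1 - \<zeta> * U) * (1 - \<zeta> * U^-1)\<close>, and both factors are inverted by Neumann series.\<close>

theorem spectrum_subset: "sp G {a, b, c, d} \<subseteq> complex_of_real ` ({- 1/2..0} \<union> {1/2..1})"
proof (rule subsetI, rule ccontr)
  fix z assume z: "z \<in> sp G {a, b, c, d}" and "z \<notin> complex_of_real ` ({- 1/2..0} \<union> {1/2..1})"
  define \<mu> where "\<mu> = 4 * z - 1"
  define \<kappa> where "\<kappa> = (\<mu>\<^sup>2 - 5) / 2"
  have "\<kappa> \<notin> complex_of_real ` {-2..2}"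
    using mem_bands_if_square_bound \<open>z \<notin> _\<close> unfolding \<kappa>_def \<mu>_def by blast
  then obtain \<zeta> where \<zeta>: "\<zeta> \<noteq> 0" "cmod \<zeta> < 1" "\<zeta> * \<zeta> - \<kappa> * \<zeta> + 1 = 0"
    by (rule joukowski_root)
  let ?H = "l2_space (carrier G)"
  let ?M = "markov_operator G {a, b, c, d}"
  define U where "U f = refl_a (refl_V f)" for f
  \<comment> \<open>\<open>V\<close> is the inverse of \<open>U\<close>, and \<open>T\<close> is \<open>4 * M - 1 + \<mu>\<close>, the cofactor of \<open>4 * M - 1 - \<mu> = 4 * (M - z)\<close>.\<close>
  define V where "V f = refl_V (refl_a f)" for f
  define T where "T f x = (refl_a f x + 2 * refl_V f x) + \<mu> * f x" for f x
  have Uop: "l2_bounded_operator (carrier G) U" and Vop: "l2_bounded_operator (carrier G) V"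
    unfolding U_def[abs_def] V_def[abs_def]
    using l2_bounded_operator_comp[OF refl_a_op refl_V_op] l2_bounded_operator_comp[OF refl_V_op refl_a_op]
    by simp_all
  have Top: "l2_bounded_operator (carrier G) T"
    unfolding T_def[abs_def]
    using l2_bounded_operator_add_scaled[OF l2_bounded_operator_add_scaled[OF refl_a_op refl_V_op]
        l2_bounded_operator_id, of 2 \<mu>] .
  have pa: "(\<lambda>n. refl_a (F n) x) \<longlonglongrightarrow> refl_a f x" and pV: "(\<lambda>n. refl_V (F n) x) \<longlonglongrightarrow> refl_V f x"
    if "\<And>y. (\<lambda>n. F n y) \<longlonglongrightarrow> f y" for F f x
    using that by (auto simp: refl_a_def refl_V_def intro!: tendsto_intros)
  obtain R where R: "l2_bounded_operator (carrier G) R"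
      "\<And>f. f \<in> ?H \<Longrightarrow> R (\<lambda>x. f x - \<zeta> * U f x) = f"
      "\<And>f. f \<in> ?H \<Longrightarrow> (\<lambda>x. R f x - \<zeta> * U (R f) x) = f"
    by (rule neumann_series[OF Uop _ _ \<zeta>(2)]) (auto simp: U_def refl_a_contraction refl_V_contraction pa pV)
  obtain S where S: "l2_bounded_operator (carrier G) S"
      "\<And>f. f \<in> ?H \<Longrightarrow> S (\<lambda>x. f x - \<zeta> * V f x) = f"
      "\<And>f. f \<in> ?H \<Longrightarrow> (\<lambda>x. S f x - \<zeta> * V (S f) x) = f"
    by (rule neumann_series[OF Vop _ _ \<zeta>(2)]) (auto simp: V_def refl_a_contraction refl_V_contraction pa pV)
  \<comment> \<open>The factorisation of \<open>(4 * M - 1)^2 - \<mu>^2\<close>, with the cofactor on either side of \<open>M - z\<close>.\<close>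
  have TM: "- 2 * \<zeta> * (?M (T f) x - z * T f x) = (f x - \<zeta> * V f x) - \<zeta> * U (\<lambda>x. f x - \<zeta> * V f x) x"
    and MT: "- 2 * \<zeta> * (T (\<lambda>x. ?M f x - z * f x) x) = (f x - \<zeta> * V f x) - \<zeta> * U (\<lambda>x. f x - \<zeta> * V f x) x"
    if f: "f \<in> ?H" for f x
  proof -
    have k: "\<zeta> * (\<mu> * \<mu>) = 2 * (\<zeta> * \<zeta> + 1) + 5 * \<zeta>"
      using \<zeta>(3) by (simp add: \<kappa>_def field_simps power2_eq_square)
    have z: "z = (\<mu> + 1) / 4" by (simp add: \<mu>_def)
    have M: "?M h y = (h y + refl_a h y + 2 * refl_V h y) / 4" if "h \<in> ?H" for h y
      using l2_space_imp_outside[OF that, of y]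
      by (cases "y \<in> carrier G") (auto simp: markov_apply markov_outside refl_a_def refl_V_def field_simps)
    have lin: "refl_a (\<lambda>y. g y + k * h y) x = refl_a g x + k * refl_a h x"
      "refl_V (\<lambda>y. g y + k * h y) x = refl_V g x + k * refl_V h x" for g h k x
      by (auto simp: refl_a_def refl_V_def field_simps)
    have sq: "refl_a (refl_a h) = h" "refl_V (refl_V h) = h" if "h \<in> ?H" for h
      using l2_space_imp_outside[OF that]
      by (auto simp: refl_a_def refl_V_def act_simps fun_eq_iff field_simps)
    have Tf: "T f = (\<lambda>y. (refl_a f y + 2 * refl_V f y) + \<mu> * f y)" by (simp add: T_def fun_eq_iff)
    have Mf: "(\<lambda>y. ?M f y - z * f y) = (\<lambda>y. (1/4) * ((refl_a f y + 2 * refl_V f y) + (- \<mu>) * f y))"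
      by (simp add: fun_eq_iff M[OF f] z field_simps)
    have Mf': "(\<lambda>y. ?M f y - z * f y) \<in> ?H" by (intro l2_space_diff f l2_bounded_operatorD[OF markov_op])
    have aT: "refl_a (T f) x = f x + 2 * U f x + \<mu> * refl_a f x"
      and VT: "refl_V (T f) x = V f x + 2 * f x + \<mu> * refl_V f x"
      unfolding Tf lin by (simp_all add: sq f U_def V_def)
    have scl: "refl_a (\<lambda>y. k * h y) x = k * refl_a h x" "refl_V (\<lambda>y. k * h y) x = k * refl_V h x" for h k x
      by (auto simp: refl_a_def refl_V_def field_simps)
    have aM: "refl_a (\<lambda>y. ?M f y - z * f y) x = (f x + 2 * U f x - \<mu> * refl_a f x) / 4"
      and VM: "refl_V (\<lambda>y. ?M f y - z * f y) x = (V f x + 2 * f x - \<mu> * refl_V f x) / 4"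
      unfolding Mf lin scl by (simp_all add: sq f U_def V_def)
    have rhs: "(f x - \<zeta> * V f x) - \<zeta> * U (\<lambda>x. f x - \<zeta> * V f x) x
        = (1 + \<zeta> * \<zeta>) * f x - \<zeta> * (U f x + V f x)"
    proof -
      have "U (\<lambda>x. f x - \<zeta> * V f x) x = U f x - \<zeta> * U (V f) x"
        by (simp add: l2_bounded_operatorD(4)[OF Uop f l2_bounded_operatorD(1)[OF Vop f]])
      moreover have "U (V f) = f"
        by (simp add: U_def V_def sq f l2_bounded_operatorD(1)[OF refl_a_op f])
      ultimately have "U (\<lambda>x. f x - \<zeta> * V f x) x = U f x - \<zeta> * f x" by simp
      then show ?thesis by (simp only:) (simp add: algebra_simps)
    qed
    have k': "\<mu> * (\<mu> * (\<zeta> * h)) = 2 * h + 2 * (\<zeta> * (\<zeta> * h)) + 5 * (\<zeta> * h)" for h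
      using arg_cong[OF k, of "\<lambda>t. t * h"] by (simp add: algebra_simps)
    show "- 2 * \<zeta> * (?M (T f) x - z * T f x) = (f x - \<zeta> * V f x) - \<zeta> * U (\<lambda>x. f x - \<zeta> * V f x) x"
      unfolding rhs M[OF l2_bounded_operatorD(1)[OF Top f]] aT VT
      by (simp add: T_def z field_simps k')
    show "- 2 * \<zeta> * (T (\<lambda>x. ?M f x - z * f x) x) = (f x - \<zeta> * V f x) - \<zeta> * U (\<lambda>x. f x - \<zeta> * V f x) x"
      unfolding rhs T_def aM VM
      by (simp add: M[OF f] z field_simps k')
  qed
  \<comment> \<open>A right and a left inverse of \<open>M - z\<close>; they coincide.\<close>
  define Q where "Q f = (\<lambda>x. - 2 * \<zeta> * T (S (R f)) x)" for f
  define Q' where "Q' f = (\<lambda>x. - 2 * \<zeta> * S (R (T f)) x)" for f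
  have Qop: "l2_bounded_operator (carrier G) Q"
    unfolding Q_def[abs_def]
    using l2_bounded_operator_scaled[OF l2_bounded_operator_comp[OF Top
        l2_bounded_operator_comp[OF S(1) R(1)]], of "- 2 * \<zeta>"] .
  note sp = l2_bounded_operatorD(1)
  have right: "(\<lambda>x. ?M (Q f) x - z * Q f x) = f" if f: "f \<in> ?H" for f
  proof
    fix x
    define g where "g = S (R f)"
    have g: "g \<in> ?H" unfolding g_def by (intro sp[OF S(1)] sp[OF R(1)] f)
    have "?M (Q f) x - z * Q f x = - 2 * \<zeta> * (?M (T g) x - z * T g x)"
      unfolding Q_def g_def[symmetric] l2_bounded_operatorD(3)[OF markov_op sp[OF Top g]]
      by (simp add: algebra_simps)
    also have "\<dots> = (g x - \<zeta> * V g x) - \<zeta> * U (\<lambda>x. g x - \<zeta> * V g x) x" by (rule TM[OF g])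
    also have "(\<lambda>x. g x - \<zeta> * V g x) = R f" unfolding g_def by (rule S(3)[OF sp[OF R(1) f]])
    finally show "?M (Q f) x - z * Q f x = f x"
      using fun_cong[OF R(3)[OF f], of x] fun_cong[OF S(3)[OF sp[OF R(1) f]], of x] by (simp add: g_def)
  qed
  have left: "Q' (\<lambda>x. ?M f x - z * f x) = f" if f: "f \<in> ?H" for f
  proof -
    let ?h = "\<lambda>x. f x - \<zeta> * V f x"
    let ?m = "\<lambda>x. ?M f x - z * f x"
    have h: "?h \<in> ?H" by (intro l2_space_diff f sp[OF Vop])
    have m: "?m \<in> ?H" by (intro l2_space_diff f sp[OF markov_op])
    have "Q' ?m = S (R (\<lambda>x. - 2 * \<zeta> * T ?m x))"
      unfolding Q'_def l2_bounded_operatorD(3)[OF R(1) sp[OF Top m]]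
        l2_bounded_operatorD(3)[OF S(1) sp[OF R(1) sp[OF Top m]]] ..
    also have "(\<lambda>x. - 2 * \<zeta> * T ?m x) = (\<lambda>x. ?h x - \<zeta> * U ?h x)" using MT[OF f] by simp
    also have "S (R \<dots>) = f" by (simp only: R(2)[OF h] S(2)[OF f])
    finally show ?thesis .
  qed
  have "Q (\<lambda>x. ?M f x - z * f x) = f" if f: "f \<in> ?H" for f
  proof -
    let ?m = "\<lambda>x. ?M f x - z * f x"
    have m: "?m \<in> ?H" by (intro l2_space_diff f sp[OF markov_op])
    have "Q' (\<lambda>x. ?M (Q ?m) x - z * Q ?m x) = Q ?m" by (rule left[OF sp[OF Qop m]])
    then show ?thesis by (simp only: right[OF m] left[OF f])
  qed
  with right Qop z show False unfolding sp_def l2_spectrum_def by blast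
qed

end

context klein_involution_group
begin

text \<open>Cut a unimodular local eigenfunction off to a Folner set \<open>\<Phi>\<close>.  The result \<open>f\<close> has norm \<open>sqrt (card \<Phi>)\<close>, while
\<open>M f - \<nu> * f\<close> is bounded and vanishes except near the boundary of \<open>\<Phi>\<close>, so its norm is a small multiple of
\<open>sqrt (card \<Phi>)\<close>.  A bounded inverse of \<open>M - \<nu>\<close> cannot map a vector that small to \<open>f\<close>.\<close>

lemma approximate_eigenvalue_in_spectrum:
  assumes fol: "folner G {a, b, c, d}"
    and local: "\<And>F. finite F \<Longrightarrow> F \<subseteq> carrier G \<Longrightarrow> \<exists>\<psi>. (\<forall>x. cmod (\<psi> x) = 1) \<and>
      (\<forall>x\<in>F. \<psi> (a \<otimes> x) + \<psi> (b \<otimes> x) + \<psi> (c \<otimes> x) + \<psi> (d \<otimes> x) = 4 * \<nu> * \<psi> x)"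
  shows "\<nu> \<in> sp G {a, b, c, d}"
proof (rule ccontr)
  let ?M = "markov_operator G {a, b, c, d}" and ?S = "{a, b, c, d}"
  assume "\<nu> \<notin> sp G {a, b, c, d}"
  then obtain R where R: "l2_bounded_operator (carrier G) R"
    and inv: "\<forall>f\<in>l2_space (carrier G). R (\<lambda>x. ?M f x - \<nu> * f x) = f"
    unfolding sp_def l2_spectrum_def by blast
  obtain K where K: "K \<ge> 0" "\<forall>f C. l2_le (carrier G) f C \<longrightarrow> l2_le (carrier G) (R f) (K * C)"
    using R by (rule l2_bounded_operatorE)
  define L where "L = 1 + cmod \<nu>"
  have L: "L > 0" by (simp add: L_def add_pos_nonneg)
  \<comment> \<open>The boundary contributes at most \<open>8 * \<epsilon> * card \<Phi>\<close> points, two sets for each of four generators; this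
    \<open>\<epsilon>\<close> makes \<open>K * L * sqrt (8 * \<epsilon>) < 1\<close>.\<close>
  define \<epsilon> where "\<epsilon> = 1 / (8 * (K * L + 1)\<^sup>2)"
  have KL: "K * L + 1 > 0" using K L by (simp add: add_nonneg_pos)
  have "\<epsilon> > 0" using KL by (simp add: \<epsilon>_def)
  obtain \<Phi> where \<Phi>: "finite \<Phi>" "\<Phi> \<noteq> {}" "\<Phi> \<subseteq> carrier G"
    and small: "\<And>s. s \<in> ?S \<Longrightarrow> real (card ((\<otimes>) s ` \<Phi> - \<Phi>)) \<le> \<epsilon> * real (card \<Phi>)"
    using fol[unfolded folner_def, rule_format, OF \<open>\<epsilon> > 0\<close>] by metis
  obtain \<psi> where \<psi>: "\<And>x. cmod (\<psi> x) = 1"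
    and eig: "\<And>x. x \<in> \<Phi> \<Longrightarrow> \<psi> (a \<otimes> x) + \<psi> (b \<otimes> x) + \<psi> (c \<otimes> x) + \<psi> (d \<otimes> x) = 4 * \<nu> * \<psi> x"
    using local[OF \<Phi>(1,3)] by blast
  define f where "f x = (if x \<in> \<Phi> then \<psi> x else 0)" for x
  define h where "h x = ?M f x - \<nu> * f x" for x
  define D where "D s = (\<otimes>) s ` \<Phi> - \<Phi>" for s
  define B where "B = (\<Union>s\<in>?S. D s \<union> (\<otimes>) s ` D s)"
  have finD: "finite (D s)" for s using \<Phi> by (simp add: D_def)
  have finB: "finite B" by (simp add: B_def finD)
  have cardD: "real (card (D s \<union> (\<otimes>) s ` D s)) \<le> 2 * (\<epsilon> * real (card \<Phi>))" if "s \<in> ?S" for s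
  proof -
    have "card (D s \<union> (\<otimes>) s ` D s) \<le> card (D s) + card (D s)"
      using card_Un_le card_image_le[OF finD] by (meson add_left_mono order_trans)
    moreover have "real (card (D s)) \<le> \<epsilon> * real (card \<Phi>)" using small that by (simp add: D_def)
    ultimately show ?thesis by linarith
  qed
  have "card B \<le> (\<Sum>s\<in>?S. card (D s \<union> (\<otimes>) s ` D s))"
    unfolding B_def by (rule card_UN_le) simp
  then have "real (card B) \<le> (\<Sum>s\<in>?S. real (card (D s \<union> (\<otimes>) s ` D s)))"
    by (simp flip: of_nat_sum)
  also have "\<dots> \<le> (\<Sum>s\<in>?S. 2 * (\<epsilon> * real (card \<Phi>)))" by (rule sum_mono) (rule cardD)
  also have "\<dots> = 8 * \<epsilon> * real (card \<Phi>)" using distinct_gens by simp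
  finally have cardB: "real (card B) \<le> 8 * \<epsilon> * real (card \<Phi>)" .
  have twice: "s \<otimes> (s \<otimes> x) = x" if "s \<in> ?S" "x \<in> carrier G" for s x
    using that by (auto simp: act_simps)
  have SG: "s \<in> carrier G" if "s \<in> ?S" for s using that by auto
  have h0: "h x = 0" if x: "x \<notin> B" for x
  proof (cases "x \<in> \<Phi>")
    case True
    have "s \<otimes> x \<in> \<Phi>" if s: "s \<in> ?S" for s
    proof (rule ccontr)
      assume "s \<otimes> x \<notin> \<Phi>"
      then have "s \<otimes> x \<in> D s" using True by (simp add: D_def)
      then have "s \<otimes> (s \<otimes> x) \<in> (\<otimes>) s ` D s" by (rule imageI)
      then have "s \<otimes> (s \<otimes> x) \<in> B" unfolding B_def using s by blast
      moreover have "s \<otimes> (s \<otimes> x) = x" using True \<Phi>(3) s by (intro twice) auto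
      ultimately show False using x by simp
    qed
    then have "a \<otimes> x \<in> \<Phi>" "b \<otimes> x \<in> \<Phi>" "c \<otimes> x \<in> \<Phi>" "d \<otimes> x \<in> \<Phi>" by auto
    moreover have "x \<in> carrier G" using True \<Phi>(3) by auto
    ultimately show ?thesis using eig[OF True] True by (simp add: h_def markov_apply f_def)
  next
    case False
    show ?thesis
    proof (cases "x \<in> carrier G")
      case True
      have "s \<otimes> x \<notin> \<Phi>" if s: "s \<in> ?S" for s
      proof
        assume "s \<otimes> x \<in> \<Phi>"
        then have "s \<otimes> (s \<otimes> x) \<in> (\<otimes>) s ` \<Phi>" by (rule imageI)
        then have "x \<in> D s" using False twice[OF s True] by (simp add: D_def)
        then show False using x s by (auto simp: B_def)
      qed
      then show ?thesis using False True by (simp add: h_def markov_apply f_def)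
    qed (simp add: h_def f_def False markov_outside)
  qed
  have f1: "cmod (f x) \<le> 1" for x by (simp add: f_def \<psi>)
  have hL: "cmod (h x) \<le> L" for x
  proof -
    have "cmod (?M f x) \<le> 1"
    proof (cases "x \<in> carrier G")
      case True
      have "cmod (f (a \<otimes> x) + f (b \<otimes> x) + f (c \<otimes> x) + f (d \<otimes> x)) \<le> 1 + 1 + 1 + 1"
        by (intro order_trans[OF norm_triangle_ineq] add_mono f1)
      then show ?thesis using True by (simp add: markov_apply norm_divide)
    qed (simp add: markov_outside)
    moreover have "cmod (\<nu> * f x) \<le> cmod \<nu>"
      unfolding norm_mult using f1[of x] by (intro mult_left_le) auto
    ultimately show ?thesis
      unfolding h_def L_def using norm_triangle_ineq4[of "?M f x" "\<nu> * f x"] by linarith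
  qed
  define C where "C = sqrt (8 * \<epsilon> * real (card \<Phi>)) * L"
  have "l2_le (carrier G) h C"
    unfolding l2_le_def
  proof (intro conjI allI impI)
    show "0 \<le> C" using L \<open>\<epsilon> > 0\<close> by (simp add: C_def)
    show "h x = 0" if "x \<notin> carrier G" for x
      using that \<Phi>(3) by (auto simp: h_def markov_outside f_def)
    fix F assume F: "finite F" "F \<subseteq> carrier G"
    have "(\<Sum>x\<in>F. (cmod (h x))\<^sup>2) = (\<Sum>x\<in>F \<inter> B. (cmod (h x))\<^sup>2)"
      using F by (intro sum.mono_neutral_right) (auto simp: h0)
    also have "\<dots> \<le> (\<Sum>x\<in>F \<inter> B. L\<^sup>2)" by (intro sum_mono power_mono hL) simp
    also have "\<dots> = real (card (F \<inter> B)) * L\<^sup>2" by simp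
    also have "\<dots> \<le> (8 * \<epsilon> * real (card \<Phi>)) * L\<^sup>2"
    proof (rule mult_right_mono)
      have "card (F \<inter> B) \<le> card B" using finB by (intro card_mono) auto
      then show "real (card (F \<inter> B)) \<le> 8 * \<epsilon> * real (card \<Phi>)" using cardB by linarith
    qed simp
    also have "\<dots> = C\<^sup>2" using \<open>\<epsilon> > 0\<close> by (simp add: C_def power_mult_distrib)
    finally show "L2_set (\<lambda>x. cmod (h x)) F \<le> C"
      unfolding L2_set_def using \<open>0 \<le> C\<close> by (rule real_le_lsqrt[rotated 1])
  qed
  then have "l2_le (carrier G) (R h) (K * C)" using K(2) by blast
  moreover have "f \<in> l2_space (carrier G)"
  proof -
    have "(\<lambda>x. (cmod (f x))\<^sup>2) summable_on \<Phi>" using \<Phi>(1) by simp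
    then have "(\<lambda>x. (cmod (f x))\<^sup>2) summable_on carrier G"
      by (rule summable_on_cong_neutral[THEN iffD1, rotated -1]) (use \<Phi>(3) in \<open>auto simp: f_def\<close>)
    then show ?thesis using \<Phi>(3) by (auto simp: l2_space_def f_def)
  qed
  then have "R h = f" unfolding h_def[abs_def] using inv by blast
  ultimately have "L2_set (\<lambda>x. cmod (f x)) \<Phi> \<le> K * C"
    using \<Phi> by (auto simp: l2_le_def)
  then have "sqrt (real (card \<Phi>)) \<le> K * C"
    by (simp add: L2_set_def f_def \<psi>)
  also have "K * C = (K * L * sqrt (8 * \<epsilon>)) * sqrt (real (card \<Phi>))"
    by (simp add: C_def real_sqrt_mult)
  finally have "1 \<le> K * L * sqrt (8 * \<epsilon>)"
    using \<Phi> by (simp add: card_gt_0_iff)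
  also have "sqrt (8 * \<epsilon>) = 1 / (K * L + 1)"
    using KL by (simp add: \<epsilon>_def real_sqrt_divide)
  also have "K * L * (1 / (K * L + 1)) < 1"
    using KL by simp
  finally show False by simp
qed

end

section \<open>Words acting on decorated trees\<close>

text \<open>\<open>None\<close> stands for \<open>a\<close>, and \<open>Some x\<close> for that one of \<open>b, c, d\<close> which does nothing below the vertex \<open>w\<^sub>n\<close> when
\<open>\<omega>\<^sub>n = x\<close>: the symbols 0, 1, 2 name \<open>d\<close>, \<open>c\<close>, \<open>b\<close>.  In this notation the three letters play symmetric roles.\<close>

type_synonym letter = "symbol option"

type_synonym word = "letter list"

text \<open>Words are evaluated without forming a free product: a group with marked generators is the image of \<open>ev act\<close>,
and the relations between the generators are the words with value \<open>id\<close>.\<close>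

fun ev :: "(letter \<Rightarrow> 'x \<Rightarrow> 'x) \<Rightarrow> word \<Rightarrow> 'x \<Rightarrow> 'x" where
  "ev act [] = id"
| "ev act (s # w) = act s \<circ> ev act w"

lemma ev_append: "ev act (u @ v) = ev act u \<circ> ev act v"
  by (induction u) (auto simp: o_assoc)

lemma ev_append_apply: "ev act (u @ v) p = ev act u (ev act v p)"
  by (simp add: ev_append)

locale klein_action =
  fixes act :: "letter \<Rightarrow> 'x \<Rightarrow> 'x"
  assumes invol [simp]: "act s (act s p) = p"
    and klein: "distinct [x, y, z] \<Longrightarrow> act (Some x) (act (Some y) p) = act (Some z) p"
begin

lemma ev_rev: "ev act (rev w) (ev act w p) = p"
  by (induction w arbitrary: p) (auto simp: ev_append_apply)

lemma ev_rev': "ev act w (ev act (rev w) p) = p"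
  using ev_rev[of "rev w"] by simp

lemma inj_ev: "inj (ev act w)"
  by (metis ev_rev injI)

end

definition shift :: "(nat \<Rightarrow> symbol) \<Rightarrow> nat \<Rightarrow> symbol" where
  "shift \<eta> n = \<eta> (Suc n)"

text \<open>The generators act on pairs of a vertex and a decoration \<open>i\<close>.  A generator is replaced by its sections while it moves
down along the vertex; if a generator arrives at the end of the vertex, it acts on the decoration through \<open>L\<close>.  The sequence \<open>\<eta>\<close> is
\<open>\<omega>\<close> with indices starting at 0, so that passing to a subtree is a shift.\<close>

fun dec_a :: "(letter \<Rightarrow> 'l \<Rightarrow> 'l) \<Rightarrow> bool list \<times> 'l \<Rightarrow> bool list \<times> 'l" where
  "dec_a L ([], i) = ([], L None i)"
| "dec_a L (y # u, i) = ((\<not> y) # u, i)"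

fun dec_v :: "(letter \<Rightarrow> 'l \<Rightarrow> 'l) \<Rightarrow> (nat \<Rightarrow> symbol) \<Rightarrow> symbol \<Rightarrow> bool list \<times> 'l \<Rightarrow> bool list \<times> 'l" where
  "dec_v L \<eta> x ([], i) = ([], L (Some x) i)"
| "dec_v L \<eta> x (False # u, i) = apfst ((#) False) (if x = \<eta> 0 then (u, i) else dec_a L (u, i))"
| "dec_v L \<eta> x (True # u, i) = apfst ((#) True) (dec_v L (shift \<eta>) x (u, i))"

definition dec_act :: "(letter \<Rightarrow> 'l \<Rightarrow> 'l) \<Rightarrow> (nat \<Rightarrow> symbol) \<Rightarrow> letter \<Rightarrow> bool list \<times> 'l \<Rightarrow> bool list \<times> 'l" where
  "dec_act L \<eta> s = (case s of None \<Rightarrow> dec_a L | Some x \<Rightarrow> dec_v L \<eta> x)"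

definition tree_act :: "(nat \<Rightarrow> symbol) \<Rightarrow> letter \<Rightarrow> bool list \<Rightarrow> bool list" where
  "tree_act \<eta> s u = fst (dec_act (\<lambda>_. id) \<eta> s (u, ()))"

abbreviation tev :: "(nat \<Rightarrow> symbol) \<Rightarrow> word \<Rightarrow> bool list \<Rightarrow> bool list" where
  "tev \<eta> \<equiv> ev (tree_act \<eta>)"

lemma dec_act_simps [simp]:
  "dec_act L \<eta> None = dec_a L" "dec_act L \<eta> (Some x) = dec_v L \<eta> x"
  by (simp_all add: dec_act_def)

lemma fst_dec_a: "fst (dec_a L (u, i)) = fst (dec_a L' (u, i'))"
  by (cases u) auto

lemma fst_dec_v: "fst (dec_v L \<eta> x (u, i)) = fst (dec_v L' \<eta> x (u, i'))"
proof (induction u arbitrary: \<eta>)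
  case (Cons y u)
  then show ?case using fst_dec_a[of L u i L' i'] by (cases y) auto
qed simp

lemma fst_dec_act: "fst (dec_act L \<eta> s p) = tree_act \<eta> s (fst p)"
  by (cases s; cases p) (auto simp: tree_act_def intro: fst_dec_a fst_dec_v)

lemma fst_ev_dec: "fst (ev (dec_act L \<eta>) w p) = tev \<eta> w (fst p)"
  by (induction w) (auto simp: fst_dec_act)

lemma tree_act_simps [simp]:
  "tree_act \<eta> s [] = []"
  "tree_act \<eta> None (y # u) = (\<not> y) # u"
  "tree_act \<eta> (Some x) (False # u) = False # (if x = \<eta> 0 then u else tree_act \<eta> None u)"
  "tree_act \<eta> (Some x) (True # u) = True # tree_act (shift \<eta>) (Some x) u"
  by (cases s) (auto simp: tree_act_def)

lemma length_tree_act [simp]: "length (tree_act \<eta> s u) = length u"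
proof (induction u arbitrary: \<eta> s)
  case (Cons y u)
  then show ?case
    by (cases s; cases y) auto
qed simp

lemma length_ev_tree [simp]: "length (tev \<eta> w u) = length u"
  by (induction w) auto

lemma length_fst_ev_dec [simp]: "length (fst (ev (dec_act L \<eta>) w p)) = length (fst p)"
  by (simp add: fst_ev_dec)

lemma klein_dec_act:
  assumes "klein_action L"
  shows "klein_action (dec_act L \<eta>)"
proof -
  interpret klein_action L by fact
  have aa: "dec_a L (dec_a L p) = p" for p
    by (cases p; cases "fst p") auto
  have vv: "dec_v L \<eta> x (dec_v L \<eta> x (u, i)) = (u, i)" for \<eta> x u i
  proof (induction u arbitrary: \<eta>)
    case (Cons y u)
    then show ?case
      using aa[of "(u, i)"] Cons[of "shift \<eta>"]
      by (cases y; cases "dec_a L (u, i)"; cases "dec_v L (shift \<eta>) x (u, i)") auto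
  qed simp
  have kl: "dec_v L \<eta> x (dec_v L \<eta> y (u, i)) = dec_v L \<eta> z (u, i)" if d: "distinct [x, y, z]" for \<eta> x y z u i
  proof (induction u arbitrary: \<eta>)
    case Nil
    then show ?case using klein[OF d] by simp
  next
    case (Cons b u)
    have "\<eta> 0 \<in> {x, y, z}" using d by (cases x; cases y; cases z; cases "\<eta> 0") auto
    then show ?case
      using d aa[of "(u, i)"] Cons[of "shift \<eta>"]
      by (cases b; cases "dec_a L (u, i)"; cases "dec_v L (shift \<eta>) y (u, i)") auto
  qed
  show ?thesis
  proof
    fix s :: "letter" and p
    show "dec_act L \<eta> s (dec_act L \<eta> s p) = p" by (cases s; cases p) (auto simp: aa vv)
  next
    fix x y z :: symbol and p :: "bool list \<times> 'a"
    assume "distinct [x, y, z]"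
    then show "dec_act L \<eta> (Some x) (dec_act L \<eta> (Some y) p) = dec_act L \<eta> (Some z) p"
      by (cases p) (simp only: dec_act_simps kl)
  qed
qed

lemma klein_action_trivial: "klein_action (\<lambda>_. id)"
  by unfold_locales auto

lemma klein_tree_act: "klein_action (tree_act \<eta>)"
proof -
  interpret D: klein_action "dec_act (\<lambda>_. id :: unit \<Rightarrow> unit) \<eta>"
    by (intro klein_dec_act klein_action_trivial)
  have *: "tree_act \<eta> s (tree_act \<eta> t u) = fst (dec_act (\<lambda>_. id) \<eta> s (dec_act (\<lambda>_. id) \<eta> t (u, ())))" for s t u
    by (simp add: fst_dec_act)
  show ?thesis
    by unfold_locales (auto simp: * D.klein simp del: distinct.simps dec_act_simps, auto simp: tree_act_def)
qed

interpretation tree: klein_action "tree_act \<eta>" by (rule klein_tree_act)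

section \<open>Sections of words\<close>

text \<open>\<open>out w y\<close> is the first letter of the image of a vertex \<open>y # u\<close> under \<open>w\<close>, and the word \<open>sec \<eta> w y\<close> describes the
action on the remaining letters \<open>u\<close>, with respect to \<open>shift \<eta>\<close>.\<close>

fun out :: "word \<Rightarrow> bool \<Rightarrow> bool" where
  "out [] y = y"
| "out (None # w) y = (\<not> out w y)"
| "out (Some x # w) y = out w y"

fun sec :: "(nat \<Rightarrow> symbol) \<Rightarrow> word \<Rightarrow> bool \<Rightarrow> word" where
  "sec \<eta> [] y = []"
| "sec \<eta> (None # w) y = sec \<eta> w y"
| "sec \<eta> (Some x # w) y =
     (if out w y then Some x # sec \<eta> w y else if x = \<eta> 0 then sec \<eta> w y else None # sec \<eta> w y)"

lemma ev_dec_section: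
  "ev (dec_act L \<eta>) w (y # u, i) = apfst ((#) (out w y)) (ev (dec_act L (shift \<eta>)) (sec \<eta> w y) (u, i))"
proof (induction w)
  case (Cons s w)
  show ?case
  proof (cases s)
    case None
    then show ?thesis using Cons by (cases "ev (dec_act L (shift \<eta>)) (sec \<eta> w y) (u, i)") auto
  next
    case (Some x)
    then show ?thesis using Cons
      by (cases "out w y"; cases "ev (dec_act L (shift \<eta>)) (sec \<eta> w y) (u, i)") auto
  qed
qed simp

lemma ev_tree_section:
  "tev \<eta> w (y # u) = out w y # tev (shift \<eta>) (sec \<eta> w y) u"
  using arg_cong[OF ev_dec_section[of "\<lambda>_. id" \<eta> w y u "()"], of fst] by (simp add: fst_ev_dec)

lemma out_append [simp]: "out (u @ v) y = out u (out v y)"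
  by (induction u y rule: out.induct) auto

lemma out_not [simp]: "out w (\<not> y) = (\<not> out w y)"
  by (induction w y rule: out.induct) auto

lemma out_eq: "out w y = (y = out w True)"
  using out_not[of w True] by (cases y) auto

lemma sec_append: "sec \<eta> (u @ v) y = sec \<eta> u (out v y) @ sec \<eta> v y"
  by (induction \<eta> u y rule: sec.induct) auto

text \<open>The length used throughout counts only the letters from \<open>b, c, d\<close>.  Each of them contributes itself to one
section and \<open>a\<close> or nothing to the other, so the lengths of the two sections add up to the length of the word.\<close>

definition vc :: "word \<Rightarrow> nat" where
  "vc w = length (filter (\<lambda>s. s \<noteq> None) w)"

lemma vc_simps [simp]: "vc [] = 0" "vc (None # w) = vc w" "vc (Some x # w) = Suc (vc w)"
  "vc (u @ v) = vc u + vc v"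
  by (simp_all add: vc_def)

lemma vc_sec: "vc (sec \<eta> w y) + vc (sec \<eta> w (\<not> y)) = vc w"
  by (induction \<eta> w y rule: sec.induct) auto

section \<open>Normal forms\<close>

definition third :: "symbol \<Rightarrow> symbol \<Rightarrow> symbol" where
  "third x y = (SOME z. z \<noteq> x \<and> z \<noteq> y)"

lemma third: "third x y \<noteq> x" "third x y \<noteq> y"
proof -
  have "\<exists>z. z \<noteq> x \<and> z \<noteq> y"
    by (cases x; cases y) (metis symbol.distinct)+
  then have "third x y \<noteq> x \<and> third x y \<noteq> y" unfolding third_def by (rule someI_ex)
  then show "third x y \<noteq> x" "third x y \<noteq> y" by auto
qed

definition pre :: "bool \<Rightarrow> word" where "pre e = (if e then [None] else [])"

definition alt :: "symbol list \<Rightarrow> word" where "alt xs = concat (map (\<lambda>x. [Some x, None]) xs)"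

lemma alt_simps [simp]: "alt [] = []" "alt (x # xs) = Some x # None # alt xs" "alt (xs @ ys) = alt xs @ alt ys"
  by (simp_all add: alt_def)

lemma vc_alt [simp]: "vc (alt xs) = length xs"
  by (induction xs) auto

lemma pre_simps [simp]: "vc (pre e) = 0" "sec \<eta> (pre e) y = []" "out (pre e) y = (y \<noteq> e)"
  by (auto simp: pre_def)

text \<open>Modulo the relations of an involution and a Klein four-group every word has the form
\<open>a^e x\<^sub>1 a x\<^sub>2 a \<dots> x\<^sub>n a a^f\<close>; this is the multiplication of such a form by a letter from the left.\<close>

fun nf_cons :: "letter \<Rightarrow> bool \<times> symbol list \<times> bool \<Rightarrow> bool \<times> symbol list \<times> bool" where
  "nf_cons None (e, xs, f) = (\<not> e, xs, f)"
| "nf_cons (Some x) (True, xs, f) = (False, x # xs, f)"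
| "nf_cons (Some x) (False, [], f) = (False, [x], \<not> f)"
| "nf_cons (Some x) (False, y # ys, f) = (if x = y then (True, ys, f) else (False, third x y # ys, f))"

definition nf :: "word \<Rightarrow> bool \<times> symbol list \<times> bool" where
  "nf w = foldr nf_cons w (False, [], False)"

definition nf_word :: "bool \<times> symbol list \<times> bool \<Rightarrow> word" where
  "nf_word = (\<lambda>(e, xs, f). pre e @ alt xs @ pre f)"

lemma vc_nf_word [simp]: "vc (nf_word (e, xs, f)) = length xs"
  by (simp add: nf_word_def)

lemma (in klein_action) ev_nf_cons: "ev act (nf_word (nf_cons s n)) = ev act (s # nf_word n)"
proof (induction s n rule: nf_cons.induct)
  case (4 x y ys f)
  have "distinct [x, y, third x y]" if "x \<noteq> y" using that third[of x y] by auto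
  then show ?case by (auto simp: nf_word_def pre_def fun_eq_iff klein ev_append simp del: distinct.simps)
qed (auto simp: nf_word_def pre_def fun_eq_iff ev_append)

lemma (in klein_action) ev_nf: "ev act (nf_word (nf w)) = ev act w"
proof (induction w)
  case (Cons s w)
  have "ev act (nf_word (nf (s # w))) = ev act (s # nf_word (nf w))"
    using ev_nf_cons[of s "nf w"] by (simp add: nf_def)
  then show ?case using Cons by simp
qed (simp add: nf_def nf_word_def pre_def)

lemma vc_nf: "vc (nf_word (nf w)) \<le> vc w"
proof (induction w)
  case (Cons s w)
  have "vc (nf_word (nf_cons s n)) \<le> vc (s # nf_word n)" for n
    by (induction s n rule: nf_cons.induct) auto
  from this[of "nf w"] Cons show ?case by (cases s) (auto simp: nf_def)
qed (simp add: nf_def)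

section \<open>Words acting trivially on the tree\<close>

definition recurs :: "symbol \<Rightarrow> (nat \<Rightarrow> symbol) \<Rightarrow> bool" where
  "recurs x \<eta> \<longleftrightarrow> (\<forall>m. \<exists>n\<ge>m. \<eta> n = x)"

definition two_recurrent :: "(nat \<Rightarrow> symbol) \<Rightarrow> bool" where
  "two_recurrent \<eta> \<longleftrightarrow> (\<exists>x y. x \<noteq> y \<and> recurs x \<eta> \<and> recurs y \<eta>)"

lemma recurs_shift: "recurs x \<eta> \<Longrightarrow> recurs x (shift \<eta>)"
  unfolding recurs_def shift_def by (metis Suc_le_D Suc_le_mono)

lemma two_recurrent_shift: "two_recurrent \<eta> \<Longrightarrow> two_recurrent (shift \<eta>)"
  unfolding two_recurrent_def using recurs_shift by blast

lemma two_recurrentD: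
  assumes "two_recurrent \<eta>"
  obtains x where "x \<noteq> y" "recurs x \<eta>"
  using assms unfolding two_recurrent_def by metis

lemma tree_letter_nontrivial:
  assumes "\<eta> n \<noteq> x"
  shows "tree_act \<eta> (Some x) (replicate n True @ [False, True]) \<noteq> replicate n True @ [False, True]"
  using assms
proof (induction n arbitrary: \<eta>)
  case 0
  then show ?case by simp
next
  case (Suc n)
  then show ?case by (simp add: shift_def)
qed

lemma tree_act_Some_neq_id:
  assumes "two_recurrent \<eta>"
  shows "\<exists>u. tree_act \<eta> (Some x) u \<noteq> u"
proof -
  obtain y where "y \<noteq> x" "recurs y \<eta>" using assms by (rule two_recurrentD)
  then obtain n where "\<eta> n \<noteq> x" unfolding recurs_def by (metis le0)
  then show ?thesis using tree_letter_nontrivial by blast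
qed

lemma ev_tree_id_section:
  assumes "tev \<eta> w = id"
  shows "out w y = y" "tev (shift \<eta>) (sec \<eta> w y) = id"
proof -
  have *: "out w y # tev (shift \<eta>) (sec \<eta> w y) u = y # u" for u
    using fun_cong[OF assms, of "y # u"] ev_tree_section[of \<eta> w y u] by simp
  show "out w y = y" using *[of "[]"] by simp
  show "tev (shift \<eta>) (sec \<eta> w y) = id" using * by (simp add: fun_eq_iff)
qed

lemma vc_sec_alt_two: "length xs \<ge> 2 \<Longrightarrow> vc (sec \<eta> (alt xs) y) > 0"
proof -
  assume "length xs \<ge> 2"
  then obtain x x' zs where xs: "xs = [x, x'] @ zs"
    by (metis Suc_le_length_iff numeral_2_eq_2 append_Cons append_Nil)
  then show ?thesis by (cases "out (alt zs) y") (auto simp: sec_append)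
qed

text \<open>In an alternating word with at least two letters from \<open>b, c, d\<close> these letters go to the two sections in turn, so
both sections are shorter; induction applies to them.  A word with a single such letter moves the first
level, or it is a conjugate of a generator and acts nontrivially, because every symbol differs from infinitely many terms of \<open>\<eta>\<close>.
So triviality on the tree is detected at a finite depth, and below it no decoration can move either.\<close>

theorem trivial_word_eventually_trivial:
  assumes "two_recurrent \<eta>" "tev \<eta> w = id"
  shows "\<exists>J. \<forall>L :: letter \<Rightarrow> 'l \<Rightarrow> 'l. klein_action L \<longrightarrow>
    (\<forall>u i. J \<le> length u \<longrightarrow> ev (dec_act L \<eta>) w (u, i) = (u, i))"
  using assms
proof (induction "vc w" arbitrary: w \<eta> rule: less_induct)
  case less
  obtain e xs f where nf: "nf w = (e, xs, f)" by (metis prod_cases3)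
  let ?v = "nf_word (e, xs, f)"
  have eq: "ev (dec_act L \<eta>) w = ev (dec_act L \<eta>) ?v" if "klein_action L" for L :: "letter \<Rightarrow> 'l \<Rightarrow> 'l"
    using klein_action.ev_nf[OF klein_dec_act[OF that]] nf by metis
  have id: "tev \<eta> ?v = id"
    using tree.ev_nf[of \<eta> w] less.prems nf by simp
  have out: "out ?v y = y" for y by (rule ev_tree_id_section[OF id])
  have triv: "\<exists>J. \<forall>L :: letter \<Rightarrow> 'l \<Rightarrow> 'l. klein_action L \<longrightarrow>
    (\<forall>u i. J \<le> length u \<longrightarrow> ev (dec_act L \<eta>) ?v (u, i) = (u, i))"
  proof -
    consider "xs = []" | x where "xs = [x]" | "length xs \<ge> 2"
      by (cases xs; cases "tl xs") auto
    then show ?thesis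
    proof cases
      case 1
      then have "e = f" using out[of True] by (auto simp: nf_word_def)
      then have "ev (dec_act L \<eta>) ?v p = p" if "klein_action L" for L :: "letter \<Rightarrow> 'l \<Rightarrow> 'l" and p
        using klein_action.invol[OF klein_dec_act[OF that], of \<eta> None p] 1 by (auto simp: nf_word_def pre_def)
      then show ?thesis by blast
    next
      case (2 x)
      then have ef: "e = (\<not> f)" using out[of True] by (auto simp: nf_word_def)
      obtain u where u: "tree_act \<eta> (Some x) u \<noteq> u" using tree_act_Some_neq_id less.prems(1) by blast
      have "tev \<eta> ?v (tev \<eta> (pre e) u) = tev \<eta> (pre e) u"
        using id by simp
      then have "tree_act \<eta> (Some x) u = u"
        using 2 ef by (cases e) (auto simp: nf_word_def pre_def dest: arg_cong[of _ _ "tree_act \<eta> None"])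
      then show ?thesis using u by simp
    next
      case 3
      have v: "vc (sec \<eta> ?v y) = vc (sec \<eta> (alt xs) (out (pre f) y))" for y
        by (simp add: nf_word_def sec_append)
      have "vc (sec \<eta> ?v y) < length xs" for y
      proof -
        have "vc (sec \<eta> ?v (\<not> y)) > 0" unfolding v using vc_sec_alt_two[OF 3] .
        then show ?thesis using vc_sec[of \<eta> ?v y] by simp
      qed
      moreover have "length xs \<le> vc w" using vc_nf[of w] nf by simp
      ultimately have "vc (sec \<eta> ?v y) < vc w" for y by (meson order_less_le_trans)
      from less.hyps[OF this two_recurrent_shift[OF less.prems(1)] ev_tree_id_section(2)[OF id]]
      obtain J where J: "\<And>y (L :: letter \<Rightarrow> 'l \<Rightarrow> 'l) u i. klein_action L \<Longrightarrow> J y \<le> length u \<Longrightarrow>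
          ev (dec_act L (shift \<eta>)) (sec \<eta> ?v y) (u, i) = (u, i)"
        by metis
      have "ev (dec_act L \<eta>) ?v (u, i) = (u, i)"
        if L: "klein_action L" and u: "Suc (max (J True) (J False)) \<le> length u" for L :: "letter \<Rightarrow> 'l \<Rightarrow> 'l" and u i
      proof -
        obtain y u' where uy: "u = y # u'" using u by (cases u) auto
        then have "J y \<le> length u'" using u by (cases y) auto
        then show ?thesis unfolding uy ev_dec_section by (simp add: out J[OF L])
      qed
      then show ?thesis by blast
    qed
  qed
  then show ?case using eq by metis
qed

section \<open>Growth\<close>



definition Gr :: "(nat \<Rightarrow> symbol) \<Rightarrow> (bool list \<Rightarrow> bool list) set" where
  "Gr \<eta> = range (tev \<eta>)"

definition vlen :: "(nat \<Rightarrow> symbol) \<Rightarrow> (bool list \<Rightarrow> bool list) \<Rightarrow> nat" where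
  "vlen \<eta> g = (LEAST n. \<exists>w. tev \<eta> w = g \<and> vc w = n)"

definition wlen :: "(nat \<Rightarrow> symbol) \<Rightarrow> word \<Rightarrow> nat" where
  "wlen \<eta> w = vlen \<eta> (tev \<eta> w)"

lemma vlen_attained:
  assumes "g \<in> Gr \<eta>"
  obtains w where "tev \<eta> w = g" "vc w = vlen \<eta> g"
proof -
  obtain w0 where "tev \<eta> w0 = g" using assms by (auto simp: Gr_def)
  then have "\<exists>n w. tev \<eta> w = g \<and> vc w = n" by blast
  then have "\<exists>w. tev \<eta> w = g \<and> vc w = vlen \<eta> g"
    unfolding vlen_def by (rule LeastI_ex)
  then show ?thesis using that by blast
qed

lemma vlen_le: "tev \<eta> w = g \<Longrightarrow> vlen \<eta> g \<le> vc w"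
  unfolding vlen_def by (rule Least_le) blast

lemma wlen_le_vc: "wlen \<eta> w \<le> vc w"
  unfolding wlen_def by (rule vlen_le) simp

lemma wlen_cong: "tev \<eta> v = tev \<eta> w \<Longrightarrow> wlen \<eta> v = wlen \<eta> w"
  by (simp add: wlen_def)

lemma wlen_attained:
  obtains v where "tev \<eta> v = tev \<eta> w" "vc v = wlen \<eta> w"
  using vlen_attained[of "tev \<eta> w" \<eta>] by (auto simp: Gr_def wlen_def)

lemma wlen_append: "wlen \<eta> (u @ v) \<le> wlen \<eta> u + wlen \<eta> v"
proof -
  obtain u' where u: "tev \<eta> u' = tev \<eta> u" "vc u' = wlen \<eta> u" by (rule wlen_attained)
  obtain v' where v: "tev \<eta> v' = tev \<eta> v" "vc v' = wlen \<eta> v" by (rule wlen_attained)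
  have "wlen \<eta> (u @ v) = wlen \<eta> (u' @ v')" by (rule wlen_cong) (simp add: ev_append u v)
  also have "\<dots> \<le> vc (u' @ v')" by (rule wlen_le_vc)
  finally show ?thesis by (simp add: u v)
qed

text \<open>Total length of the sections at the two vertices of level 1, respectively at the four vertices of level 2.\<close>

definition sec_len :: "(nat \<Rightarrow> symbol) \<Rightarrow> word \<Rightarrow> nat" where
  "sec_len \<eta> w = wlen (shift \<eta>) (sec \<eta> w False) + wlen (shift \<eta>) (sec \<eta> w True)"

definition sec_len2 :: "(nat \<Rightarrow> symbol) \<Rightarrow> word \<Rightarrow> nat" where
  "sec_len2 \<eta> w = sec_len (shift \<eta>) (sec \<eta> w False) + sec_len (shift \<eta>) (sec \<eta> w True)"

lemma sec_len_le_vc: "sec_len \<eta> w \<le> vc w"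
  unfolding sec_len_def using wlen_le_vc[of "shift \<eta>" "sec \<eta> w False"] wlen_le_vc[of "shift \<eta>" "sec \<eta> w True"]
    vc_sec[of \<eta> w False] by simp

lemma ev_tree_eq_section:
  assumes "tev \<eta> v = tev \<eta> w"
  shows "tev (shift \<eta>) (sec \<eta> v y) = tev (shift \<eta>) (sec \<eta> w y)"
proof
  fix u
  show "tev (shift \<eta>) (sec \<eta> v y) u = tev (shift \<eta>) (sec \<eta> w y) u"
    using fun_cong[OF assms, of "y # u"] by (simp add: ev_tree_section)
qed

lemma sec_len_le_wlen: "sec_len \<eta> w \<le> wlen \<eta> w"
proof -
  obtain v where v: "tev \<eta> v = tev \<eta> w" "vc v = wlen \<eta> w" by (rule wlen_attained)
  have "sec_len \<eta> w = sec_len \<eta> v"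
    unfolding sec_len_def by (simp add: wlen_cong[OF ev_tree_eq_section[OF v(1)]])
  then show ?thesis using sec_len_le_vc[of \<eta> v] v(2) by simp
qed

lemma sec_len_append: "sec_len \<eta> (u @ v) \<le> sec_len \<eta> u + sec_len \<eta> v"
  using wlen_append[of "shift \<eta>" "sec \<eta> u False" "sec \<eta> v False"] wlen_append[of "shift \<eta>" "sec \<eta> u True" "sec \<eta> v True"]
    wlen_append[of "shift \<eta>" "sec \<eta> u True" "sec \<eta> v False"] wlen_append[of "shift \<eta>" "sec \<eta> u False" "sec \<eta> v True"]
  unfolding sec_len_def sec_append out_eq[of v False] by (cases "out v True") auto

lemma sec_len2_append: "sec_len2 \<eta> (u @ v) \<le> sec_len2 \<eta> u + sec_len2 \<eta> v"
  using sec_len_append[of "shift \<eta>" "sec \<eta> u False" "sec \<eta> v False"] sec_len_append[of "shift \<eta>" "sec \<eta> u True" "sec \<eta> v True"]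
    sec_len_append[of "shift \<eta>" "sec \<eta> u True" "sec \<eta> v False"] sec_len_append[of "shift \<eta>" "sec \<eta> u False" "sec \<eta> v True"]
  unfolding sec_len2_def sec_append out_eq[of v False] by (cases "out v True") auto

lemma sec_len2_le_vc: "sec_len2 \<eta> w \<le> vc w"
  unfolding sec_len2_def using sec_len_le_vc[of "shift \<eta>" "sec \<eta> w False"] sec_len_le_vc[of "shift \<eta>" "sec \<eta> w True"]
    vc_sec[of \<eta> w False] by simp

lemma wlen_merge: "wlen \<eta> (u @ Some x # Some y # v) \<le> vc u + vc v + 1"
proof -
  have "wlen \<eta> [Some x, Some y] \<le> 1"
  proof (cases "x = y")
    case True
    then have "wlen \<eta> [Some x, Some y] = wlen \<eta> []" by (intro wlen_cong) (simp add: fun_eq_iff)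
    then show ?thesis using wlen_le_vc[of \<eta> "[]"] by simp
  next
    case False
    then have "distinct [x, y, third x y]" using third[of x y] by auto
    then have "wlen \<eta> [Some x, Some y] = wlen \<eta> [Some (third x y)]"
      by (intro wlen_cong) (simp add: fun_eq_iff tree.klein del: distinct.simps)
    then show ?thesis using wlen_le_vc[of \<eta> "[Some (third x y)]"] by simp
  qed
  then show ?thesis
    using wlen_append[of \<eta> u "[Some x, Some y] @ v"] wlen_append[of \<eta> "[Some x, Some y]" v]
      wlen_le_vc[of \<eta> u] wlen_le_vc[of \<eta> v] by simp
qed

text \<open>The contraction.  If \<open>x3 = \<eta> 0\<close>, then \<open>x3\<close> leaves no \<open>a\<close> in one section, where \<open>x2\<close> and \<open>x4\<close> merge into one letter.
If \<open>x3 = \<eta> 1\<close>, then either \<open>x3\<close> merges with a neighbour in the other section because \<open>x2\<close> or \<open>x4\<close> is \<open>\<eta> 0\<close>, or it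
survives between two letters \<open>a\<close> there, and the same effect makes \<open>x1\<close> and \<open>x5\<close> merge on the second level.\<close>

lemma sec_len2_block:
  assumes ne: "\<eta> 0 \<noteq> \<eta> 1" and x3: "x3 \<in> {\<eta> 0, \<eta> 1}"
  shows "sec_len2 \<eta> (alt [x1, x2, x3, x4, x5]) \<le> 4"
proof -
  let ?w = "alt [x1, x2, x3, x4, x5]" and ?\<alpha> = "\<lambda>x. if x = \<eta> 0 then [] else [None]"
  let ?F = "Some x1 # ?\<alpha> x2 @ Some x3 # ?\<alpha> x4 @ [Some x5]"
  let ?T = "?\<alpha> x1 @ Some x2 # ?\<alpha> x3 @ Some x4 # ?\<alpha> x5"
  have F: "sec \<eta> ?w False = ?F" and T: "sec \<eta> ?w True = ?T" by auto
  have vF: "vc ?F = 3" and vT: "vc ?T = 2" by auto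
  have leF: "sec_len (shift \<eta>) ?F \<le> 3" and leT: "sec_len (shift \<eta>) ?T \<le> 2"
    using sec_len_le_vc[of "shift \<eta>" ?F] sec_len_le_vc[of "shift \<eta>" ?T] vF vT by simp_all
  show ?thesis
  proof (cases "x3 = \<eta> 0")
    case True
    have "wlen (shift \<eta>) ?T \<le> 1"
      using wlen_merge[of "shift \<eta>" "?\<alpha> x1" x2 x4 "?\<alpha> x5"] True by (auto split: if_splits)
    then have "sec_len (shift \<eta>) ?T \<le> 1" using sec_len_le_wlen by (rule order_trans[rotated])
    then show ?thesis using leF unfolding sec_len2_def F T by simp
  next
    case False
    then have x3: "x3 = \<eta> 1" using x3 by simp
    have "sec_len (shift \<eta>) ?F \<le> 2"
    proof -
      consider "x2 = \<eta> 0" | "x4 = \<eta> 0" | "x2 \<noteq> \<eta> 0" "x4 \<noteq> \<eta> 0" by blast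
      then show ?thesis
      proof cases
        case 1
        then have "wlen (shift \<eta>) ?F \<le> 2"
          using wlen_merge[of "shift \<eta>" "[]" x1 x3 "?\<alpha> x4 @ [Some x5]"] by (auto split: if_splits)
        then show ?thesis using sec_len_le_wlen by (rule order_trans[rotated])
      next
        case 2
        then have "wlen (shift \<eta>) ?F \<le> 2"
          using wlen_merge[of "shift \<eta>" "Some x1 # ?\<alpha> x2" x3 x5 "[]"] by (auto split: if_splits)
        then show ?thesis using sec_len_le_wlen by (rule order_trans[rotated])
      next
        case 3
        then have "?F = [Some x1, None, Some x3, None, Some x5]" by simp
        moreover have "sec_len (shift \<eta>) [Some x1, None, Some x3, None, Some x5] \<le> 2"
        proof -
          let ?\<eta> = "shift \<eta>" and ?w' = "[Some x1, None, Some x3, None, Some x5]"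
          have "sec ?\<eta> ?w' True = [Some x1, Some x5]" using x3 by (simp add: shift_def)
          then have "wlen (shift ?\<eta>) (sec ?\<eta> ?w' True) \<le> 1"
            using wlen_merge[of "shift ?\<eta>" "[]" x1 x5 "[]"] by simp
          moreover have "vc (sec ?\<eta> ?w' False) = 1" by auto
          then have "wlen (shift ?\<eta>) (sec ?\<eta> ?w' False) \<le> 1" using wlen_le_vc by metis
          ultimately show ?thesis by (simp add: sec_len_def)
        qed
        ultimately show ?thesis by (simp only:)
      qed
    qed
    then show ?thesis using leT unfolding sec_len2_def F T by simp
  qed
qed

definition killed :: "(nat \<Rightarrow> symbol) \<Rightarrow> symbol list \<Rightarrow> nat" where
  "killed \<eta> xs = length (filter (\<lambda>x. x \<in> {\<eta> 0, \<eta> 1}) xs)"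

lemma killed_simps [simp]:
  "killed \<eta> [] = 0" "killed \<eta> (x # xs) = (if x \<in> {\<eta> 0, \<eta> 1} then 1 else 0) + killed \<eta> xs"
  by (simp_all add: killed_def)

lemma killed_le: "killed \<eta> xs \<le> length xs"
  by (simp add: killed_def)

lemma killed_take_drop: "killed \<eta> xs \<le> k + killed \<eta> (drop k xs)"
proof -
  have "killed \<eta> xs = killed \<eta> (take k xs) + killed \<eta> (drop k xs)"
    unfolding killed_def by (metis append_take_drop_id filter_append length_append)
  then show ?thesis using killed_le[of \<eta> "take k xs"] by simp
qed

text \<open>Scan the word from the left; as soon as the third letter is killed, split off a block of five letters, which
saves 1, and otherwise a single letter.  The first two letters cannot be the middle of a block, hence the
\<open>drop 2\<close>.  A block accounts for at most 3 killed letters behind its second one and 2 at the start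
of the rest, and the inequality for the rest leaves room for 2 more: this is the factor 7.\<close>

lemma sec_len2_saving_aux:
  assumes ne: "\<eta> 0 \<noteq> \<eta> 1"
  shows "\<exists>s. sec_len2 \<eta> (alt xs) + s \<le> length xs \<and> killed \<eta> (drop 2 xs) \<le> 7 * s + 2"
proof (induction "length xs" arbitrary: xs rule: less_induct)
  case less
  show ?case
  proof (cases "length xs < 5")
    case True
    have "killed \<eta> (drop 2 xs) \<le> 2" using killed_le[of \<eta> "drop 2 xs"] True by simp
    moreover have "sec_len2 \<eta> (alt xs) \<le> length xs" using sec_len2_le_vc[of \<eta> "alt xs"] by simp
    ultimately show ?thesis by (intro exI[of _ 0]) simp
  next
    case False
    then have "5 \<le> length xs" by simp
    then obtain x1 x2 x3 x4 x5 r where xs: "xs = [x1, x2, x3, x4, x5] @ r"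
      by (auto simp: Suc_le_length_iff eval_nat_numeral)
    show ?thesis
    proof (cases "x3 \<in> {\<eta> 0, \<eta> 1}")
      case True
      obtain s where s: "sec_len2 \<eta> (alt r) + s \<le> length r" "killed \<eta> (drop 2 r) \<le> 7 * s + 2"
        using less[of r] xs by auto
      have "sec_len2 \<eta> (alt xs) \<le> sec_len2 \<eta> (alt [x1, x2, x3, x4, x5]) + sec_len2 \<eta> (alt r)"
        unfolding xs alt_simps(3) by (rule sec_len2_append)
      also have "\<dots> \<le> 4 + sec_len2 \<eta> (alt r)" using sec_len2_block[OF ne True] by simp
      finally have "sec_len2 \<eta> (alt xs) + Suc s \<le> length xs" using s(1) xs by simp
      moreover have "killed \<eta> (drop 2 xs) \<le> 3 + killed \<eta> r" by (simp add: xs)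
      then have "killed \<eta> (drop 2 xs) \<le> 7 * Suc s + 2"
        using killed_take_drop[of \<eta> r 2] s(2) by simp
      ultimately show ?thesis by blast
    next
      case x3: False
      define r' where "r' = [x2, x3, x4, x5] @ r"
      have xs': "xs = [x1] @ r'" by (simp add: xs r'_def)
      obtain s where s: "sec_len2 \<eta> (alt r') + s \<le> length r'" "killed \<eta> (drop 2 r') \<le> 7 * s + 2"
        using less[of r'] xs' by auto
      have "sec_len2 \<eta> (alt xs) \<le> sec_len2 \<eta> (alt [x1]) + sec_len2 \<eta> (alt r')"
        unfolding xs' alt_simps(3) by (rule sec_len2_append)
      also have "\<dots> \<le> 1 + sec_len2 \<eta> (alt r')" using sec_len2_le_vc[of \<eta> "alt [x1]"] by simp
      finally have "sec_len2 \<eta> (alt xs) + s \<le> length xs" using s(1) xs' by simp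
      moreover have "killed \<eta> (drop 2 xs) = killed \<eta> (drop 2 r')" using x3 by (simp add: xs r'_def)
      ultimately show ?thesis using s(2) by auto
    qed
  qed
qed

lemma sec_len2_saving:
  assumes "\<eta> 0 \<noteq> \<eta> 1"
  shows "\<exists>s. sec_len2 \<eta> (alt xs) + s \<le> length xs \<and> killed \<eta> xs \<le> 7 * s + 4"
  using sec_len2_saving_aux[OF assms, of xs] killed_take_drop[of \<eta> xs 2] by fastforce

lemma sec_len2_pre: "sec_len2 \<eta> (pre e @ w @ pre f) \<le> sec_len2 \<eta> w"
proof -
  have "sec_len2 \<eta> (pre e) = 0" "sec_len2 \<eta> (pre f) = 0" using sec_len2_le_vc[of \<eta> "pre e"] sec_len2_le_vc[of \<eta> "pre f"] by auto
  then show ?thesis using sec_len2_append[of \<eta> "pre e" "w @ pre f"] sec_len2_append[of \<eta> w "pre f"] by simp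
qed

lemma minimal_nf:
  assumes "g \<in> Gr \<eta>"
  shows "\<exists>e xs f. tev \<eta> (nf_word (e, xs, f)) = g \<and> length xs = vlen \<eta> g"
proof -
  obtain w where w: "tev \<eta> w = g" "vc w = vlen \<eta> g" using assms by (rule vlen_attained)
  obtain e xs f where nf: "nf w = (e, xs, f)" by (metis prod_cases3)
  have g: "tev \<eta> (nf_word (e, xs, f)) = g" using tree.ev_nf[of \<eta> w] w nf by simp
  moreover have "length xs \<le> vlen \<eta> g" using vc_nf[of w] nf w by simp
  moreover have "vlen \<eta> g \<le> length xs" using vlen_le[OF g] by simp
  ultimately show ?thesis by (metis le_antisym)
qed

section \<open>The growth series\<close>

definition gsec :: "(bool list \<Rightarrow> bool list) \<Rightarrow> bool \<Rightarrow> bool list \<Rightarrow> bool list" where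
  "gsec g y u = tl (g (y # u))"

lemma gsec_ev: "gsec (tev \<eta> w) y = tev (shift \<eta>) (sec \<eta> w y)"
  by (simp add: gsec_def fun_eq_iff ev_tree_section)

lemma gsec_in_Gr: "g \<in> Gr \<eta> \<Longrightarrow> gsec g y \<in> Gr (shift \<eta>)"
  by (auto simp: Gr_def gsec_ev)

text \<open>Convergence of the growth series at \<open>t\<close>, expressed through its finite partial sums.\<close>

definition growth_bounded :: "(nat \<Rightarrow> symbol) \<Rightarrow> real \<Rightarrow> bool" where
  "growth_bounded \<eta> t \<longleftrightarrow> (\<exists>B. \<forall>F. finite F \<longrightarrow> F \<subseteq> Gr \<eta> \<longrightarrow> (\<Sum>g\<in>F. t ^ vlen \<eta> g) \<le> B)"

lemma Gr_decomposition_inj: "inj_on (\<lambda>g. (hd (g [True]), gsec g False, gsec g True)) (Gr \<eta>)"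
proof (rule inj_onI)
  fix g h assume gh: "g \<in> Gr \<eta>" "h \<in> Gr \<eta>"
    and eq: "(hd (g [True]), gsec g False, gsec g True) = (hd (h [True]), gsec h False, gsec h True)"
  obtain v w where v: "g = tev \<eta> v" and w: "h = tev \<eta> w"
    using gh by (auto simp: Gr_def)
  have o: "out v True = out w True" using eq by (simp add: v w ev_tree_section)
  have s: "tev (shift \<eta>) (sec \<eta> v y) = tev (shift \<eta>) (sec \<eta> w y)" for y
    using eq by (cases y) (simp_all add: v w gsec_ev)
  show "g = h"
  proof
    fix u
    show "g u = h u"
    proof (cases u)
      case Nil
      have "length (g []) = 0" "length (h []) = 0" unfolding v w by simp_all
      then show ?thesis using Nil by simp
    next
      case (Cons y u')
      then show ?thesis by (simp add: v w ev_tree_section s out_eq[of v y] out_eq[of w y] o)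
    qed
  qed
qed

text \<open>An element is determined by its action on the first level and its two sections, so a series over the group
whose exponent is additive over the sections is at most twice the square of a series over the group of the
shifted sequence.\<close>

lemma sum_over_decomposition:
  fixes t :: real
  assumes F: "finite F" "F \<subseteq> Gr \<eta>" and "0 \<le> t"
    and B: "\<And>F'. finite F' \<Longrightarrow> F' \<subseteq> Gr (shift \<eta>) \<Longrightarrow> (\<Sum>g\<in>F'. t ^ k g) \<le> B"
  shows "(\<Sum>g\<in>F. t ^ (k (gsec g False) + k (gsec g True))) \<le> 2 * B\<^sup>2"
proof -
  let ?d = "\<lambda>g. (hd (g [True]), gsec g False, gsec g True)"
  let ?A = "(\<lambda>g. gsec g False) ` F" and ?B = "(\<lambda>g. gsec g True) ` F"
  have inj: "inj_on ?d F" using Gr_decomposition_inj F(2) by (rule inj_on_subset)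
  have A: "(\<Sum>x\<in>?A. t ^ k x) \<le> B" and B': "(\<Sum>x\<in>?B. t ^ k x) \<le> B"
    using F by (intro B; auto intro: gsec_in_Gr)+
  have "(\<Sum>g\<in>F. t ^ (k (gsec g False) + k (gsec g True))) = (\<Sum>(b, x, y)\<in>?d ` F. t ^ k x * t ^ k y)"
    using inj by (subst sum.reindex) (auto simp: power_add)
  also have "\<dots> \<le> (\<Sum>(b, x, y)\<in>(UNIV :: bool set) \<times> ?A \<times> ?B. t ^ k x * t ^ k y)"
  proof (rule sum_mono2)
    show "finite ((UNIV :: bool set) \<times> ?A \<times> ?B)" using F(1) by simp
    show "?d ` F \<subseteq> UNIV \<times> ?A \<times> ?B" by auto
  qed (use \<open>0 \<le> t\<close> in auto)
  also have "\<dots> = 2 * ((\<Sum>x\<in>?A. t ^ k x) * (\<Sum>y\<in>?B. t ^ k y))"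
    unfolding sum_product by (simp add: sum.cartesian_product[symmetric] sum_distrib_left)
  also have "(\<Sum>x\<in>?A. t ^ k x) * (\<Sum>y\<in>?B. t ^ k y) \<le> B * B"
    using A B' \<open>0 \<le> t\<close> by (intro mult_mono) (auto intro!: sum_nonneg order_trans[OF sum_nonneg A])
  finally show ?thesis by (simp add: power2_eq_square)
qed

lemma wlen_ev: "vlen \<eta> (tev \<eta> w) = wlen \<eta> w"
  by (simp add: wlen_def)

lemma growth_bounded_shift:
  assumes "growth_bounded (shift \<eta>) t" "0 < t" "t \<le> 1"
  shows "growth_bounded \<eta> t"
proof -
  obtain B where B: "\<And>F'. finite F' \<Longrightarrow> F' \<subseteq> Gr (shift \<eta>) \<Longrightarrow> (\<Sum>g\<in>F'. t ^ vlen (shift \<eta>) g) \<le> B"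
    using assms(1) unfolding growth_bounded_def by blast
  have "(\<Sum>g\<in>F. t ^ vlen \<eta> g) \<le> 2 * B\<^sup>2" if F: "finite F" "F \<subseteq> Gr \<eta>" for F
  proof -
    have "(\<Sum>g\<in>F. t ^ vlen \<eta> g) \<le> (\<Sum>g\<in>F. t ^ (vlen (shift \<eta>) (gsec g False) + vlen (shift \<eta>) (gsec g True)))"
    proof (rule sum_mono)
      fix g assume "g \<in> F"
      then obtain w where "g = tev \<eta> w" using F by (auto simp: Gr_def)
      then have "vlen (shift \<eta>) (gsec g False) + vlen (shift \<eta>) (gsec g True) \<le> vlen \<eta> g"
        using sec_len_le_wlen[of \<eta> w] by (simp add: gsec_ev wlen_ev sec_len_def)
      then show "t ^ vlen \<eta> g \<le> t ^ (vlen (shift \<eta>) (gsec g False) + vlen (shift \<eta>) (gsec g True))"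
        using assms by (intro power_decreasing) auto
    qed
    also have "\<dots> \<le> 2 * B\<^sup>2" using F assms(2) B by (intro sum_over_decomposition) auto
    finally show ?thesis .
  qed
  then show ?thesis unfolding growth_bounded_def by blast
qed

lemma UNIV_symbol_third:
  assumes "x \<noteq> y"
  shows "(UNIV :: symbol set) = {x, y, third x y}"
proof -
  have "distinct [x, y, third x y]" using assms third[of x y] by auto
  then have "z \<in> {x, y, third x y}" for z
    by (cases x; cases y; cases "third x y"; cases z) auto
  then show ?thesis by blast
qed

lemma finite_UNIV_symbol [simp]: "finite (UNIV :: symbol set)"
  by (subst UNIV_symbol_third[of Sym0 Sym1]) auto

lemma finite_symbol_lists: "finite {xs :: symbol list. length xs = k}" "finite {xs :: symbol list. length xs \<le> k}"
  using finite_lists_length_eq[of "UNIV :: symbol set" k] finite_lists_length_le[of "UNIV :: symbol set" k] by auto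

lemma sum_lists_killed:
  fixes u :: real
  assumes ne: "\<eta> 0 \<noteq> \<eta> 1"
  shows "(\<Sum>xs | length xs = k. u ^ killed \<eta> xs) = (1 + 2 * u) ^ k"
proof (induction k)
  case (Suc k)
  have eq: "{xs :: symbol list. length xs = Suc k} = (\<lambda>(x, xs). x # xs) ` (UNIV \<times> {xs. length xs = k})"
    by (auto simp: length_Suc_conv)
  have inj: "inj_on (\<lambda>(x, xs). x # xs) (UNIV \<times> {xs :: symbol list. length xs = k})"
    by (auto simp: inj_on_def)
  have "(\<Sum>xs | length xs = Suc k. u ^ killed \<eta> xs) =
      (\<Sum>x\<in>UNIV. \<Sum>xs | length xs = k. u ^ (if x \<in> {\<eta> 0, \<eta> 1} then 1 else 0) * u ^ killed \<eta> xs)"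
    unfolding eq sum.reindex[OF inj] sum.cartesian_product
    by (intro sum.cong) (auto simp: power_add)
  also have "\<dots> = (\<Sum>x\<in>UNIV. u ^ (if x \<in> {\<eta> 0, \<eta> 1} then 1 else 0)) * (1 + 2 * u) ^ k"
    by (simp add: sum_distrib_left[symmetric] Suc sum_distrib_right)
  also have "(\<Sum>x\<in>UNIV. u ^ (if x \<in> {\<eta> 0, \<eta> 1} then 1 else 0)) = 1 + 2 * u"
    unfolding UNIV_symbol_third[OF ne] using ne third[of "\<eta> 0" "\<eta> 1"] by simp
  finally show ?case by simp
qed simp

text \<open>The generating function of all normal forms by length (weight \<open>r\<close>) and number of killed letters (weight \<open>u\<close>) is
\<open>4 / (1 - r * (1 + 2 * u))\<close>: two of the three letters are killed, and the factor 4 counts the two outer powers of \<open>a\<close>.\<close>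

lemma sum_over_normal_forms:
  fixes r u :: real
  assumes ne: "\<eta> 0 \<noteq> \<eta> 1" and r: "0 \<le> r" "0 \<le> u" "r * (1 + 2 * u) < 1"
    and F: "finite F" and inj: "inj_on n F"
  shows "(\<Sum>g\<in>F. case n g of (e :: bool, xs, f :: bool) \<Rightarrow> r ^ length xs * u ^ killed \<eta> xs) \<le> 4 / (1 - r * (1 + 2 * u))"
proof -
  let ?\<phi> = "\<lambda>(e :: bool, xs, f :: bool). r ^ length xs * u ^ killed \<eta> xs"
  define N where "N = Max (insert 0 ((\<lambda>g. length (fst (snd (n g)))) ` F))"
  have N: "length (fst (snd (n g))) \<le> N" if "g \<in> F" for g
    unfolding N_def using F that by (intro Max_ge) auto
  let ?X = "{xs :: symbol list. length xs \<le> N}"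
  have "(\<Sum>g\<in>F. ?\<phi> (n g)) = (\<Sum>p\<in>n ` F. ?\<phi> p)"
    using inj by (simp add: sum.reindex)
  also have "\<dots> \<le> (\<Sum>p\<in>(UNIV :: bool set) \<times> ?X \<times> (UNIV :: bool set). ?\<phi> p)"
  proof (rule sum_mono2)
    show "finite ((UNIV :: bool set) \<times> ?X \<times> (UNIV :: bool set))"
      by (intro finite_cartesian_product finite_symbol_lists) auto
    show "n ` F \<subseteq> UNIV \<times> ?X \<times> UNIV"
    proof (rule image_subsetI)
      fix g assume "g \<in> F"
      from N[OF this] show "n g \<in> UNIV \<times> ?X \<times> UNIV" by (cases "n g") auto
    qed
  qed (use r in auto)
  also have "\<dots> = 4 * (\<Sum>xs\<in>?X. r ^ length xs * u ^ killed \<eta> xs)"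
    by (simp add: sum.cartesian_product[symmetric] sum_distrib_left)
  also have "(\<Sum>xs\<in>?X. r ^ length xs * u ^ killed \<eta> xs) = (\<Sum>k\<le>N. \<Sum>xs | xs \<in> ?X \<and> length xs = k. r ^ length xs * u ^ killed \<eta> xs)"
    by (rule sum.group[symmetric]) (auto simp: finite_symbol_lists)
  also have "\<dots> = (\<Sum>k\<le>N. (r * (1 + 2 * u)) ^ k)"
  proof (rule sum.cong[OF refl])
    fix k assume "k \<in> {..N}"
    then have "(\<Sum>xs | xs \<in> ?X \<and> length xs = k. r ^ length xs * u ^ killed \<eta> xs) = (\<Sum>xs | length xs = k. r ^ k * u ^ killed \<eta> xs)"
      by (intro sum.cong) auto
    then show "(\<Sum>xs | xs \<in> ?X \<and> length xs = k. r ^ length xs * u ^ killed \<eta> xs) = (r * (1 + 2 * u)) ^ k"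
      by (simp add: sum_distrib_left[symmetric] sum_lists_killed[OF ne] power_mult_distrib)
  qed
  also have "\<dots> \<le> 1 / (1 - r * (1 + 2 * u))"
  proof -
    have "(\<Sum>k\<le>N. (r * (1 + 2 * u)) ^ k) \<le> (\<Sum>k. (r * (1 + 2 * u)) ^ k)"
      using r by (intro sum_le_suminf summable_geometric) auto
    also have "\<dots> = 1 / (1 - r * (1 + 2 * u))" using r by (intro suminf_geometric) auto
    finally show ?thesis .
  qed
  finally show ?thesis by simp
qed

definition min_nf :: "(nat \<Rightarrow> symbol) \<Rightarrow> (bool list \<Rightarrow> bool list) \<Rightarrow> bool \<times> symbol list \<times> bool" where
  "min_nf \<eta> g = (SOME n. tev \<eta> (nf_word n) = g \<and> length (fst (snd n)) = vlen \<eta> g)"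

lemma min_nf:
  assumes "g \<in> Gr \<eta>"
  shows "tev \<eta> (nf_word (min_nf \<eta> g)) = g" "length (fst (snd (min_nf \<eta> g))) = vlen \<eta> g"
proof -
  have "\<exists>n. tev \<eta> (nf_word n) = g \<and> length (fst (snd n)) = vlen \<eta> g"
    using minimal_nf[OF assms] by fastforce
  from someI_ex[OF this]
  show "tev \<eta> (nf_word (min_nf \<eta> g)) = g" "length (fst (snd (min_nf \<eta> g))) = vlen \<eta> g"
    by (auto simp: min_nf_def)
qed

lemma inj_on_min_nf: "inj_on (min_nf \<eta>) (Gr \<eta>)"
  by (rule inj_onI) (metis min_nf(1))

text \<open>Each group element is counted in one of two ways.  If the saving on a minimal word is large, its
second-level sections have total length at most \<open>(1 - \<delta>)\<close> times its own length, and its term is bounded by a term of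
the fourth power of the series of the sequence shifted twice, at \<open>t powr (1 / (1 - \<delta>))\<close>.  Otherwise its word
contains few killed letters and is rare: a weight \<open>u\<close> on the killed letters bounds the sum of these terms by a convergent geometric series.\<close>

lemma growth_bounded_contraction:
  assumes ne: "\<eta> 0 \<noteq> \<eta> 1" and t: "0 < t" "t < 1" and \<delta>: "0 < \<delta>" "\<delta> < 1" and u: "0 < u" "u \<le> 1"
    and r: "t * u powr (- 7 * \<delta>) * (1 + 2 * u) < 1"
    and bounded: "growth_bounded (shift (shift \<eta>)) (t powr (1 / (1 - \<delta>)))"
  shows "growth_bounded \<eta> t"
proof -
  define q where "q = 1 / (1 - \<delta>)"
  define t' where "t' = t powr q"
  define r where "r = t * u powr (- 7 * \<delta>)"
  have t': "0 < t'" "t' \<le> 1" using t \<delta> by (simp_all add: t'_def q_def powr_le1)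
  obtain B where B: "\<And>F'. finite F' \<Longrightarrow> F' \<subseteq> Gr (shift (shift \<eta>)) \<Longrightarrow> (\<Sum>g\<in>F'. t' ^ vlen (shift (shift \<eta>)) g) \<le> B"
    using bounded unfolding growth_bounded_def t'_def q_def by blast
  define k1 where "k1 h = vlen (shift (shift \<eta>)) (gsec h False) + vlen (shift (shift \<eta>)) (gsec h True)" for h
  define k2 where "k2 g = k1 (gsec g False) + k1 (gsec g True)" for g
  have B1: "(\<Sum>h\<in>F'. t' ^ k1 h) \<le> 2 * B\<^sup>2" if "finite F'" "F' \<subseteq> Gr (shift \<eta>)" for F'
    unfolding k1_def using that t' B by (intro sum_over_decomposition) auto
  have B2: "(\<Sum>g\<in>F'. t' ^ k2 g) \<le> 2 * (2 * B\<^sup>2)\<^sup>2" if "finite F'" "F' \<subseteq> Gr \<eta>" for F'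
    unfolding k2_def using that t' B1 by (intro sum_over_decomposition) auto
  have k2: "k2 (tev \<eta> w) = sec_len2 \<eta> w" for w
    by (simp add: k2_def k1_def gsec_ev wlen_ev sec_len2_def sec_len_def)
  define \<phi> where "\<phi> = (\<lambda>(e :: bool, xs, f :: bool). r ^ length xs * u ^ killed \<eta> xs)"
  have split: "t ^ vlen \<eta> g \<le> t' ^ k2 g + u powr (-4) * \<phi> (min_nf \<eta> g)" if g: "g \<in> Gr \<eta>" for g
  proof -
    obtain e xs f where n: "min_nf \<eta> g = (e, xs, f)" by (metis prod_cases3)
    have ev: "tev \<eta> (nf_word (e, xs, f)) = g" and len: "length xs = vlen \<eta> g"
      using min_nf[OF g] n by auto
    have "k2 g = sec_len2 \<eta> (nf_word (e, xs, f))" using k2 ev by metis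
    also have "\<dots> \<le> sec_len2 \<eta> (alt xs)" unfolding nf_word_def by (simp add: sec_len2_pre)
    finally have le: "k2 g \<le> sec_len2 \<eta> (alt xs)" .
    obtain s where s: "sec_len2 \<eta> (alt xs) + s \<le> length xs" "killed \<eta> xs \<le> 7 * s + 4"
      using sec_len2_saving[OF ne] by blast
    have pos: "0 \<le> \<phi> (min_nf \<eta> g)" using t u by (simp add: \<phi>_def n r_def)
    show ?thesis
    proof (cases "real s \<ge> \<delta> * real (length xs)")
      case True
      have "real (k2 g) \<le> (1 - \<delta>) * real (length xs)"
        using le s(1) True by (simp add: algebra_simps)
      then have "q * real (k2 g) \<le> real (length xs)"
        using \<delta> by (simp add: q_def field_simps)
      then have "t powr real (length xs) \<le> t powr (q * real (k2 g))"
        using t by (intro powr_mono') auto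
      also have "\<dots> = t' ^ k2 g" using t t' by (simp add: t'_def powr_powr[symmetric] powr_realpow)
      finally have "t ^ vlen \<eta> g \<le> t' ^ k2 g" using t len by (simp add: powr_realpow)
      then show ?thesis using pos u by (simp add: add_increasing2)
    next
      case False
      have "1 \<le> u powr (real (killed \<eta> xs) - 4 - 7 * \<delta> * real (length xs))"
      proof -
        have "real (killed \<eta> xs) - 4 - 7 * \<delta> * real (length xs) \<le> 0"
          using False s(2) by simp
        from powr_mono'[OF this, of u] show ?thesis using u by simp
      qed
      also have "\<dots> = u powr (-4) * (u powr (- 7 * \<delta>)) ^ length xs * u ^ killed \<eta> xs"
        using u by (simp add: powr_realpow[symmetric] powr_powr powr_add[symmetric] algebra_simps)
      finally have "t ^ length xs * 1 \<le> t ^ length xs * (u powr (-4) * (u powr (- 7 * \<delta>)) ^ length xs * u ^ killed \<eta> xs)"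
        using t by (intro mult_left_mono) auto
      also have "\<dots> = u powr (-4) * \<phi> (min_nf \<eta> g)"
        by (simp add: \<phi>_def n r_def power_mult_distrib)
      finally have "t ^ vlen \<eta> g \<le> u powr (-4) * \<phi> (min_nf \<eta> g)" using len by simp
      then show ?thesis using t' by (simp add: add_increasing)
    qed
  qed
  have "(\<Sum>g\<in>F. t ^ vlen \<eta> g) \<le> 2 * (2 * B\<^sup>2)\<^sup>2 + u powr (-4) * (4 / (1 - r * (1 + 2 * u)))"
    if F: "finite F" "F \<subseteq> Gr \<eta>" for F
  proof -
    have "(\<Sum>g\<in>F. t ^ vlen \<eta> g) \<le> (\<Sum>g\<in>F. t' ^ k2 g + u powr (-4) * \<phi> (min_nf \<eta> g))"
      using F by (intro sum_mono split) auto
    also have "\<dots> = (\<Sum>g\<in>F. t' ^ k2 g) + u powr (-4) * (\<Sum>g\<in>F. \<phi> (min_nf \<eta> g))"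
      by (simp add: sum.distrib sum_distrib_left)
    also have "\<dots> \<le> 2 * (2 * B\<^sup>2)\<^sup>2 + u powr (-4) * (4 / (1 - r * (1 + 2 * u)))"
    proof (intro add_mono B2 F mult_left_mono)
      have "(\<Sum>g\<in>F. case min_nf \<eta> g of (e, xs, f) \<Rightarrow> r ^ length xs * u ^ killed \<eta> xs) \<le> 4 / (1 - r * (1 + 2 * u))"
        using t u assms(8) F inj_on_subset[OF inj_on_min_nf F(2)]
        by (intro sum_over_normal_forms[OF ne]) (auto simp: r_def)
      then show "(\<Sum>g\<in>F. \<phi> (min_nf \<eta> g)) \<le> 4 / (1 - r * (1 + 2 * u))" by (simp add: \<phi>_def)
    qed simp
    finally show ?thesis .
  qed
  then show ?thesis unfolding growth_bounded_def by blast
qed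

lemma growth_bounded_small:
  assumes ne: "\<eta> 0 \<noteq> \<eta> 1" and t: "0 < t" "t \<le> 1/4"
  shows "growth_bounded \<eta> t"
proof -
  have "(\<Sum>g\<in>F. t ^ vlen \<eta> g) \<le> 4 / (1 - t * (1 + 2 * 1))" if F: "finite F" "F \<subseteq> Gr \<eta>" for F
  proof -
    have "(\<Sum>g\<in>F. t ^ vlen \<eta> g) = (\<Sum>g\<in>F. case min_nf \<eta> g of (e, xs, f) \<Rightarrow> t ^ length xs * 1 ^ killed \<eta> xs)"
      using F by (intro sum.cong) (auto simp: min_nf(2)[symmetric] split: prod.splits)
    also have "\<dots> \<le> 4 / (1 - t * (1 + 2 * 1))"
      using t F inj_on_subset[OF inj_on_min_nf F(2)] by (intro sum_over_normal_forms[OF ne]) auto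
    finally show ?thesis .
  qed
  then show ?thesis unfolding growth_bounded_def by blast
qed

lemma funpow_shift: "(shift ^^ k) \<eta> n = \<eta> (k + n)"
  by (induction k arbitrary: n) (auto simp: shift_def)

lemma two_recurrent_funpow_shift: "two_recurrent \<eta> \<Longrightarrow> two_recurrent ((shift ^^ k) \<eta>)"
  by (induction k) (auto intro: two_recurrent_shift)

lemma two_recurrent_change:
  assumes "two_recurrent \<eta>"
  shows "\<exists>k. \<eta> k \<noteq> \<eta> (Suc k)"
proof (rule ccontr)
  assume "\<nexists>k. \<eta> k \<noteq> \<eta> (Suc k)"
  then have "\<eta> k = \<eta> 0" for k by (induction k) auto
  moreover obtain x where "x \<noteq> \<eta> 0" "recurs x \<eta>" using assms by (rule two_recurrentD)
  ultimately show False unfolding recurs_def by metis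
qed

lemma growth_bounded_funpow_shift:
  assumes "growth_bounded ((shift ^^ k) \<eta>) t" "0 < t" "t \<le> 1"
  shows "growth_bounded \<eta> t"
  using assms(1) by (induction k) (auto intro: growth_bounded_shift assms)

text \<open>The groups have subexponential growth.  Suppose that the series diverges at \<open>t\<close>.  Divergence persists under
shifts, and at a position where two consecutive symbols differ the contraction turns divergence at \<open>s \<le> t\<close> into
divergence at \<open>s powr q\<close> for the sequence shifted twice, with a fixed \<open>q > 1\<close>.  Repeating this gives divergence
below \<open>1/4\<close>, which is impossible since there are at most \<open>4 * 3 ^ n\<close> elements of length \<open>n\<close>.\<close>

theorem growth_bounded:
  assumes \<eta>: "two_recurrent \<eta>" and t: "0 < t" "t < 1"
  shows "growth_bounded \<eta> t"
proof (rule ccontr)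
  assume unbounded: "\<not> growth_bounded \<eta> t"
  \<comment> \<open>First \<open>u\<close> is chosen so small that \<open>t * (1 + 2 * u) < 1\<close>, then \<open>\<delta>\<close> so small that
    the factor \<open>u powr (- 7 * \<delta>)\<close> preserves this inequality.\<close>
  define u where "u = (1 - t) / 4"
  define \<rho> where "\<rho> = t * (1 + 2 * u)"
  have u: "0 < u" "u < 1" using t by (auto simp: u_def)
  have "t * (1 - t) > 0" using t by simp
  then have "\<rho> > 0" using t u by (simp add: \<rho>_def)
  have "\<rho> < 1"
  proof -
    have "1 - \<rho> = (1 - t) * (1 - t / 2)" by (simp add: \<rho>_def u_def field_simps)
    also have "\<dots> > 0" using t by simp
    finally show ?thesis by simp
  qed
  define \<delta> where "\<delta> = min (1/2) (ln \<rho> / (14 * ln u))"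
  have lnu: "ln u < 0" and ln\<rho>: "ln \<rho> < 0" using u \<open>0 < \<rho>\<close> \<open>\<rho> < 1\<close> by auto
  have \<delta>: "0 < \<delta>" "\<delta> < 1" using lnu ln\<rho> by (auto simp: \<delta>_def divide_neg_neg)
  have r: "\<rho> * u powr (- 7 * \<delta>) < 1"
  proof -
    have "\<delta> \<le> ln \<rho> / (14 * ln u)" by (simp add: \<delta>_def)
    then have "\<delta> * (14 * ln u) \<ge> ln \<rho>" using lnu by (simp add: neg_le_divide_eq)
    then have "ln \<rho> + (- 7 * \<delta>) * ln u < 0" using ln\<rho> by simp
    then have "exp (ln \<rho> + (- 7 * \<delta>) * ln u) < 1" by simp
    also have "exp (ln \<rho> + (- 7 * \<delta>) * ln u) = \<rho> * u powr (- 7 * \<delta>)"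
      unfolding exp_add powr_def using \<open>0 < \<rho>\<close> u by simp
    finally show ?thesis .
  qed
  define q where "q = 1 / (1 - \<delta>)"
  have q: "1 < q" using \<delta> by (simp add: q_def)
  have change: "\<exists>k'. \<not> growth_bounded ((shift ^^ k') \<eta>) s \<and> (shift ^^ k') \<eta> 0 \<noteq> (shift ^^ k') \<eta> 1"
    if "\<not> growth_bounded ((shift ^^ k) \<eta>) s" "0 < s" "s \<le> 1" for k s
  proof -
    obtain j where "(shift ^^ k) \<eta> j \<noteq> (shift ^^ k) \<eta> (Suc j)"
      using two_recurrent_change[OF two_recurrent_funpow_shift[OF \<eta>]] by blast
    then have ne: "(shift ^^ (j + k)) \<eta> 0 \<noteq> (shift ^^ (j + k)) \<eta> 1" by (simp add: funpow_shift add.commute)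
    have "\<not> growth_bounded ((shift ^^ j) ((shift ^^ k) \<eta>)) s"
      using growth_bounded_funpow_shift that by blast
    then show ?thesis using ne by (intro exI[of _ "j + k"]) (simp add: funpow_add)
  qed
  have "\<exists>k. \<not> growth_bounded ((shift ^^ k) \<eta>) (t powr (q ^ j))" for j
  proof (induction j)
    case 0
    then show ?case using unbounded t by (intro exI[of _ 0]) simp
  next
    case (Suc j)
    let ?s = "t powr (q ^ j)"
    have "?s < t powr 0" using t q by (intro powr_less_mono') auto
    then have s: "0 < ?s" "?s < 1" using t by auto
    have "?s \<le> t powr 1" using t q by (intro powr_mono') (auto intro: one_le_power)
    then have st: "?s \<le> t" using t by simp
    obtain k where k: "\<not> growth_bounded ((shift ^^ k) \<eta>) ?s" "(shift ^^ k) \<eta> 0 \<noteq> (shift ^^ k) \<eta> 1"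
      using Suc change s by (metis less_imp_le)
    have "?s * u powr (- 7 * \<delta>) * (1 + 2 * u) \<le> t * u powr (- 7 * \<delta>) * (1 + 2 * u)"
      using st u by (intro mult_right_mono) auto
    also have "\<dots> < 1" using r by (simp add: \<rho>_def mult_ac)
    finally have "?s * u powr (- 7 * \<delta>) * (1 + 2 * u) < 1" .
    then have "\<not> growth_bounded (shift (shift ((shift ^^ k) \<eta>))) (?s powr (1 / (1 - \<delta>)))"
      using growth_bounded_contraction[OF k(2) s \<delta> u(1)] k(1) u by auto
    moreover have "?s powr (1 / (1 - \<delta>)) = t powr (q ^ Suc j)"
      by (simp add: powr_powr q_def)
    ultimately show ?case by (intro exI[of _ "Suc (Suc k)"]) simp
  qed
  moreover obtain j where j: "ln 4 / ln (1 / t) < q ^ j" using real_arch_pow[OF q] by blast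
  ultimately obtain k0 where "\<not> growth_bounded ((shift ^^ k0) \<eta>) (t powr (q ^ j))" by blast
  moreover have "0 < t powr (q ^ j)" "t powr (q ^ j) \<le> 1" using t q by (auto simp: powr_le1)
  ultimately obtain k where k: "\<not> growth_bounded ((shift ^^ k) \<eta>) (t powr (q ^ j))" "(shift ^^ k) \<eta> 0 \<noteq> (shift ^^ k) \<eta> 1"
    using change by blast
  have "ln 4 < q ^ j * ln (1 / t)" using j t by (simp add: field_simps)
  then have "q ^ j * ln t \<le> ln (1/4)" using t by (simp add: ln_div)
  then have "exp (q ^ j * ln t) \<le> exp (ln (1/4))" by (simp only: exp_le_cancel_iff)
  also have "\<dots> = 1/4" by simp
  finally have "t powr (q ^ j) \<le> 1/4" using t by (simp add: powr_def)
  then show False using growth_bounded_small[OF k(2)] k(1) t by simp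
qed

section \<open>Balls form Folner sets\<close>

definition vball :: "(nat \<Rightarrow> symbol) \<Rightarrow> nat \<Rightarrow> (bool list \<Rightarrow> bool list) set" where
  "vball \<eta> n = {g \<in> Gr \<eta>. vlen \<eta> g \<le> n}"

lemma finite_vball: "finite (vball \<eta> n)"
proof (rule finite_imageD)
  have "min_nf \<eta> ` vball \<eta> n \<subseteq> UNIV \<times> {xs. length xs \<le> n} \<times> UNIV"
  proof (rule image_subsetI)
    fix g assume "g \<in> vball \<eta> n"
    then have "length (fst (snd (min_nf \<eta> g))) \<le> n" by (simp add: vball_def min_nf(2))
    then show "min_nf \<eta> g \<in> UNIV \<times> {xs. length xs \<le> n} \<times> UNIV" by (cases "min_nf \<eta> g") auto
  qed
  then show "finite (min_nf \<eta> ` vball \<eta> n)"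
    by (rule finite_subset) (intro finite_cartesian_product finite_symbol_lists finite)
  show "inj_on (min_nf \<eta>) (vball \<eta> n)"
    by (rule inj_on_subset[OF inj_on_min_nf]) (auto simp: vball_def)
qed

lemma id_in_vball: "id \<in> vball \<eta> n"
proof -
  have "id \<in> Gr \<eta>" unfolding Gr_def by (metis ev.simps(1) rangeI)
  then show ?thesis using vlen_le[of \<eta> "[]" id] by (simp add: vball_def)
qed

text \<open>Otherwise the balls would grow at least like \<open>(1 + \<epsilon>) ^ n\<close>, and the growth series would diverge at \<open>1 / (1 + \<epsilon> / 2)\<close>.\<close>

lemma vball_grows_slowly:
  assumes \<eta>: "two_recurrent \<eta>" and "\<epsilon> > 0"
  shows "\<exists>n. real (card (vball \<eta> (Suc n))) \<le> (1 + \<epsilon>) * real (card (vball \<eta> n))"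
proof (rule ccontr)
  assume "\<not> ?thesis"
  then have grow: "(1 + \<epsilon>) * real (card (vball \<eta> n)) \<le> real (card (vball \<eta> (Suc n)))" for n
    by (meson linear)
  have big: "(1 + \<epsilon>) ^ n \<le> real (card (vball \<eta> n))" for n
  proof (induction n)
    case 0
    have "card (vball \<eta> 0) > 0" using finite_vball id_in_vball by (metis card_gt_0_iff empty_iff)
    then show ?case by simp
  next
    case (Suc n)
    have "(1 + \<epsilon>) ^ Suc n \<le> (1 + \<epsilon>) * real (card (vball \<eta> n))" using Suc \<open>\<epsilon> > 0\<close> by simp
    then show ?case using grow[of n] by linarith
  qed
  define t where "t = 1 / (1 + \<epsilon> / 2)"
  have t: "0 < t" "t < 1" using \<open>\<epsilon> > 0\<close> by (auto simp: t_def)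
  obtain B where B: "\<And>F. finite F \<Longrightarrow> F \<subseteq> Gr \<eta> \<Longrightarrow> (\<Sum>g\<in>F. t ^ vlen \<eta> g) \<le> B"
    using growth_bounded[OF \<eta> t] unfolding growth_bounded_def by blast
  have "((1 + \<epsilon>) * t) ^ n \<le> B" for n
  proof -
    have "((1 + \<epsilon>) * t) ^ n \<le> real (card (vball \<eta> n)) * t ^ n"
      using big[of n] t by (simp add: power_mult_distrib)
    also have "\<dots> = (\<Sum>g\<in>vball \<eta> n. t ^ n)" by simp
    also have "\<dots> \<le> (\<Sum>g\<in>vball \<eta> n. t ^ vlen \<eta> g)"
      using t by (intro sum_mono power_decreasing) (auto simp: vball_def)
    also have "\<dots> \<le> B" by (rule B[OF finite_vball]) (auto simp: vball_def)
    finally show ?thesis .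
  qed
  moreover have "1 < (1 + \<epsilon>) * t" using \<open>\<epsilon> > 0\<close> by (simp add: t_def)
  then obtain n where "B < ((1 + \<epsilon>) * t) ^ n" using real_arch_pow by blast
  ultimately show False by (meson not_le)
qed

lemma tree_act_vball: "g \<in> vball \<eta> n \<Longrightarrow> tree_act \<eta> s \<circ> g \<in> vball \<eta> (Suc n)"
proof -
  assume g: "g \<in> vball \<eta> n"
  then have "g \<in> Gr \<eta>" by (simp add: vball_def)
  then obtain w where w: "tev \<eta> w = g" "vc w = vlen \<eta> g" by (rule vlen_attained)
  have eq: "tree_act \<eta> s \<circ> g = tev \<eta> (s # w)" using w by simp
  have "vlen \<eta> (tree_act \<eta> s \<circ> g) \<le> vc (s # w)" by (rule vlen_le[OF eq[symmetric]])
  also have "\<dots> \<le> Suc n" using g w by (cases s) (auto simp: vball_def)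
  finally show ?thesis by (simp add: vball_def Gr_def eq del: ev.simps)
qed

theorem tree_folner:
  assumes "two_recurrent \<eta>" and "\<epsilon> > 0"
  shows "\<exists>\<Phi>. finite \<Phi> \<and> \<Phi> \<noteq> {} \<and> \<Phi> \<subseteq> Gr \<eta> \<and>
    (\<forall>s. real (card ((\<lambda>g. tree_act \<eta> s \<circ> g) ` \<Phi> - \<Phi>)) \<le> \<epsilon> * real (card \<Phi>))"
proof -
  obtain n where n: "real (card (vball \<eta> (Suc n))) \<le> (1 + \<epsilon>) * real (card (vball \<eta> n))"
    using vball_grows_slowly[OF assms] by blast
  let ?\<Phi> = "vball \<eta> n"
  have "real (card ((\<lambda>g. tree_act \<eta> s \<circ> g) ` ?\<Phi> - ?\<Phi>)) \<le> \<epsilon> * real (card ?\<Phi>)" for s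
  proof -
    have "(\<lambda>g. tree_act \<eta> s \<circ> g) ` ?\<Phi> - ?\<Phi> \<subseteq> vball \<eta> (Suc n) - ?\<Phi>"
      using tree_act_vball by blast
    then have "card ((\<lambda>g. tree_act \<eta> s \<circ> g) ` ?\<Phi> - ?\<Phi>) \<le> card (vball \<eta> (Suc n) - ?\<Phi>)"
      using finite_vball by (intro card_mono) auto
    moreover have "?\<Phi> \<subseteq> vball \<eta> (Suc n)" by (auto simp: vball_def)
    then have "card (vball \<eta> (Suc n) - ?\<Phi>) + card ?\<Phi> = card (vball \<eta> (Suc n))"
      using finite_vball by (simp add: card_Diff_subset card_mono)
    ultimately show ?thesis using n by (simp add: algebra_simps)
  qed
  then show ?thesis
    using finite_vball[of \<eta> n] id_in_vball[of \<eta> n] by (intro exI[of _ ?\<Phi>]) (auto simp: vball_def[of \<eta> n])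
qed

section \<open>Elements of finite order\<close>

definition finite_order :: "('x \<Rightarrow> 'x) \<Rightarrow> bool" where
  "finite_order f \<longleftrightarrow> (\<exists>m>0. f ^^ m = id)"

lemma funpow_eq_id_mult: "f ^^ m = id \<Longrightarrow> f ^^ (m * n) = id"
  by (simp add: funpow_mult[symmetric])

lemma finite_order_power: "finite_order (f ^^ n) \<Longrightarrow> n > 0 \<Longrightarrow> finite_order f"
  unfolding finite_order_def by (metis funpow_mult mult.commute nat_0_less_mult_iff)

lemma finite_order_sections:
  assumes out: "\<And>y. out w y = y" and fin: "\<And>y. finite_order (tev (shift \<eta>) (sec \<eta> w y))"
  shows "finite_order (tev \<eta> w)"
proof -
  obtain m1 m2 where m: "0 < m1" "tev (shift \<eta>) (sec \<eta> w True) ^^ m1 = id"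
    "0 < m2" "tev (shift \<eta>) (sec \<eta> w False) ^^ m2 = id"
    using fin unfolding finite_order_def by metis
  then have y: "tev (shift \<eta>) (sec \<eta> w y) ^^ (m1 * m2) = id" for y
    using funpow_eq_id_mult[OF m(2), of m2] funpow_eq_id_mult[OF m(4), of m1] by (cases y) (auto simp: mult.commute)
  have pow: "(tev \<eta> w ^^ n) (y # u) = y # (tev (shift \<eta>) (sec \<eta> w y) ^^ n) u" for n y u
    by (induction n) (auto simp: ev_tree_section out)
  have "(tev \<eta> w ^^ (m1 * m2)) u = u" for u
  proof (cases u)
    case Nil
    have "length ((tev \<eta> w ^^ n) u) = length u" for n by (induction n) auto
    from this[of "m1 * m2"] show ?thesis using Nil by simp
  next
    case (Cons y u')
    then show ?thesis by (simp add: pow y)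
  qed
  then show ?thesis using m unfolding finite_order_def by (intro exI[of _ "m1 * m2"]) (auto simp: fun_eq_iff)
qed

lemma ev_concat_replicate: "ev act (concat (replicate n w)) = ev act w ^^ n"
  by (induction n) (auto simp: ev_append)

context klein_action
begin

lemma finite_order_swap:
  assumes "finite_order (ev act [s, t])"
  shows "finite_order (ev act [t, s])"
proof -
  obtain m where m: "m > 0" "ev act [s, t] ^^ m = id" using assms by (auto simp: finite_order_def)
  have "(ev act [t, s] ^^ n) p = act t ((ev act [s, t] ^^ n) (act t p))" for n p
    by (induction n) auto
  then have "ev act [t, s] ^^ m = id" using m by (simp add: fun_eq_iff)
  then show ?thesis using m by (auto simp: finite_order_def)
qed

text \<open>Two involutions whose product \<open>R\<close> has finite order generate a finite dihedral group, all of whose elements are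
\<open>R ^^ i\<close> or \<open>R ^^ i \<circ> B\<close>.\<close>

lemma dihedral_word_finite_order:
  assumes fin: "finite_order (ev act [Some x, None])" and w: "set w \<subseteq> {None, Some x}"
  shows "finite_order (ev act w)"
proof -
  define R where "R = ev act [Some x, None]"
  define B where "B = act None"
  obtain m where m: "m > 0" "R ^^ m = id" using fin by (auto simp: finite_order_def R_def)
  obtain k where k: "m = Suc k" using m by (cases m) auto
  have BB: "B \<circ> B = id" by (simp add: B_def fun_eq_iff)
  have A: "act (Some x) = R \<circ> B" by (simp add: R_def B_def fun_eq_iff)
  have RBR: "R \<circ> B \<circ> R = B" by (simp add: R_def B_def fun_eq_iff)
  have BR: "B \<circ> R = R ^^ k \<circ> B"
  proof -
    have "R ^^ k \<circ> B = R ^^ k \<circ> (R \<circ> B \<circ> R)" by (simp only: RBR)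
    also have "\<dots> = R ^^ m \<circ> B \<circ> R" by (simp only: k funpow_Suc_right o_assoc)
    finally show ?thesis by (simp add: m)
  qed
  have BRi: "B \<circ> R ^^ i = R ^^ (k * i) \<circ> B" for i
  proof (induction i)
    case (Suc i)
    have "B \<circ> R ^^ Suc i = (B \<circ> R ^^ i) \<circ> R" by (simp only: funpow_Suc_right o_assoc)
    also have "\<dots> = R ^^ (k * i) \<circ> (B \<circ> R)" by (simp only: Suc o_assoc)
    also have "\<dots> = R ^^ (k * i + k) \<circ> B" by (simp only: BR funpow_add o_assoc)
    finally show ?case by (simp only: mult_Suc_right add.commute)
  qed simp
  have form: "\<exists>i. ev act w = R ^^ i \<or> ev act w = R ^^ i \<circ> B"
    using w
  proof (induction w)
    case Nil
    show ?case by (intro exI[of _ 0]) simp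
  next
    case (Cons s w)
    have "set w \<subseteq> {None, Some x}" using Cons.prems by simp
    from Cons.IH[OF this] obtain i where i: "ev act w = R ^^ i \<or> ev act w = R ^^ i \<circ> B" by blast
    have B1: "\<exists>j. B \<circ> ev act w = R ^^ j \<or> B \<circ> ev act w = R ^^ j \<circ> B"
      using i
    proof
      assume "ev act w = R ^^ i"
      then show ?thesis using BRi by metis
    next
      assume "ev act w = R ^^ i \<circ> B"
      then have "B \<circ> ev act w = (B \<circ> R ^^ i) \<circ> B" by (simp only: o_assoc)
      also have "\<dots> = R ^^ (k * i) \<circ> (B \<circ> B)" by (simp only: BRi o_assoc)
      also have "\<dots> = R ^^ (k * i)" by (simp only: BB comp_id)
      finally show ?thesis by blast
    qed
    show ?case
    proof (cases s)
      case None
      then show ?thesis using B1 by (simp only: B_def ev.simps)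
    next
      case (Some z)
      then have "s = Some x" using Cons.prems by simp
      then have e: "ev act (s # w) = R \<circ> (B \<circ> ev act w)" by (simp only: ev.simps A o_assoc)
      obtain j where "B \<circ> ev act w = R ^^ j \<or> B \<circ> ev act w = R ^^ j \<circ> B" using B1 by blast
      then have "ev act (s # w) = R ^^ Suc j \<or> ev act (s # w) = R ^^ Suc j \<circ> B"
      proof
        assume "B \<circ> ev act w = R ^^ j"
        then show ?thesis by (simp only: e funpow.simps simp_thms)
      next
        assume "B \<circ> ev act w = R ^^ j \<circ> B"
        then show ?thesis by (simp only: e funpow.simps o_assoc simp_thms)
      qed
      then show ?thesis by blast
    qed
  qed
  then obtain i where i: "ev act w = R ^^ i \<or> ev act w = R ^^ i \<circ> B" by blast
  then show ?thesis
  proof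
    assume "ev act w = R ^^ i"
    then have "ev act w ^^ m = id" using funpow_eq_id_mult[OF m(2), of i] by (simp add: funpow_mult mult.commute)
    then show ?thesis using m by (auto simp: finite_order_def)
  next
    assume e: "ev act w = R ^^ i \<circ> B"
    have "ev act w \<circ> ev act w = R ^^ i \<circ> (B \<circ> R ^^ i) \<circ> B" by (simp only: e o_assoc)
    also have "\<dots> = R ^^ i \<circ> R ^^ (k * i) \<circ> (B \<circ> B)" by (simp only: BRi o_assoc)
    also have "\<dots> = R ^^ (m * i)" by (simp only: BB comp_id funpow_add[symmetric] k mult_Suc)
    also have "\<dots> = id" by (rule funpow_eq_id_mult[OF m(2)])
    finally have "ev act w ^^ 2 = id" by (simp add: numeral_2_eq_2)
    then show ?thesis unfolding finite_order_def by (intro exI[of _ 2]) simp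
  qed
qed

end

text \<open>The sections of the square of \<open>x a\<close> are \<open>x\<close> if \<open>x = \<eta> 0\<close>, and otherwise \<open>x a\<close> and \<open>a x\<close>, for the shifted sequence.\<close>

lemma letter_a_finite_order:
  assumes "\<eta> k = x"
  shows "finite_order (tev \<eta> [Some x, None])"
  using assms
proof (induction k arbitrary: \<eta>)
  case 0
  let ?w = "[Some x, None, Some x, None]"
  have "finite_order (tev \<eta> ?w)"
  proof (rule finite_order_sections)
    fix y
    have "sec \<eta> ?w y = [Some x]" using 0 by (cases y) auto
    moreover have "tev (shift \<eta>) [Some x] ^^ 2 = id" by (simp add: numeral_2_eq_2 fun_eq_iff)
    ultimately show "finite_order (tev (shift \<eta>) (sec \<eta> ?w y))"
      unfolding finite_order_def by (metis zero_less_numeral)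
  qed simp
  moreover have "tev \<eta> ?w = tev \<eta> [Some x, None] ^^ 2"
    by (simp add: numeral_2_eq_2 fun_eq_iff)
  ultimately show ?case by (metis finite_order_power zero_less_numeral)
next
  case (Suc k)
  let ?w = "[Some x, None, Some x, None]"
  have fin: "finite_order (tev (shift \<eta>) [Some x, None])"
    by (rule Suc.IH) (simp add: shift_def Suc.prems)
  have "finite_order (tev \<eta> ?w)"
  proof (rule finite_order_sections)
    fix y
    have "tev (shift \<eta>) [Some x] ^^ 2 = id" by (simp add: numeral_2_eq_2 fun_eq_iff)
    then have "finite_order (tev (shift \<eta>) [Some x])" unfolding finite_order_def by (metis zero_less_numeral)
    moreover have "sec \<eta> ?w y \<in> {[Some x], [Some x, None], [None, Some x]}" by (cases y) auto
    ultimately show "finite_order (tev (shift \<eta>) (sec \<eta> ?w y))"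
      using fin tree.finite_order_swap[OF fin] by auto
  qed simp
  moreover have "tev \<eta> ?w = tev \<eta> [Some x, None] ^^ 2"
    by (simp add: numeral_2_eq_2 fun_eq_iff)
  ultimately show ?case by (metis finite_order_power zero_less_numeral)
qed

section \<open>Lifting words\<close>

text \<open>If \<open>x \<noteq> \<eta> 0\<close>, then the substitution of \<open>a x a\<close> for \<open>a\<close> lifts a word \<open>w\<close> to a word with section \<open>w\<close> at the vertex \<open>1\<close>; its
section at \<open>0\<close> involves the letters \<open>a\<close> and \<open>x\<close> only.\<close>

definition lift :: "symbol \<Rightarrow> word \<Rightarrow> word" where
  "lift x w = concat (map (\<lambda>s. if s = None then [None, Some x, None] else [s]) w)"

lemma lift_simps [simp]: "lift x [] = []" "lift x (None # w) = None # Some x # None # lift x w"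
  "lift x (Some v # w) = Some v # lift x w"
  by (simp_all add: lift_def)

lemma out_lift [simp]: "out (lift x w) y = y"
proof (induction w)
  case (Cons s w)
  then show ?case by (cases s) auto
qed simp

lemma sec_lift_True: "x \<noteq> \<eta> 0 \<Longrightarrow> sec \<eta> (lift x w) True = w"
proof (induction w)
  case (Cons s w)
  then show ?case by (cases s) auto
qed simp

lemma sec_lift_False: "set (sec \<eta> (lift x w) False) \<subseteq> {None, Some x}"
proof (induction w)
  case (Cons s w)
  then show ?case by (cases s) auto
qed simp

text \<open>At depth 0 take the word \<open>(\<eta> 0) a\<close>.  To pass from \<open>shift \<eta>\<close> to \<open>\<eta>\<close>, lift with a recurring symbol \<open>x \<noteq> \<eta> 0\<close>: the new
section lies in the group generated by \<open>a\<close> and \<open>x\<close>, which is finite dihedral because \<open>x\<close> occurs later in \<open>\<eta>\<close>.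
So some power of the word is trivial on the tree, although with decorations of infinite order
the word acts at the vertex \<open>1 \<dots> 1\<close> of depth \<open>J\<close> as a product of two reflections.\<close>

theorem finite_order_word_with_section:
  assumes "two_recurrent \<eta>"
  shows "\<exists>w. finite_order (tev \<eta> w) \<and> (\<forall>(L :: letter \<Rightarrow> 'l \<Rightarrow> 'l) i.
    ev (dec_act L \<eta>) w (replicate J True, i) = (replicate J True, L (Some (\<eta> J)) (L None i)))"
  using assms
proof (induction J arbitrary: \<eta>)
  case 0
  show ?case
  proof (intro exI conjI allI)
    show "finite_order (tev \<eta> [Some (\<eta> 0), None])" by (rule letter_a_finite_order) (rule refl)
  qed simp
next
  case (Suc J)
  obtain w where w: "finite_order (tev (shift \<eta>) w)"
    "\<And>(L :: letter \<Rightarrow> 'l \<Rightarrow> 'l) i. ev (dec_act L (shift \<eta>)) w (replicate J True, i) =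
      (replicate J True, L (Some (shift \<eta> J)) (L None i))"
    using Suc.IH[OF two_recurrent_shift[OF Suc.prems]] by blast
  obtain x where x: "x \<noteq> \<eta> 0" "recurs x \<eta>" using Suc.prems by (rule two_recurrentD)
  obtain k where "shift \<eta> k = x" using recurs_shift[OF x(2)] unfolding recurs_def by blast
  then have fin: "finite_order (tev (shift \<eta>) [Some x, None])" by (rule letter_a_finite_order)
  have "finite_order (tev \<eta> (lift x w))"
  proof (rule finite_order_sections)
    fix y
    show "finite_order (tev (shift \<eta>) (sec \<eta> (lift x w) y))"
      using w(1) tree.dihedral_word_finite_order[OF fin sec_lift_False, of \<eta> w] sec_lift_True[of x \<eta> w] x(1)
      by (cases y) auto
  qed simp
  moreover have "ev (dec_act L \<eta>) (lift x w) (replicate (Suc J) True, i) =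
      (replicate (Suc J) True, L (Some (\<eta> (Suc J))) (L None i))" for L :: "letter \<Rightarrow> 'l \<Rightarrow> 'l" and i
    using x(1) by (simp add: ev_dec_section sec_lift_True w(2) shift_def)
  ultimately show ?case by blast
qed

section \<open>Dihedral decorations\<close>

text \<open>The dihedral action on the residues modulo \<open>p\<close>, represented by \<open>{0..<p}\<close>: \<open>a\<close> acts by \<open>- i\<close>, the letter \<open>z\<close> trivially and the
two other letters by \<open>1 - i\<close>.  For \<open>p = 1\<close> the action is trivial.\<close>

definition dih :: "int \<Rightarrow> symbol \<Rightarrow> letter \<Rightarrow> int \<Rightarrow> int" where
  "dih p z s i = (if 0 \<le> i \<and> i < p then
     (case s of None \<Rightarrow> (- i) mod p | Some x \<Rightarrow> if x = z then i else (1 - i) mod p) else i)"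

lemma dih_range: "0 \<le> dih p z s i \<and> dih p z s i < p \<longleftrightarrow> 0 \<le> i \<and> i < p"
  by (auto simp: dih_def split: option.splits)

lemma klein_dih: "klein_action (dih p z)"
proof
  fix s i
  have "(- ((- i) mod p)) mod p = i mod p" "(1 - (1 - i) mod p) mod p = i mod p"
    by (simp_all add: mod_minus_eq mod_diff_right_eq)
  then show "dih p z s (dih p z s i) = i"
    by (cases s) (auto simp: dih_def)
next
  fix x y v :: symbol and i
  assume d: "distinct [x, y, v]"
  have "z \<in> {x, y, v}" using d by (cases x; cases y; cases v; cases z) auto
  moreover have "(1 - (1 - i) mod p) mod p = i mod p" by (simp add: mod_diff_right_eq)
  ultimately show "dih p z (Some x) (dih p z (Some y) i) = dih p z (Some v) i"
    using d by (auto simp: dih_def)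
qed

lemma dih_rotation:
  assumes "p > 0" "x \<noteq> z"
  shows "((\<lambda>i. dih p z (Some x) (dih p z None i)) ^^ k) 0 = int k mod p"
proof (induction k)
  case (Suc k)
  have "dih p z (Some x) (dih p z None i) = (1 + i) mod p" if "0 \<le> i" "i < p" for i
    using that assms by (simp add: dih_def mod_diff_right_eq)
  then show ?case using Suc assms by (simp add: mod_add_right_eq add.commute)
qed (use assms in simp)

text \<open>The decorations at depth \<open>n\<close> ignore some letter other than \<open>\<eta> n\<close>, so that the product of \<open>\<eta> n\<close> and \<open>a\<close> acts as a translation.
Applying \<open>third\<close> to equal arguments merely picks such a letter.\<close>

abbreviation level_act :: "(nat \<Rightarrow> symbol) \<Rightarrow> nat \<Rightarrow> int \<Rightarrow> letter \<Rightarrow> bool list \<times> int \<Rightarrow> bool list \<times> int" where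
  "level_act \<eta> n P \<equiv> dec_act (dih P (third (\<eta> n) (\<eta> n))) \<eta>"

text \<open>A period \<open>p n\<close> for each depth \<open>n\<close>; the value 1 removes the decorations at this depth.\<close>

definition layer_act :: "(nat \<Rightarrow> symbol) \<Rightarrow> (nat \<Rightarrow> int) \<Rightarrow> letter \<Rightarrow> bool list \<times> int \<Rightarrow> bool list \<times> int" where
  "layer_act \<eta> p s q = level_act \<eta> (length (fst q)) (p (length (fst q))) s q"

lemma ev_layer: "ev (layer_act \<eta> p) w (u, i) = ev (level_act \<eta> (length u) (p (length u))) w (u, i)"
  by (induction w) (simp_all add: layer_act_def)

lemma fst_ev_layer: "fst (ev (layer_act \<eta> p) w q) = tev \<eta> w (fst q)"
  by (cases q) (simp add: ev_layer fst_ev_dec)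

lemma layer_determines_tree:
  assumes "ev (layer_act \<eta> p) v = ev (layer_act \<eta> p) w"
  shows "tev \<eta> v = tev \<eta> w"
proof
  fix u
  show "tev \<eta> v u = tev \<eta> w u"
    using assms fst_ev_layer[of \<eta> p v "(u, 0)"] fst_ev_layer[of \<eta> p w "(u, 0)"] by simp
qed

lemma klein_layer: "klein_action (layer_act \<eta> p)"
proof
  have D: "klein_action (level_act \<eta> n (p n))" for n by (intro klein_dec_act klein_dih)
  fix q
  have len: "length (fst (layer_act \<eta> p s q)) = length (fst q)" for s
    by (simp add: layer_act_def fst_dec_act)
  show "layer_act \<eta> p s (layer_act \<eta> p s q) = q" for s
    by (subst layer_act_def) (simp only: len, simp add: layer_act_def klein_action.invol[OF D])
  show "layer_act \<eta> p (Some x) (layer_act \<eta> p (Some y) q) = layer_act \<eta> p (Some z) q"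
    if "distinct [x, y, z]" for x y z
    by (subst layer_act_def) (simp only: len, simp only: layer_act_def klein_action.klein[OF D that])
qed

lemma dec_act_range:
  assumes "\<And>s i. 0 \<le> L s i \<and> L s i < p \<longleftrightarrow> 0 \<le> i \<and> i < (p :: int)" and "\<And>s i. \<not> (0 \<le> i \<and> i < p) \<Longrightarrow> L s i = i"
  shows "0 \<le> snd (ev (dec_act L \<eta>) w q) \<and> snd (ev (dec_act L \<eta>) w q) < p \<longleftrightarrow> 0 \<le> snd q \<and> snd q < p"
    and "\<not> (0 \<le> snd q \<and> snd q < p) \<Longrightarrow> snd (ev (dec_act L \<eta>) w q) = snd q"
proof -
  have a: "snd (dec_a L (u, i)) \<in> {i, L None i}" for u i by (cases u) auto
  have v: "snd (dec_v L \<eta> x (u, i)) \<in> {i, L None i, L (Some x) i}" for \<eta> x u i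
  proof (induction u arbitrary: \<eta>)
    case (Cons y u)
    then show ?case using a[of u i] by (cases y) auto
  qed simp
  have s: "snd (dec_act L \<eta> s q) = snd q \<or> (\<exists>t. snd (dec_act L \<eta> s q) = L t (snd q))" for s q
    using a v by (cases s; cases q) fastforce+
  show "0 \<le> snd (ev (dec_act L \<eta>) w q) \<and> snd (ev (dec_act L \<eta>) w q) < p \<longleftrightarrow> 0 \<le> snd q \<and> snd q < p"
  proof (induction w)
    case (Cons t w)
    from s[of t "ev (dec_act L \<eta>) w q"] show ?case
      by (elim disjE exE) (simp_all only: ev.simps comp_apply assms(1) Cons)
  qed simp
  show "snd (ev (dec_act L \<eta>) w q) = snd q" if "\<not> (0 \<le> snd q \<and> snd q < p)"
  proof (induction w)
    case (Cons t w)
    from s[of t "ev (dec_act L \<eta>) w q"] show ?case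
      by (elim disjE exE) (simp_all only: ev.simps comp_apply assms(2)[OF that] Cons)
  qed simp
qed

section \<open>Lifting Folner sets through a locally finite kernel\<close>

definition folner_action :: "(letter \<Rightarrow> 'x \<Rightarrow> 'x) \<Rightarrow> bool" where
  "folner_action act \<longleftrightarrow> (\<forall>\<epsilon>>0. \<exists>\<Phi>. finite \<Phi> \<and> \<Phi> \<noteq> {} \<and> \<Phi> \<subseteq> range (ev act) \<and>
    (\<forall>s. real (card ((\<lambda>g. act s \<circ> g) ` \<Phi> - \<Phi>)) \<le> \<epsilon> * real (card \<Phi>)))"

text \<open>Choose words \<open>l g\<close> that represent the elements \<open>g\<close> of a Folner set \<open>\<Phi>\<close> of the quotient.  The words \<open>r s g\<close>, which compare
\<open>s \<cdot> l g\<close> with \<open>l (s \<cdot> g)\<close>, are finitely many and act trivially on the quotient, so their values lie in a finite set \<open>L\<close>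
closed under composition.  The products of the \<open>l g\<close> with the members of \<open>L\<close> form a Folner set with the same
relative boundary as \<open>\<Phi>\<close>.\<close>

lemma folner_action_lift:
  fixes act :: "letter \<Rightarrow> 'x \<Rightarrow> 'x" and base :: "letter \<Rightarrow> 'y \<Rightarrow> 'y"
  assumes act: "klein_action act"
    and proj: "\<And>v w. ev act v = ev act w \<Longrightarrow> ev base v = ev base w"
    and locally_finite: "\<And>W. finite W \<Longrightarrow> \<forall>w\<in>W. ev base w = id \<Longrightarrow>
      \<exists>L. finite L \<and> id \<in> L \<and> ev act ` W \<subseteq> L \<and> L \<subseteq> ev act ` {w. ev base w = id} \<and> (\<forall>k\<in>L. \<forall>l\<in>L. k \<circ> l \<in> L)"
    and base: "klein_action base" "folner_action base"
  shows "folner_action act"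
  unfolding folner_action_def
proof (intro allI impI)
  interpret act: klein_action act by fact
  interpret base: klein_action base by fact
  fix \<epsilon> :: real assume "\<epsilon> > 0"
  obtain \<Phi> where \<Phi>: "finite \<Phi>" "\<Phi> \<noteq> {}" "\<Phi> \<subseteq> range (ev base)"
    and small: "\<And>s. real (card ((\<lambda>g. base s \<circ> g) ` \<Phi> - \<Phi>)) \<le> \<epsilon> * real (card \<Phi>)"
    using base(2)[unfolded folner_action_def, rule_format, OF \<open>\<epsilon> > 0\<close>] by metis
  define l where "l g = (SOME w. ev base w = g)" for g
  have l: "ev base (l g) = g" if "g \<in> \<Phi>" for g
  proof -
    have "\<exists>w. ev base w = g" using that \<Phi>(3) by auto
    then show ?thesis unfolding l_def by (rule someI_ex)
  qed
  define r where "r s g = rev (l (base s \<circ> g)) @ s # l g" for s g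
  define W where "W = (\<lambda>(s, g). r s g) ` {(s, g) \<in> UNIV \<times> \<Phi>. base s \<circ> g \<in> \<Phi>}"
  have "finite (UNIV :: letter set)"
    by (simp add: UNIV_option_conv)
  then have "finite ((UNIV :: letter set) \<times> \<Phi>)" using \<Phi>(1) by simp
  then have "finite {(s, g) \<in> UNIV \<times> \<Phi>. base s \<circ> g \<in> \<Phi>}" by (rule rev_finite_subset) auto
  then have "finite W" unfolding W_def by (rule finite_imageI)
  moreover have "\<forall>w\<in>W. ev base w = id"
  proof
    fix w assume "w \<in> W"
    then obtain s g where w: "w = r s g" and g: "g \<in> \<Phi>" "base s \<circ> g \<in> \<Phi>" by (auto simp: W_def)
    have "ev base (s # l g) = ev base (l (base s \<circ> g))" using l g by simp
    then show "ev base w = id" by (simp add: w r_def ev_append fun_eq_iff base.ev_rev del: ev.simps)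
  qed
  ultimately obtain L where L: "finite L" "id \<in> L" "ev act ` W \<subseteq> L"
      "L \<subseteq> ev act ` {w. ev base w = id}" "\<And>k k'. k \<in> L \<Longrightarrow> k' \<in> L \<Longrightarrow> k \<circ> k' \<in> L"
    using locally_finite by metis
  define f :: "('y \<Rightarrow> 'y) \<times> ('x \<Rightarrow> 'x) \<Rightarrow> 'x \<Rightarrow> 'x" where "f = (\<lambda>(g, k). ev act (l g) \<circ> k)"
  define \<Psi> where "\<Psi> = f ` (\<Phi> \<times> L)"
  have inj: "inj_on f (\<Phi> \<times> L)"
  proof (rule inj_onI, clarify)
    fix g k g' k' assume *: "g \<in> \<Phi>" "k \<in> L" "g' \<in> \<Phi>" "k' \<in> L" "f (g, k) = f (g', k')"
    obtain w w' where w: "k = ev act w" "ev base w = id" "k' = ev act w'" "ev base w' = id"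
      using L(4) *(2,4) by blast
    have "ev act (l g @ w) = ev act (l g' @ w')" using *(5) by (simp add: f_def w ev_append)
    then have "ev base (l g @ w) = ev base (l g' @ w')" by (rule proj)
    then have "g = g'" using l *(1,3) by (simp add: ev_append w)
    moreover have "k = k'"
    proof
      fix p
      have "ev act (l g) (k p) = ev act (l g) (k' p)"
        using fun_cong[OF *(5), of p] \<open>g = g'\<close> by (simp add: f_def)
      then show "k p = k' p" using act.inj_ev by (metis injD)
    qed
    ultimately show "g = g' \<and> k = k'" by simp
  qed
  have card: "card \<Psi> = card \<Phi> * card L"
    unfolding \<Psi>_def card_image[OF inj] by (rule card_cartesian_product)
  have "real (card ((\<lambda>g. act s \<circ> g) ` \<Psi> - \<Psi>)) \<le> \<epsilon> * real (card \<Psi>)" for s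
  proof -
    let ?D = "{g \<in> \<Phi>. base s \<circ> g \<notin> \<Phi>}"
    have inj_s: "inj_on (\<lambda>g. base s \<circ> g) A" for A
      by (rule inj_onI) (metis base.invol comp_apply ext)
    have "(\<lambda>g. act s \<circ> g) ` \<Psi> - \<Psi> \<subseteq> (\<lambda>q. act s \<circ> f q) ` (?D \<times> L)"
    proof
      fix h assume h: "h \<in> (\<lambda>g. act s \<circ> g) ` \<Psi> - \<Psi>"
      then obtain g k where gk: "g \<in> \<Phi>" "k \<in> L" "h = act s \<circ> f (g, k)" by (auto simp: \<Psi>_def)
      have "base s \<circ> g \<notin> \<Phi>"
      proof
        assume sg: "base s \<circ> g \<in> \<Phi>"
        then have "r s g \<in> W" using gk by (auto simp: W_def)
        then have "ev act (r s g) \<circ> k \<in> L" using L gk by blast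
        then have "f (base s \<circ> g, ev act (r s g) \<circ> k) \<in> \<Psi>" using sg by (auto simp: \<Psi>_def)
        moreover have "f (base s \<circ> g, ev act (r s g) \<circ> k) = h"
          by (simp add: f_def gk r_def ev_append fun_eq_iff act.ev_rev')
        ultimately show False using h by simp
      qed
      then show "h \<in> (\<lambda>q. act s \<circ> f q) ` (?D \<times> L)" using gk by blast
    qed
    then have "card ((\<lambda>g. act s \<circ> g) ` \<Psi> - \<Psi>) \<le> card ((\<lambda>q. act s \<circ> f q) ` (?D \<times> L))"
      using \<Phi>(1) L(1) by (intro card_mono) auto
    also have "\<dots> \<le> card (?D \<times> L)" using \<Phi>(1) L(1) by (intro card_image_le) auto
    also have "\<dots> = card ?D * card L" by (rule card_cartesian_product)
    also have "card ?D = card ((\<lambda>g. base s \<circ> g) ` ?D)" by (rule card_image[OF inj_s, symmetric])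
    also have "(\<lambda>g. base s \<circ> g) ` ?D = (\<lambda>g. base s \<circ> g) ` \<Phi> - \<Phi>" by auto
    finally have "real (card ((\<lambda>g. act s \<circ> g) ` \<Psi> - \<Psi>)) \<le> real (card ((\<lambda>g. base s \<circ> g) ` \<Phi> - \<Phi>)) * real (card L)"
      by (metis of_nat_le_iff of_nat_mult)
    also have "\<dots> \<le> \<epsilon> * real (card \<Phi>) * real (card L)" by (intro mult_right_mono small) simp
    finally show ?thesis by (simp add: card mult.assoc)
  qed
  moreover have "finite \<Psi>" "\<Psi> \<noteq> {}" using \<Phi> L by (auto simp: \<Psi>_def)
  moreover have "\<Psi> \<subseteq> range (ev act)"
  proof
    fix h assume "h \<in> \<Psi>"
    then obtain g k where "k \<in> L" "h = ev act (l g) \<circ> k" by (auto simp: \<Psi>_def f_def)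
    then obtain w where "h = ev act (l g @ w)" using L(4) by (auto simp: ev_append)
    then show "h \<in> range (ev act)" by simp
  qed
  ultimately show "\<exists>\<Phi>. finite \<Phi> \<and> \<Phi> \<noteq> {} \<and> \<Phi> \<subseteq> range (ev act) \<and>
    (\<forall>s. real (card ((\<lambda>g. act s \<circ> g) ` \<Phi> - \<Phi>)) \<le> \<epsilon> * real (card \<Phi>))" by blast
qed

lemma finite_functions_supported_on:
  assumes "finite X"
  shows "finite {f :: 'x \<Rightarrow> 'x. f ` X \<subseteq> X \<and> (\<forall>x. x \<notin> X \<longrightarrow> f x = x)}"
proof (rule finite_imageD)
  show "finite ((\<lambda>f. restrict f X) ` {f :: 'x \<Rightarrow> 'x. f ` X \<subseteq> X \<and> (\<forall>x. x \<notin> X \<longrightarrow> f x = x)})"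
    by (rule finite_subset[of _ "PiE X (\<lambda>_. X)"]) (auto intro!: finite_PiE assms)
  show "inj_on (\<lambda>f. restrict f X) {f :: 'x \<Rightarrow> 'x. f ` X \<subseteq> X \<and> (\<forall>x. x \<notin> X \<longrightarrow> f x = x)}"
  proof (rule inj_onI, rule ext)
    fix f g :: "'x \<Rightarrow> 'x" and x
    assume "f \<in> {f. f ` X \<subseteq> X \<and> (\<forall>x. x \<notin> X \<longrightarrow> f x = x)}" "g \<in> {f. f ` X \<subseteq> X \<and> (\<forall>x. x \<notin> X \<longrightarrow> f x = x)}"
      "restrict f X = restrict g X"
    then show "f x = g x" by (cases "x \<in> X") (auto dest: fun_cong[of _ _ x])
  qed
qed

lemma dih_outside: "\<not> (0 \<le> i \<and> i < p) \<Longrightarrow> dih p z s i = i"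
  unfolding dih_def by (rule if_not_P)

lemma dec_dih_range:
  "0 \<le> snd (ev (dec_act (dih P z) \<eta>) w q) \<and> snd (ev (dec_act (dih P z) \<eta>) w q) < P \<longleftrightarrow> 0 \<le> snd q \<and> snd q < P"
  "\<not> (0 \<le> snd q \<and> snd q < P) \<Longrightarrow> snd (ev (dec_act (dih P z) \<eta>) w q) = snd q"
  using dec_act_range[where L = "dih P z" and p = P, OF dih_range dih_outside] by blast+

lemma snd_ev_layer:
  "0 \<le> snd (ev (layer_act \<eta> p) w (u, i)) \<and> snd (ev (layer_act \<eta> p) w (u, i)) < p (length u) \<longleftrightarrow>
    0 \<le> i \<and> i < p (length u)"
  "\<not> (0 \<le> i \<and> i < p (length u)) \<Longrightarrow> snd (ev (layer_act \<eta> p) w (u, i)) = i"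
  using dec_dih_range[where q = "(u, i)"] by (simp_all add: ev_layer)

text \<open>Finitely many words that are trivial on the tree act trivially at large depth, so they only move the finitely
many decorated vertices of smaller depth; the permutations supported there form a finite set.\<close>

lemma layer_folner:
  assumes \<eta>: "two_recurrent \<eta>"
  shows "folner_action (layer_act \<eta> p)"
proof (rule folner_action_lift[OF klein_layer, where base = "tree_act \<eta>"])
  show "tev \<eta> v = tev \<eta> w" if "ev (layer_act \<eta> p) v = ev (layer_act \<eta> p) w" for v w
    using that by (rule layer_determines_tree)
  show "folner_action (tree_act \<eta>)"
    unfolding folner_action_def Gr_def[symmetric] by (intro allI impI tree_folner[OF \<eta>])
  fix W assume W: "finite W" "\<forall>w\<in>W. tev \<eta> w = id"
  have "\<forall>w\<in>W. \<exists>J. \<forall>L :: letter \<Rightarrow> int \<Rightarrow> int. klein_action L \<longrightarrow>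
    (\<forall>u i. J \<le> length u \<longrightarrow> ev (dec_act L \<eta>) w (u, i) = (u, i))"
    using W(2) trivial_word_eventually_trivial[OF \<eta>] by blast
  then obtain J where J: "\<And>w (L :: letter \<Rightarrow> int \<Rightarrow> int) u i. w \<in> W \<Longrightarrow> klein_action L \<Longrightarrow>
      J w \<le> length u \<Longrightarrow> ev (dec_act L \<eta>) w (u, i) = (u, i)"
    by metis
  define N where "N = Max (insert 0 (J ` W))"
  have N: "J w \<le> N" if "w \<in> W" for w unfolding N_def using W(1) that by (intro Max_ge) auto
  define X where "X = (SIGMA u:{u :: bool list. length u \<le> N}. {0..<p (length u)})"
  have "finite X"
    unfolding X_def using finite_lists_length_le[of "UNIV :: bool set" N] by (intro finite_SigmaI) auto
  define L where "L = {ev (layer_act \<eta> p) w | w. tev \<eta> w = id \<and>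
    (\<forall>u i. N < length u \<longrightarrow> ev (layer_act \<eta> p) w (u, i) = (u, i))}"
  have "L \<subseteq> {f. f ` X \<subseteq> X \<and> (\<forall>x. x \<notin> X \<longrightarrow> f x = x)}"
  proof
    fix f assume "f \<in> L"
    then obtain w where w: "f = ev (layer_act \<eta> p) w" "tev \<eta> w = id"
        "\<And>u i. N < length u \<Longrightarrow> ev (layer_act \<eta> p) w (u, i) = (u, i)" by (auto simp: L_def)
    have f: "f (u, i) = (u, snd (f (u, i)))" for u i
      using fst_ev_layer[of \<eta> p w "(u, i)"] by (simp add: w(1,2) prod_eq_iff)
    have "f (u, i) \<in> X" if "(u, i) \<in> X" for u i
      using that snd_ev_layer(1)[of \<eta> p w u i] by (subst f) (auto simp: X_def w(1))
    moreover have "f (u, i) = (u, i)" if "(u, i) \<notin> X" for u i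
    proof (cases "N < length u")
      case True
      then show ?thesis using w by simp
    next
      case False
      then show ?thesis using that snd_ev_layer(2)[of i p u \<eta> w] by (subst f) (auto simp: X_def w(1))
    qed
    ultimately show "f \<in> {f. f ` X \<subseteq> X \<and> (\<forall>x. x \<notin> X \<longrightarrow> f x = x)}" by auto
  qed
  then have "finite L" by (rule finite_subset) (rule finite_functions_supported_on[OF \<open>finite X\<close>])
  moreover have "id \<in> L" unfolding L_def by (rule CollectI, rule exI[of _ "[]"]) simp
  moreover have "ev (layer_act \<eta> p) ` W \<subseteq> L"
  proof (rule image_subsetI)
    fix w assume w: "w \<in> W"
    have "ev (layer_act \<eta> p) w (u, i) = (u, i)" if "N < length u" for u i
      unfolding ev_layer using N[OF w] that by (intro J[OF w klein_dih]) simp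
    then show "ev (layer_act \<eta> p) w \<in> L" using W(2) w by (auto simp: L_def)
  qed
  moreover have "L \<subseteq> ev (layer_act \<eta> p) ` {w. tev \<eta> w = id}" by (auto simp: L_def)
  moreover have "\<forall>k\<in>L. \<forall>l\<in>L. k \<circ> l \<in> L"
  proof (intro ballI)
    fix k l assume "k \<in> L" "l \<in> L"
    then obtain v w where "k = ev (layer_act \<eta> p) v" "tev \<eta> v = id"
        "\<And>u i. N < length u \<Longrightarrow> ev (layer_act \<eta> p) v (u, i) = (u, i)"
        "l = ev (layer_act \<eta> p) w" "tev \<eta> w = id"
        "\<And>u i. N < length u \<Longrightarrow> ev (layer_act \<eta> p) w (u, i) = (u, i)"
      by (auto simp: L_def)
    then show "k \<circ> l \<in> L"
      unfolding L_def by (intro CollectI exI[of _ "v @ w"]) (simp add: ev_append)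
  qed
  ultimately show "\<exists>L. finite L \<and> id \<in> L \<and> ev (layer_act \<eta> p) ` W \<subseteq> L \<and>
    L \<subseteq> ev (layer_act \<eta> p) ` {w. tev \<eta> w = id} \<and> (\<forall>k\<in>L. \<forall>l\<in>L. k \<circ> l \<in> L)"
    by (intro exI[of _ L] conjI)
qed (rule klein_tree_act)

section \<open>Separating words\<close>

lemma funpow_fact_card:
  assumes "finite X" "f ` X \<subseteq> X" "inj f" "x \<in> X"
  shows "(f ^^ fact (card X)) x = x"
proof -
  have in_X: "(f ^^ i) x \<in> X" for i using assms by (induction i) auto
  have "\<not> inj_on (\<lambda>i. (f ^^ i) x) {..card X}"
  proof
    assume "inj_on (\<lambda>i. (f ^^ i) x) {..card X}"
    then have "card {..card X} \<le> card X"
      by (rule card_inj_on_le) (use in_X assms(1) in auto)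
    then show False by simp
  qed
  then obtain a b where ab: "a \<le> card X" "b \<le> card X" "(f ^^ a) x = (f ^^ b) x" "a \<noteq> b"
    by (auto simp: inj_on_def)
  define i j where "i = min a b" and "j = max a b"
  have ij: "i < j" "j \<le> card X" "(f ^^ i) x = (f ^^ j) x"
    using ab by (auto simp: i_def j_def min_def max_def)
  have "(f ^^ i) ((f ^^ (j - i)) x) = (f ^^ i) x"
    using ij funpow_add[of i "j - i" f] by simp
  then have d: "(f ^^ (j - i)) x = x"
    using inj_fn[OF assms(3), of i] by (metis injD)
  have "(j - i) dvd fact (card X)" using ij by (intro dvd_fact) auto
  then obtain k where k: "fact (card X) = (j - i) * k" by (rule dvdE)
  have "(((f ^^ (j - i)) ^^ n)) x = x" for n by (induction n) (auto simp: d)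
  then show ?thesis by (simp add: k funpow_mult)
qed

definition level_set :: "nat \<Rightarrow> int \<Rightarrow> (bool list \<times> int) set" where
  "level_set n P = {u. length u = n} \<times> {0..<P}"

lemma finite_level_set: "finite (level_set n P)"
  unfolding level_set_def using finite_lists_length_eq[of "UNIV :: bool set" n] by auto

lemma level_power_trivial:
  assumes id: "tev \<eta> w = id" and u: "length u = n"
  shows "(ev (dec_act (dih P z) \<eta>) w ^^ fact (card (level_set n P))) (u, i) = (u, i)"
proof (cases "0 \<le> i \<and> i < P")
  case True
  interpret D: klein_action "dec_act (dih P z) \<eta>" by (intro klein_dec_act klein_dih)
  have "ev (dec_act (dih P z) \<eta>) w ` level_set n P \<subseteq> level_set n P"
  proof (rule image_subsetI)
    fix q assume "q \<in> level_set n P"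
    then show "ev (dec_act (dih P z) \<eta>) w q \<in> level_set n P"
      using dec_dih_range(1)[of P z \<eta> w q] length_fst_ev_dec[of "dih P z" \<eta> w q]
      by (auto simp: level_set_def mem_Times_iff)
  qed
  then show ?thesis
    using funpow_fact_card[OF finite_level_set _ D.inj_ev] True u by (auto simp: level_set_def)
next
  case False
  have "ev (dec_act (dih P z) \<eta>) w (u, i) = (u, i)"
    using dec_dih_range(2)[of "(u, i)" P z \<eta> w] fst_ev_dec[of "dih P z" \<eta> w "(u, i)"] False
    by (simp add: id prod_eq_iff)
  then have "(ev (dec_act (dih P z) \<eta>) w ^^ k) (u, i) = (u, i)" for k by (induction k) auto
  then show ?thesis .
qed

text \<open>A power \<open>v\<close> of the word from \<open>finite_order_word_with_section\<close> is trivial on the tree, and \<open>v ^ E\<close> translates the decoration 0 at the vertex \<open>1 \<dots> 1\<close> of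
depth \<open>J\<close> by \<open>m * E\<close>, where \<open>m\<close> is the exponent of the power.  The period \<open>m * E + 1\<close> makes this translation nontrivial.\<close>

lemma separation_step:
  assumes \<eta>: "two_recurrent \<eta>" and "E > 0"
  shows "\<exists>w P J'. P > 0 \<and> J < J' \<and> tev \<eta> w = id \<and>
    ev (level_act \<eta> J P) (concat (replicate E w)) (replicate J True, 0) \<noteq> (replicate J True, 0) \<and>
    (\<forall>L :: letter \<Rightarrow> int \<Rightarrow> int. klein_action L \<longrightarrow>
      (\<forall>u i. J' \<le> length u \<longrightarrow> ev (dec_act L \<eta>) w (u, i) = (u, i)))"
proof -
  obtain w where fin: "finite_order (tev \<eta> w)"
    and w: "\<And>(L :: letter \<Rightarrow> int \<Rightarrow> int) i. ev (dec_act L \<eta>) w (replicate J True, i) =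
      (replicate J True, L (Some (\<eta> J)) (L None i))"
    using finite_order_word_with_section[OF \<eta>] by blast
  obtain m where m: "m > 0" "tev \<eta> w ^^ m = id" using fin by (auto simp: finite_order_def)
  define v where "v = concat (replicate m w)"
  define P where "P = int (m * E) + 1"
  define z where "z = third (\<eta> J) (\<eta> J)"
  have v: "tev \<eta> v = id" by (simp add: v_def ev_concat_replicate m)
  obtain J0 where J0: "\<forall>L :: letter \<Rightarrow> int \<Rightarrow> int. klein_action L \<longrightarrow>
      (\<forall>u i. J0 \<le> length u \<longrightarrow> ev (dec_act L \<eta>) v (u, i) = (u, i))"
    using trivial_word_eventually_trivial[OF \<eta> v] by blast
  let ?L = "dih P z"
  have pow: "(ev (dec_act ?L \<eta>) w ^^ k) (replicate J True, i) =
      (replicate J True, ((\<lambda>i. ?L (Some (\<eta> J)) (?L None i)) ^^ k) i)" for k i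
    by (induction k) (auto simp: w)
  have "ev (dec_act ?L \<eta>) (concat (replicate E v)) (replicate J True, 0) =
      (replicate J True, ((\<lambda>i. ?L (Some (\<eta> J)) (?L None i)) ^^ (m * E)) 0)"
    by (simp add: ev_concat_replicate v_def funpow_mult pow)
  also have "((\<lambda>i. ?L (Some (\<eta> J)) (?L None i)) ^^ (m * E)) 0 = int (m * E) mod P"
    by (rule dih_rotation) (auto simp: P_def z_def third[THEN not_sym] simp flip: of_nat_mult)
  also have "\<dots> = int (m * E)" by (simp add: P_def)
  finally have "ev (dec_act ?L \<eta>) (concat (replicate E v)) (replicate J True, 0) \<noteq> (replicate J True, 0)"
    using m \<open>E > 0\<close> by simp
  moreover have "P > 0" by (simp add: P_def add_nonneg_pos)
  ultimately show ?thesis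
    using v J0 unfolding z_def by (intro exI[of _ v] exI[of _ P] exI[of _ "max J0 (Suc J)"]) auto
qed

text \<open>Depths \<open>J k\<close>, periods \<open>P k\<close> and words \<open>v k\<close> are chosen one after the other.  At the depths chosen earlier \<open>v k\<close> acts trivially
because it is a power whose exponent \<open>Ek k\<close> is divisible by the exponents of the finite groups acting there;
at the depths chosen later it acts trivially because they lie beyond the depth where it can move anything.\<close>

theorem separating_words:
  assumes \<eta>: "two_recurrent \<eta>"
  shows "\<exists>(v :: nat \<Rightarrow> word) (J :: nat \<Rightarrow> nat) (P :: nat \<Rightarrow> int). strict_mono J \<and> (\<forall>k. P k > 0) \<and>
    (\<forall>k. tev \<eta> (v k) = id) \<and>
    (\<forall>k. \<exists>q. ev (level_act \<eta> (J k) (P k)) (v k) q \<noteq> q \<and> length (fst q) = J k) \<and>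
    (\<forall>k k' u i. k \<noteq> k' \<longrightarrow> length u = J k' \<longrightarrow>
      ev (level_act \<eta> (J k') (P k')) (v k) (u, i) = (u, i))"
proof -
  define Q where "Q J E w P J' \<longleftrightarrow> P > 0 \<and> J < J' \<and> tev \<eta> w = id \<and>
      ev (level_act \<eta> J P) (concat (replicate E w)) (replicate J True, 0) \<noteq> (replicate J True, 0) \<and>
      (\<forall>L :: letter \<Rightarrow> int \<Rightarrow> int. klein_action L \<longrightarrow>
        (\<forall>u i. J' \<le> length u \<longrightarrow> ev (dec_act L \<eta>) w (u, i) = (u, i)))" for J E w P J'
  define w where "w J E = (SOME w. \<exists>P J'. Q J E w P J')" for J E
  define P where "P J E = (SOME P. \<exists>J'. Q J E (w J E) P J')" for J E
  define J' where "J' J E = (SOME J'. Q J E (w J E) (P J E) J')" for J E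
  have Q: "Q J E (w J E) (P J E) (J' J E)" if "E > 0" for J E
  proof -
    have "\<exists>w P J'. Q J E w P J'"
      unfolding Q_def by (rule separation_step[OF \<eta> that])
    then have "\<exists>P J'. Q J E (w J E) P J'" unfolding w_def by (rule someI_ex)
    then have "\<exists>J'. Q J E (w J E) (P J E) J'" unfolding P_def by (rule someI_ex)
    then show ?thesis unfolding J'_def by (rule someI_ex)
  qed
  define next_st :: "nat \<times> nat \<Rightarrow> nat \<times> nat" where
    "next_st = (\<lambda>(J, E). (J' J E, E * fact (card (level_set J (P J E)))))"
  define st where "st k = (next_st ^^ k) (0, 1)" for k
  define Jk where "Jk k = fst (st k)" for k
  define Ek where "Ek k = snd (st k)" for k
  have st_Suc: "Jk (Suc k) = J' (Jk k) (Ek k)" "Ek (Suc k) = Ek k * fact (card (level_set (Jk k) (P (Jk k) (Ek k))))" for k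
    by (simp_all add: Jk_def Ek_def st_def next_st_def split_beta)
  have E_pos: "Ek k > 0" for k
    by (induction k) (simp_all add: st_Suc, simp add: Ek_def st_def)
  note step' = Q[OF E_pos, unfolded Q_def]
  have "strict_mono Jk" by (simp add: strict_mono_Suc_iff st_Suc step')
  define v where "v k = concat (replicate (Ek k) (w (Jk k) (Ek k)))" for k
  have E_dvd: "Ek i dvd Ek j" if "i \<le> j" for i j
    using that by (induction j rule: dec_induct) (auto simp: st_Suc)
  have v_id: "tev \<eta> (v k) = id" for k
    using step'[of "Jk k" k] by (simp add: v_def ev_concat_replicate)
  have disj: "ev (level_act \<eta> (Jk k') (P (Jk k') (Ek k'))) (v k) (u, i) = (u, i)"
    if "k \<noteq> k'" and u: "length u = Jk k'" for k k' u i
  proof (cases "k' < k")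
    case True
    let ?f = "ev (level_act \<eta> (Jk k') (P (Jk k') (Ek k'))) (w (Jk k) (Ek k))"
    have "fact (card (level_set (Jk k') (P (Jk k') (Ek k')))) dvd Ek (Suc k')" by (simp add: st_Suc)
    also have "\<dots> dvd Ek k" using True by (intro E_dvd) simp
    finally obtain n where n: "Ek k = fact (card (level_set (Jk k') (P (Jk k') (Ek k')))) * n" by (rule dvdE)
    have "(?f ^^ fact (card (level_set (Jk k') (P (Jk k') (Ek k'))))) (u, i) = (u, i)"
      using step'[of "Jk k" k] u by (intro level_power_trivial) auto
    then have "((?f ^^ fact (card (level_set (Jk k') (P (Jk k') (Ek k'))))) ^^ n) (u, i) = (u, i)"
      by (induction n) auto
    then show ?thesis by (simp add: v_def ev_concat_replicate n funpow_mult)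
  next
    case False
    then have "Suc k \<le> k'" using that by simp
    then have "Jk (Suc k) \<le> Jk k'" using \<open>strict_mono Jk\<close> by (simp add: strict_mono_less_eq)
    then have "J' (Jk k) (Ek k) \<le> length u" using u by (simp add: st_Suc)
    then have "ev (level_act \<eta> (Jk k') (P (Jk k') (Ek k'))) (w (Jk k) (Ek k)) (u, i) = (u, i)"
      using step'[of "Jk k" k] klein_dih by blast
    then have "(ev (level_act \<eta> (Jk k') (P (Jk k') (Ek k'))) (w (Jk k) (Ek k)) ^^ n) (u, i) = (u, i)" for n
      by (induction n) auto
    then show ?thesis by (simp add: v_def ev_concat_replicate)
  qed
  show ?thesis
  proof (rule exI[of _ v], rule exI[of _ Jk], rule exI[of _ "\<lambda>k. P (Jk k) (Ek k)"], intro conjI allI impI)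
    show "\<exists>q. ev (level_act \<eta> (Jk k) (P (Jk k) (Ek k))) (v k) q \<noteq> q \<and> length (fst q) = Jk k" for k
      using step'[of "Jk k" k] by (intro exI[of _ "(replicate (Jk k) True, 0)"]) (simp add: v_def)
    show "P (Jk k) (Ek k) > 0" for k using step' by blast
  qed (rule \<open>strict_mono Jk\<close> v_id disj | assumption)+
qed

definition sub_periods :: "(nat \<Rightarrow> nat) \<Rightarrow> (nat \<Rightarrow> int) \<Rightarrow> nat set \<Rightarrow> nat \<Rightarrow> int" where
  "sub_periods J P K n = (if \<exists>k\<in>K. J k = n then P (inv_into UNIV J n) else 1)"

text \<open>A set \<open>K\<close> of natural numbers is encoded by decorating the depths \<open>J k\<close> with \<open>k \<in> K\<close>; the relations recover \<open>K\<close>.\<close>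

theorem family_of_layer_actions:
  assumes \<eta>: "two_recurrent \<eta>"
  shows "\<exists>(p :: nat set \<Rightarrow> nat \<Rightarrow> int) (v :: nat \<Rightarrow> word).
    \<forall>k K. ev (layer_act \<eta> (p K)) (v k) = id \<longleftrightarrow> k \<notin> K"
proof -
  obtain v J and P :: "nat \<Rightarrow> int" where J: "strict_mono J"
    and v_id: "\<forall>k. tev \<eta> (v k) = id"
    and sep: "\<forall>k. \<exists>q. ev (level_act \<eta> (J k) (P k)) (v k) q \<noteq> q \<and> length (fst q) = J k"
    and triv: "\<forall>k k' u i. k \<noteq> k' \<longrightarrow> length u = J k' \<longrightarrow>
      ev (level_act \<eta> (J k') (P k')) (v k) (u, i) = (u, i)"
    using separating_words[OF \<eta>] by (elim exE conjE)
  have inj: "inj J" using J by (rule strict_mono_imp_inj_on)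
  have at: "sub_periods J P K (J k) = (if k \<in> K then P k else 1)" for K k
    using inj by (auto simp: sub_periods_def inv_f_f inj_eq)
  have off: "ev (dec_act (dih 1 z) \<eta>) (v k) q = q" for z k q
    using dec_dih_range(2)[of q 1 z \<eta> "v k"] dec_dih_range(1)[of 1 z \<eta> "v k" q]
      fst_ev_dec[of "dih 1 z" \<eta> "v k" q]
    by (cases "0 \<le> snd q \<and> snd q < 1") (auto simp: v_id prod_eq_iff)
  show ?thesis
  proof (intro exI allI)
    fix k K
    show "ev (layer_act \<eta> (sub_periods J P K)) (v k) = id \<longleftrightarrow> k \<notin> K"
    proof
      assume id: "ev (layer_act \<eta> (sub_periods J P K)) (v k) = id"
      show "k \<notin> K"
      proof
        assume "k \<in> K"
        obtain u i where "ev (level_act \<eta> (J k) (P k)) (v k) (u, i) \<noteq> (u, i)" "length u = J k"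
          using sep by (metis prod.collapse)
        then show False using fun_cong[OF id, of "(u, i)"] \<open>k \<in> K\<close> by (simp add: ev_layer at)
      qed
    next
      assume k: "k \<notin> K"
      have "ev (layer_act \<eta> (sub_periods J P K)) (v k) (u, i) = (u, i)" for u i
      proof (cases "\<exists>k'\<in>K. J k' = length u")
        case True
        then obtain k' where k': "k' \<in> K" "length u = J k'" by auto
        then have "k \<noteq> k'" using k by auto
        from triv[rule_format, OF this k'(2)] show ?thesis by (simp add: ev_layer k' at)
      next
        case False
        then show ?thesis by (simp add: ev_layer sub_periods_def off)
      qed
      then show "ev (layer_act \<eta> (sub_periods J P K)) (v k) = id" by (auto simp: fun_eq_iff)
    qed
  qed
qed

section \<open>Gray code\<close>

text \<open>The graph of the action on a level of the tree is a path, and \<open>pos u\<close> is the position of the vertex \<open>u\<close> on it, counted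
from the end \<open>1 \<dots> 1\<close>.  Positions \<open>2 * k\<close> and \<open>2 * k + 1\<close> are joined by \<open>a\<close>, positions \<open>2 * k - 1\<close> and \<open>2 * k\<close> by two of the
letters \<open>b, c, d\<close>, and the third letter fixes both.\<close>

fun pos :: "bool list \<Rightarrow> nat" where
  "pos [] = 0"
| "pos (y # u) = 2 * pos u + (if even (pos u) = y then 0 else 1)"

definition step_a :: "nat \<Rightarrow> nat" where "step_a k = (if even k then Suc k else k - 1)"
definition step_V :: "nat \<Rightarrow> nat" where "step_V k = (if even k then k - 1 else Suc k)"

lemma pos_tree_a: "u \<noteq> [] \<Longrightarrow> pos (tree_act \<eta> None u) = step_a (pos u)"
  by (cases u) (auto simp: step_a_def)

lemma pos_less: "pos u < 2 ^ length u"
  by (induction u) auto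

lemma pos_surj: "k < 2 ^ n \<Longrightarrow> \<exists>u. length u = n \<and> pos u = k"
proof (induction n arbitrary: k)
  case (Suc n)
  then obtain u where u: "length u = n" "pos u = k div 2" by (metis less_mult_imp_div_less power_Suc2)
  let ?y = "even (pos u) = even k"
  have "pos (?y # u) = 2 * (k div 2) + (if even k then 0 else 1)" using u by auto
  also have "\<dots> = k" by auto
  finally show ?case using u by (metis length_Cons)
qed simp

lemma pos_tree_V:
  assumes "0 < pos u" "Suc (pos u) < 2 ^ length u"
  shows "\<exists>z. tree_act \<eta> (Some z) u = u \<and> (\<forall>x. x \<noteq> z \<longrightarrow> pos (tree_act \<eta> (Some x) u) = step_V (pos u))"
  using assms
proof (induction u arbitrary: \<eta>)
  case (Cons y u)
  show ?case
  proof (cases y)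
    case False
    have "u \<noteq> []" using Cons.prems False by (cases u) auto
    then have p: "pos (tree_act \<eta> None u) = step_a (pos u)" by (rule pos_tree_a)
    have "pos u > 0" if "odd (pos u)" using that by (cases "pos u") auto
    then have "pos (False # tree_act \<eta> None u) = step_V (pos (False # u))"
      by (auto simp: p step_a_def step_V_def elim!: oddE)
    then show ?thesis using False by (intro exI[of _ "\<eta> 0"]) auto
  next
    case True
    have u0: "0 < pos u" using Cons.prems(1) True by (cases "pos u = 0") auto
    have u1: "Suc (pos u) < 2 ^ length u"
    proof (rule ccontr)
      assume "\<not> Suc (pos u) < 2 ^ length u"
      then have e: "Suc (pos u) = 2 ^ length u" using pos_less[of u] by simp
      have "length u \<noteq> 0" using u0 by auto
      then have "even (Suc (pos u))" unfolding e by simp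
      then have "pos (y # u) = Suc (2 * pos u)" using True by auto
      then show False using Cons.prems(2) e by simp
    qed
    obtain z where z: "tree_act (shift \<eta>) (Some z) u = u"
        "\<And>x. x \<noteq> z \<Longrightarrow> pos (tree_act (shift \<eta>) (Some x) u) = step_V (pos u)"
      using Cons.IH[OF u0 u1] by blast
    have "pos (tree_act \<eta> (Some x) (y # u)) = step_V (pos (y # u))" if "x \<noteq> z" for x
      using z(2)[OF that] u0 True by (auto simp: step_V_def)
    then show ?thesis using z(1) True by (intro exI[of _ z]) auto
  qed
qed simp

lemma step_bounds: "step_a k \<le> Suc k" "k \<le> Suc (step_a k)" "step_V k \<le> Suc k" "k \<le> Suc (step_V k)"
  by (auto simp: step_a_def step_V_def)

lemma pos_ev_interior:
  assumes "pos u = Suc r" "2 * r + 3 < 2 ^ length u" "length w \<le> r"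
  shows "pos (tev \<eta> w u) \<le> Suc r + length w \<and> Suc r \<le> pos (tev \<eta> w u) + length w"
  using assms(3)
proof (induction w)
  case (Cons s w)
  let ?v = "tev \<eta> w u"
  have v: "pos ?v \<le> Suc r + length w" "Suc r \<le> pos ?v + length w" using Cons by auto
  have "pos (tree_act \<eta> s ?v) \<in> {pos ?v, step_a (pos ?v), step_V (pos ?v)}"
  proof (cases s)
    case None
    have "?v \<noteq> []" using v Cons.prems by (cases ?v) auto
    then show ?thesis using None by (simp add: pos_tree_a)
  next
    case (Some x)
    have "0 < pos ?v" "Suc (pos ?v) < 2 ^ length ?v" using v Cons.prems assms(2) by auto
    from pos_tree_V[OF this, of \<eta>] show ?thesis using Some by (metis insertCI)
  qed
  then show ?case using v step_bounds[of "pos ?v"] by auto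
qed (use assms in simp)

text \<open>On the path \<open>4 * M\<close> becomes the sum of the value at the neighbour along \<open>a\<close>, twice the value at the other neighbour, and
the value itself.  This function is geometric of ratio \<open>z\<close> on the even and on the odd positions.  It is an
eigenfunction with value \<open>1 + \<mu>\<close> if \<open>\<mu>^2\<close> is the squared modulus of \<open>1 + 2 * z\<close>, and for unimodular \<open>z\<close> it is then unimodular.\<close>

definition line_fun :: "complex \<Rightarrow> real \<Rightarrow> nat \<Rightarrow> complex" where
  "line_fun z \<mu> k = (if even k then 1 else of_real \<mu> / (1 + 2 * cnj z)) * z ^ (k div 2)"

lemma line_fun_eigen:
  assumes z: "cmod z = 1" and \<mu>: "cmod (1 + 2 * z) = \<bar>\<mu>\<bar>" "\<mu> \<noteq> 0" and "0 < k"
  shows "line_fun z \<mu> (step_a k) + 2 * line_fun z \<mu> (step_V k) + line_fun z \<mu> k = (1 + of_real \<mu>) * line_fun z \<mu> k"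
proof -
  have zz: "z * cnj z = 1" using z by (simp add: complex_norm_square[symmetric])
  have "cmod (1 + 2 * cnj z) = cmod (1 + 2 * z)"
    by (metis complex_cnj_add complex_cnj_mult complex_cnj_numeral complex_cnj_one complex_mod_cnj)
  then have ne: "1 + 2 * cnj z \<noteq> 0" using \<mu> by auto
  have "(1 + 2 * z) * (1 + 2 * cnj z) = complex_of_real ((cmod (1 + 2 * z))\<^sup>2)"
    by (subst complex_norm_square) simp
  also have "\<dots> = of_real \<mu> * of_real \<mu>" by (simp add: \<mu> power2_eq_square)
  finally have mm: "(1 + 2 * z) * (1 + 2 * cnj z) = of_real \<mu> * of_real \<mu>" .
  show ?thesis
  proof (cases "even k")
    case True
    then obtain j where j: "k = 2 * Suc j" using \<open>0 < k\<close> by (metis evenE gr0_implies_Suc nat_0_less_mult_iff)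
    define c where "c = of_real \<mu> / (1 + 2 * cnj z)"
    have c: "c * (1 + 2 * cnj z) = of_real \<mu>" using ne by (simp add: c_def)
    have "z ^ j = (z * cnj z) * z ^ j" by (simp add: zz)
    then have zj: "z ^ j = cnj z * z ^ Suc j" by (simp add: mult_ac)
    have "line_fun z \<mu> (step_a k) = c * z ^ Suc j" "line_fun z \<mu> (step_V k) = c * z ^ j" "line_fun z \<mu> k = z ^ Suc j"
      by (simp_all add: line_fun_def step_a_def step_V_def j c_def)
    then have "line_fun z \<mu> (step_a k) + 2 * line_fun z \<mu> (step_V k) + line_fun z \<mu> k =
        c * z ^ Suc j + 2 * (c * (cnj z * z ^ Suc j)) + z ^ Suc j"
      by (simp only: zj)
    also have "\<dots> = (1 + c * (1 + 2 * cnj z)) * z ^ Suc j" by (simp only: algebra_simps mult_1_left)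
    finally show ?thesis unfolding c by (simp add: line_fun_def j)
  next
    case False
    then obtain j where j: "k = Suc (2 * j)" by (auto elim: oddE)
    define c where "c = of_real \<mu> / (1 + 2 * cnj z)"
    have "c * (1 + 2 * cnj z) = of_real \<mu>" using ne by (simp add: c_def)
    then have "(1 + 2 * z) * (1 + 2 * cnj z) = (of_real \<mu> * c) * (1 + 2 * cnj z)"
      using mm by (simp only: mult.assoc)
    then have c: "1 + 2 * z = of_real \<mu> * c" using ne by simp
    have "line_fun z \<mu> (step_a k) = z ^ j" "line_fun z \<mu> (step_V k) = z * z ^ j" "line_fun z \<mu> k = c * z ^ j"
      by (simp_all add: line_fun_def step_a_def step_V_def j c_def)
    then have "line_fun z \<mu> (step_a k) + 2 * line_fun z \<mu> (step_V k) + line_fun z \<mu> k =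
        (1 + 2 * z) * z ^ j + c * z ^ j"
      by (simp only: algebra_simps mult_1_left)
    also have "\<dots> = (1 + of_real \<mu>) * (c * z ^ j)" unfolding c by (simp only: algebra_simps mult_1_left)
    finally show ?thesis using \<open>line_fun z \<mu> k = c * z ^ j\<close> by (simp only:)
  qed
qed

lemma cmod_line_fun:
  assumes z: "cmod z = 1" and \<mu>: "cmod (1 + 2 * z) = \<bar>\<mu>\<bar>" "\<mu> \<noteq> 0"
  shows "cmod (line_fun z \<mu> k) = 1"
proof -
  have "cmod (1 + 2 * cnj z) = cmod (1 + 2 * z)"
    by (metis complex_cnj_add complex_cnj_mult complex_cnj_numeral complex_cnj_one complex_mod_cnj)
  then show ?thesis using z \<mu> by (simp add: line_fun_def norm_mult norm_power norm_divide)
qed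

lemma unit_with_modulus:
  assumes "1 \<le> m" "m \<le> 3"
  obtains z where "cmod z = 1" "cmod (1 + 2 * z) = m"
proof -
  define \<theta> where "\<theta> = arccos ((m\<^sup>2 - 5) / 4)"
  have m2: "1 \<le> m\<^sup>2" "m\<^sup>2 \<le> 9" using assms power_mono[of 1 m 2] power_mono[of m 3 2] by auto
  have cos: "cos \<theta> = (m\<^sup>2 - 5) / 4" unfolding \<theta>_def using m2 by (intro cos_arccos) auto
  have "(cmod (1 + 2 * cis \<theta>))\<^sup>2 = (1 + 2 * cos \<theta>)\<^sup>2 + (2 * sin \<theta>)\<^sup>2" by (simp add: cmod_power2)
  also have "\<dots> = 1 + 4 * cos \<theta> + 4 * (cos \<theta>)\<^sup>2 + 4 * (sin \<theta>)\<^sup>2"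
    by (simp add: power2_eq_square algebra_simps del: sin_cos_squared_add3)
  also have "\<dots> = m\<^sup>2" by (simp add: sin_squared_eq cos field_simps)
  finally have "(cmod (1 + 2 * cis \<theta>))\<^sup>2 = m\<^sup>2" .
  then have "cmod (1 + 2 * cis \<theta>) = m" by (rule power2_eq_imp_eq) (use assms in auto)
  then show thesis using that[of "cis \<theta>"] by simp
qed

section \<open>The generators of \<open>G_omega\<close>\<close>

lemma tree_word_Suc_Suc: "tree_word (Suc (Suc n)) = True # tree_word (Suc n)"
  by (simp add: tree_word_def)

lemma tree_word_1: "tree_word (Suc 0) = [False]" "tree_word 0 = []"
  by (simp_all add: tree_word_def)

lemma \<sigma>_Cons:
  "\<sigma> 0 (y # u) = (\<not> y) # u" "\<sigma> 0 [] = []"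
  "\<sigma> (Suc 0) (False # u) = False # \<sigma> 0 u" "\<sigma> (Suc 0) (True # u) = True # u"
  "\<sigma> (Suc (Suc n)) (False # u) = False # u" "\<sigma> (Suc (Suc n)) (True # u) = True # \<sigma> (Suc n) u"
  by (auto simp: \<sigma>_def tree_word_Suc_Suc tree_word_1 split: nat.splits)

lemma \<sigma>_partial_prod_True:
  assumes "0 \<notin> N"
  shows "\<sigma>_partial_prod N (Suc k) (True # u) = True # \<sigma>_partial_prod {n. 1 \<le> n \<and> Suc n \<in> N} k u"
proof (induction k arbitrary: u)
  case (Suc k)
  then show ?case by (cases k) (auto simp: \<sigma>_Cons simp del: \<sigma>_partial_prod.simps(2), auto simp: \<sigma>_Cons)
qed (use assms in simp)

lemma \<sigma>_partial_prod_False: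
  assumes "0 \<notin> N"
  shows "\<sigma>_partial_prod N (Suc (Suc k)) (False # u) = False # (if 1 \<in> N then \<sigma> 0 u else u)"
proof (induction k)
  case 0
  then show ?case using assms by (auto simp: \<sigma>_Cons)
next
  case (Suc k)
  then show ?case by (subst \<sigma>_partial_prod.simps(2)) (auto simp: \<sigma>_Cons simp del: \<sigma>_partial_prod.simps(2))
qed

lemma gen_a_eq: "gen_a = tree_act \<eta> None"
proof
  fix u show "gen_a u = tree_act \<eta> None u" by (cases u) (auto simp: gen_a_def \<sigma>_Cons)
qed

lemma \<sigma>_prod_eq_tree_act: "\<sigma>_prod {n. 1 \<le> n \<and> \<eta> (n - 1) \<noteq> x} u = tree_act \<eta> (Some x) u"
proof (induction u arbitrary: \<eta>)
  case Nil
  show ?case using \<sigma>_prod_eq[of "[]" 0] by simp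
next
  case (Cons y u)
  let ?N = "{n. 1 \<le> n \<and> \<eta> (n - 1) \<noteq> x}"
  have 0: "0 \<notin> ?N" by simp
  have eq: "\<sigma>_prod ?N (y # u) = \<sigma>_partial_prod ?N (Suc (Suc (length u))) (y # u)"
    by (rule \<sigma>_prod_eq) simp
  show ?case
  proof (cases y)
    case True
    have N: "{n. 1 \<le> n \<and> Suc n \<in> ?N} = {n. 1 \<le> n \<and> shift \<eta> (n - 1) \<noteq> x}"
      by (auto simp: shift_def)
    have "\<sigma>_prod ?N (y # u) = True # \<sigma>_partial_prod {n. 1 \<le> n \<and> Suc n \<in> ?N} (Suc (length u)) u"
      unfolding eq using True by (simp only: \<sigma>_partial_prod_True[OF 0] simp_thms)
    also have "\<dots> = True # \<sigma>_prod {n. 1 \<le> n \<and> Suc n \<in> ?N} u"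
      by (subst \<sigma>_prod_eq[of u "Suc (length u)"]) simp_all
    also have "\<dots> = True # tree_act (shift \<eta>) (Some x) u" unfolding N Cons ..
    finally show ?thesis by (simp add: True)
  next
    case False
    have "\<sigma>_prod ?N (y # u) = False # (if 1 \<in> ?N then \<sigma> 0 u else u)"
      unfolding eq using False by (simp only: \<sigma>_partial_prod_False[OF 0] simp_thms)
    moreover have "\<sigma> 0 u = tree_act \<eta> None u" using gen_a_eq by (metis gen_a_def)
    ultimately show ?thesis using False by auto
  qed
qed

definition seq0 :: "symbol_seq \<Rightarrow> nat \<Rightarrow> symbol" where "seq0 \<omega> n = \<omega> (Suc n)"

lemma gen_eqs:
  "gen_a = tree_act (seq0 \<omega>) None" "gen_b \<omega> = tree_act (seq0 \<omega>) (Some Sym2)"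
  "gen_c \<omega> = tree_act (seq0 \<omega>) (Some Sym1)" "gen_d \<omega> = tree_act (seq0 \<omega>) (Some Sym0)"
proof -
  have N: "{n. 1 \<le> n \<and> seq0 \<omega> (n - 1) \<noteq> x} = {n. 1 \<le> n \<and> \<omega> n \<noteq> x}" for x
    by (auto simp: seq0_def)
  have c: "fst (Defs.column s) = Ent_Pi \<longleftrightarrow> s \<noteq> Sym2" "fst (snd (Defs.column s)) = Ent_Pi \<longleftrightarrow> s \<noteq> Sym1"
    "snd (snd (Defs.column s)) = Ent_Pi \<longleftrightarrow> s \<noteq> Sym0" for s
    by (cases s; simp)+
  show "gen_a = tree_act (seq0 \<omega>) None" by (rule gen_a_eq)
  show "gen_b \<omega> = tree_act (seq0 \<omega>) (Some Sym2)" "gen_c \<omega> = tree_act (seq0 \<omega>) (Some Sym1)"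
    "gen_d \<omega> = tree_act (seq0 \<omega>) (Some Sym0)"
    by (rule ext, simp only: gen_b_def gen_c_def gen_d_def c N[symmetric] \<sigma>_prod_eq_tree_act)+
qed

lemma two_recurrent_seq0:
  assumes "\<omega> \<in> Omega2"
  shows "two_recurrent (seq0 \<omega>)"
proof -
  obtain x y where xy: "x \<noteq> y" "infinite {n. 1 \<le> n \<and> \<omega> n = x}" "infinite {n. 1 \<le> n \<and> \<omega> n = y}"
    using assms unfolding Omega2_def by blast
  have "recurs x (seq0 \<omega>)" if "infinite {n. 1 \<le> n \<and> \<omega> n = x}" for x
    unfolding recurs_def
  proof
    fix m
    have "\<exists>n>m. n \<in> {n. 1 \<le> n \<and> \<omega> n = x}"
      using that[unfolded infinite_nat_iff_unbounded] by (rule spec)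
    then obtain n where "n > m" "\<omega> n = x" by blast
    then show "\<exists>n\<ge>m. seq0 \<omega> n = x" by (intro exI[of _ "n - 1"]) (auto simp: seq0_def)
  qed
  then show ?thesis using xy unfolding two_recurrent_def by blast
qed

lemma carrier_G_omega: "carrier (G_omega \<omega>) = range (tev (seq0 \<omega>))"
proof
  let ?S = "{gen_a, gen_b \<omega>, gen_c \<omega>, gen_d \<omega>}"
  have G: "carrier (G_omega \<omega>) = generate tree_aut ?S" by (simp add: G_omega_def)
  have letters: "range (tree_act (seq0 \<omega>)) = ?S"
  proof -
    have "range (tree_act (seq0 \<omega>)) = insert (tree_act (seq0 \<omega>) None) ((\<lambda>x. tree_act (seq0 \<omega>) (Some x)) ` UNIV)"
      by (simp add: UNIV_option_conv image_image)
    also have "(UNIV :: symbol set) = {Sym0, Sym1, Sym2}" by (auto intro: symbol.exhaust)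
    finally show ?thesis unfolding gen_eqs(2-)[of \<omega>] gen_eqs(1)[of \<omega>] by auto
  qed
  show "carrier (G_omega \<omega>) \<subseteq> range (tev (seq0 \<omega>))"
  proof
    fix g assume "g \<in> carrier (G_omega \<omega>)"
    then have "g \<in> generate tree_aut ?S" by (simp add: G_omega_def)
    then show "g \<in> range (tev (seq0 \<omega>))"
    proof induction
      case one
      have "\<one>\<^bsub>tree_aut\<^esub> = tev (seq0 \<omega>) []" by (simp add: tree_aut_def)
      then show ?case by (metis rangeI)
    next
      case (incl h)
      then obtain s where "h = tree_act (seq0 \<omega>) s" using letters by auto
      then have "h = tev (seq0 \<omega>) [s]" by simp
      then show ?case by (metis rangeI)
    next
      case (inv h)
      then obtain s where s: "h = tree_act (seq0 \<omega>) s" using letters by auto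
      have "h \<otimes>\<^bsub>tree_aut\<^esub> h = \<one>\<^bsub>tree_aut\<^esub>" by (simp add: tree_aut_def s fun_eq_iff)
      moreover have "h \<in> carrier tree_aut" using inv generators_in_tree_aut by blast
      ultimately have "inv\<^bsub>tree_aut\<^esub> h = h" using group_tree_aut by (simp add: group.inv_equality)
      then have "inv\<^bsub>tree_aut\<^esub> h = tev (seq0 \<omega>) [s]" by (simp add: s)
      then show ?case by (metis rangeI)
    next
      case (eng g h)
      then obtain v w where "g = tev (seq0 \<omega>) v" "h = tev (seq0 \<omega>) w" by auto
      then have "g \<otimes>\<^bsub>tree_aut\<^esub> h = tev (seq0 \<omega>) (v @ w)" by (simp add: tree_aut_def ev_append)
      then show ?case by (metis rangeI)
    qed
  qed
  show "range (tev (seq0 \<omega>)) \<subseteq> carrier (G_omega \<omega>)"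
  proof (rule image_subsetI)
    fix w
    show "tev (seq0 \<omega>) w \<in> carrier (G_omega \<omega>)"
    proof (induction w)
      case Nil
      have "tev (seq0 \<omega>) [] = \<one>\<^bsub>tree_aut\<^esub>" by (simp add: tree_aut_def)
      then show ?case by (simp add: G_omega_def generate.one del: ev.simps)
    next
      case (Cons s w)
      have "tree_act (seq0 \<omega>) s \<in> generate tree_aut ?S" using letters by (intro generate.incl) blast
      moreover have "tev (seq0 \<omega>) w \<in> generate tree_aut ?S" using Cons by (simp add: G_omega_def)
      ultimately have "tree_act (seq0 \<omega>) s \<otimes>\<^bsub>tree_aut\<^esub> tev (seq0 \<omega>) w \<in> generate tree_aut ?S"
        by (rule generate.eng)
      then have "tree_act (seq0 \<omega>) s \<circ> tev (seq0 \<omega>) w \<in> generate tree_aut ?S"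
        by (simp only: tree_aut_def monoid.simps)
      then show ?case by (simp only: G ev.simps)
    qed
  qed
qed


section \<open>Groups of words\<close>

instance symbol :: countable
  by countable_datatype

text \<open>An element of the group generated by the letters is coded by the number of one chosen word that represents it.\<close>

definition wcode :: "(letter \<Rightarrow> 'x \<Rightarrow> 'x) \<Rightarrow> word \<Rightarrow> nat" where
  "wcode act w = to_nat (SOME v. ev act v = ev act w)"

definition word_group :: "(letter \<Rightarrow> 'x \<Rightarrow> 'x) \<Rightarrow> nat monoid" where
  "word_group act = \<lparr>carrier = range (wcode act), mult = (\<lambda>m n. wcode act (from_nat m @ from_nat n)),
     one = wcode act []\<rparr>"

lemma ev_wcode [simp]: "ev act (from_nat (wcode act w)) = ev act w"
proof -
  have "ev act (SOME v. ev act v = ev act w) = ev act w" by (rule someI[of _ w]) simp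
  then show ?thesis by (simp add: wcode_def)
qed

lemma wcode_eq_iff: "wcode act v = wcode act w \<longleftrightarrow> ev act v = ev act w"
proof
  assume "wcode act v = wcode act w"
  then show "ev act v = ev act w" by (metis ev_wcode)
qed (simp add: wcode_def)

lemma word_group_simps:
  "carrier (word_group act) = range (wcode act)" "wcode act v \<otimes>\<^bsub>word_group act\<^esub> wcode act w = wcode act (v @ w)"
  "\<one>\<^bsub>word_group act\<^esub> = wcode act []"
  by (auto simp: word_group_def wcode_eq_iff ev_append)

lemma ev_word_group_mult:
  assumes "m \<in> carrier (word_group act)" "n \<in> carrier (word_group act)"
  shows "ev act (from_nat (m \<otimes>\<^bsub>word_group act\<^esub> n)) = ev act (from_nat m) \<circ> ev act (from_nat n)"
  using assms by (auto simp: word_group_simps ev_append)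

lemma generate_singleton_words:
  assumes "\<And>s. wcode act [s] \<in> S"
  shows "wcode act w \<in> generate (word_group act) S"
proof (induction w)
  case Nil
  show ?case using generate.one[of "word_group act" S] by (simp add: word_group_simps)
next
  case (Cons s w)
  have "wcode act [s] \<otimes>\<^bsub>word_group act\<^esub> wcode act w \<in> generate (word_group act) S"
    by (rule generate.eng[OF generate.incl[OF assms] Cons])
  then show ?case by (simp add: word_group_simps)
qed

context klein_action
begin

lemma group_word_group: "group (word_group act)"
proof (rule groupI)
  fix x assume "x \<in> carrier (word_group act)"
  then obtain w where w: "x = wcode act w" by (auto simp: word_group_simps)
  show "\<exists>y\<in>carrier (word_group act). y \<otimes>\<^bsub>word_group act\<^esub> x = \<one>\<^bsub>word_group act\<^esub>"
    by (rule bexI[of _ "wcode act (rev w)"])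
       (auto simp: w word_group_simps wcode_eq_iff ev_append fun_eq_iff ev_rev)
qed (auto simp: word_group_simps)

lemma folner_word_group:
  assumes "folner_action act"
  shows "folner (word_group act) (range (\<lambda>s. wcode act [s]))"
  unfolding folner_def
proof (intro allI impI)
  fix \<epsilon> :: real assume "\<epsilon> > 0"
  obtain \<Phi> where \<Phi>: "finite \<Phi>" "\<Phi> \<noteq> {}" "\<Phi> \<subseteq> range (ev act)"
    and small: "\<And>s. real (card ((\<lambda>g. act s \<circ> g) ` \<Phi> - \<Phi>)) \<le> \<epsilon> * real (card \<Phi>)"
    using assms[unfolded folner_action_def, rule_format, OF \<open>\<epsilon> > 0\<close>] by metis
  let ?G = "word_group act"
  define h where "h m = ev act (from_nat m)" for m
  have inj: "inj_on h (carrier ?G)"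
    by (rule inj_onI) (auto simp: h_def word_group_simps wcode_eq_iff)
  define \<Psi> where "\<Psi> = {m \<in> carrier ?G. h m \<in> \<Phi>}"
  have \<Psi>G: "\<Psi> \<subseteq> carrier ?G" by (auto simp: \<Psi>_def)
  have im: "h ` \<Psi> = \<Phi>"
  proof
    show "\<Phi> \<subseteq> h ` \<Psi>"
    proof
      fix g assume g: "g \<in> \<Phi>"
      then obtain w where "g = ev act w" using \<Phi>(3) by auto
      then have "h (wcode act w) = g" by (simp add: h_def)
      then show "g \<in> h ` \<Psi>" using g by (intro image_eqI[of _ _ "wcode act w"]) (auto simp: \<Psi>_def word_group_simps)
    qed
  qed (auto simp: \<Psi>_def)
  have inj\<Psi>: "inj_on h \<Psi>" using inj \<Psi>G by (rule inj_on_subset)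
  have "finite \<Psi>" using \<Phi>(1) im inj\<Psi> by (metis finite_imageD)
  moreover have "\<Psi> \<noteq> {}" using \<Phi>(2) im by auto
  moreover have "real (card ((\<lambda>x. g \<otimes>\<^bsub>?G\<^esub> x) ` \<Psi> - \<Psi>)) \<le> \<epsilon> * real (card \<Psi>)" if g: "g \<in> range (\<lambda>s. wcode act [s])" for g
  proof -
    obtain s where s: "g = wcode act [s]" using g by auto
    have gG: "g \<in> carrier ?G" by (simp add: s word_group_simps)
    have tG: "(\<lambda>x. g \<otimes>\<^bsub>?G\<^esub> x) ` \<Psi> \<subseteq> carrier ?G"
      using \<Psi>G gG by (intro image_subsetI monoid.m_closed[OF group.is_monoid[OF group_word_group]]) auto
    have hx: "h (g \<otimes>\<^bsub>?G\<^esub> x) = act s \<circ> h x" if "x \<in> \<Psi>" for x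
    proof -
      have "h (g \<otimes>\<^bsub>?G\<^esub> x) = h g \<circ> h x"
        unfolding h_def using gG that \<Psi>G by (intro ev_word_group_mult) auto
      also have "h g = act s" by (simp add: h_def s)
      finally show ?thesis .
    qed
    have "h ` (\<lambda>x. g \<otimes>\<^bsub>?G\<^esub> x) ` \<Psi> = (\<lambda>x. act s \<circ> h x) ` \<Psi>"
      unfolding image_image by (rule image_cong[OF refl hx])
    also have "\<dots> = (\<lambda>g. act s \<circ> g) ` h ` \<Psi>" by (rule image_image[symmetric])
    finally have t: "h ` (\<lambda>x. g \<otimes>\<^bsub>?G\<^esub> x) ` \<Psi> = (\<lambda>g. act s \<circ> g) ` \<Phi>"
      by (simp only: im)
    have sub: "(\<lambda>x. g \<otimes>\<^bsub>?G\<^esub> x) ` \<Psi> - \<Psi> \<subseteq> carrier ?G" using tG by blast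
    have "h ` ((\<lambda>x. g \<otimes>\<^bsub>?G\<^esub> x) ` \<Psi> - \<Psi>) = (\<lambda>g. act s \<circ> g) ` \<Phi> - \<Phi>"
      unfolding inj_on_image_set_diff[OF inj sub \<Psi>G] t im ..
    moreover have "card (h ` ((\<lambda>x. g \<otimes>\<^bsub>?G\<^esub> x) ` \<Psi> - \<Psi>)) = card ((\<lambda>x. g \<otimes>\<^bsub>?G\<^esub> x) ` \<Psi> - \<Psi>)"
      by (rule card_image[OF inj_on_subset[OF inj sub]])
    moreover have "card \<Psi> = card \<Phi>" using card_image[OF inj\<Psi>] im by simp
    ultimately show ?thesis using small[of s] by simp
  qed
  ultimately show "\<exists>\<Phi>. finite \<Phi> \<and> \<Phi> \<noteq> {} \<and> \<Phi> \<subseteq> carrier ?G \<and>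
     (\<forall>s\<in>range (\<lambda>s. wcode act [s]). real (card ((\<lambda>x. s \<otimes>\<^bsub>?G\<^esub> x) ` \<Phi> - \<Phi>)) \<le> \<epsilon> * real (card \<Phi>))"
    by (intro exI[of _ \<Psi>] conjI ballI \<Psi>G)
qed

end

section \<open>Covers of \<open>G_omega\<close>\<close>

lemma (in group) ord_eq_2:
  assumes "x \<in> carrier G" "x \<noteq> \<one>" "x \<otimes> x = \<one>"
  shows "ord x = 2"
proof -
  have "x [^] (2 :: nat) = \<one>" using assms by (simp add: numeral_2_eq_2)
  then have "ord x dvd 2" using assms(1) by (simp add: pow_eq_id)
  moreover from this have "ord x \<noteq> 0" by (intro notI) simp
  ultimately have "ord x \<le> 2" "ord x \<noteq> 0" by (auto intro: dvd_imp_le)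
  then have "ord x = 1 \<or> ord x = 2" by linarith
  moreover have "ord x \<noteq> 1" using ord_eq_1[OF assms(1)] assms(2) by blast
  ultimately show ?thesis by blast
qed

text \<open>A group generated by an involution and a Klein four-group that covers the group acting on the tree.\<close>

locale covers_tree_action = klein_action act for act :: "letter \<Rightarrow> 'x \<Rightarrow> 'x" +
  fixes \<eta> :: "nat \<Rightarrow> symbol"
  assumes proj: "ev act v = ev act w \<Longrightarrow> tev \<eta> v = tev \<eta> w"
    and rec: "two_recurrent \<eta>"
begin

abbreviation "W \<equiv> word_group act"
abbreviation "a \<equiv> wcode act [None]"
abbreviation "b \<equiv> wcode act [Some Sym2]"
abbreviation "c \<equiv> wcode act [Some Sym1]"
abbreviation "d \<equiv> wcode act [Some Sym0]"

lemma tree_letters_distinct: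
  assumes "s \<noteq> t"
  shows "tree_act \<eta> s \<noteq> tree_act \<eta> t"
proof -
  have *: "tree_act \<eta> (Some x) \<noteq> tree_act \<eta> None" for x
    by (rule notI) (drule fun_cong[of _ _ "[True]"], simp)
  have "tree_act \<eta> (Some x) \<noteq> tree_act \<eta> (Some y)" if "x \<noteq> y" for x y
  proof
    assume eq: "tree_act \<eta> (Some x) = tree_act \<eta> (Some y)"
    have "distinct [x, y, third x y]" using that third[of x y] by auto
    from tree.klein[OF this, of \<eta>] have "tree_act \<eta> (Some (third x y)) u = u" for u
      by (metis eq tree.invol)
    then show False using tree_act_Some_neq_id[OF rec] by blast
  qed
  then show ?thesis using assms * by (cases s; cases t) (auto, metis)
qed

lemma letters_distinct: "wcode act [s] = wcode act [t] \<longleftrightarrow> s = t"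
proof
  assume "wcode act [s] = wcode act [t]"
  then have "ev act [s] = ev act [t]" by (simp only: wcode_eq_iff)
  then have "tev \<eta> [s] = tev \<eta> [t]" by (rule proj)
  then show "s = t" using tree_letters_distinct by auto
qed simp

lemma letters_nontrivial: "wcode act [s] \<noteq> wcode act []"
proof
  assume "wcode act [s] = wcode act []"
  then have "ev act [s] = ev act []" by (simp only: wcode_eq_iff)
  then have "tev \<eta> [s] = tev \<eta> []" by (rule proj)
  then have id: "tree_act \<eta> s u = u" for u by (simp add: fun_eq_iff)
  show False
  proof (cases s)
    case None
    then show False using id[of "[True]"] by simp
  next
    case (Some x)
    then show False using id tree_act_Some_neq_id[OF rec] by blast
  qed
qed

lemma letter_codes: "range (\<lambda>s. wcode act [s]) = {a, b, c, d}"
proof -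
  have "s \<in> {None, Some Sym2, Some Sym1, Some Sym0}" for s :: "letter"
    by (cases s) (auto intro: symbol.exhaust)
  then have U: "(UNIV :: letter set) = {None, Some Sym2, Some Sym1, Some Sym0}" by blast
  show ?thesis unfolding U by simp
qed

lemma relations:
  "wcode act [s] \<otimes>\<^bsub>W\<^esub> wcode act [s] = \<one>\<^bsub>W\<^esub>"
  "b \<otimes>\<^bsub>W\<^esub> c \<otimes>\<^bsub>W\<^esub> d = \<one>\<^bsub>W\<^esub>"
proof -
  show "wcode act [s] \<otimes>\<^bsub>W\<^esub> wcode act [s] = \<one>\<^bsub>W\<^esub>"
    by (simp add: word_group_simps wcode_eq_iff fun_eq_iff)
  have "act (Some Sym2) (act (Some Sym1) (act (Some Sym0) p)) = p" for p
    using klein[of Sym2 Sym1 Sym0 "act (Some Sym0) p"] by simp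
  then show "b \<otimes>\<^bsub>W\<^esub> c \<otimes>\<^bsub>W\<^esub> d = \<one>\<^bsub>W\<^esub>"
    by (simp add: word_group_simps wcode_eq_iff fun_eq_iff)
qed

lemma klein_involution_word_group: "klein_involution_group (W) a b c d"
proof -
  interpret G: group "W" by (rule group_word_group)
  show ?thesis
    by unfold_locales (auto simp: relations letters_distinct, auto simp: word_group_simps)
qed

lemma generate_letters: "generate (W) {a, b, c, d} = carrier W"
proof
  interpret G: group "W" by (rule group_word_group)
  show "generate (W) {a, b, c, d} \<subseteq> carrier W"
    by (rule G.generate_incl) (auto simp: word_group_simps)
  show "carrier W \<subseteq> generate (W) {a, b, c, d}"
    using generate_singleton_words[of act "{a, b, c, d}"] letter_codes by (auto simp: word_group_simps)
qed

text \<open>Follow the image of a vertex in the middle of a level under the action on the tree.  If the level is deep enough,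
the elements of \<open>F\<close> do not bring it to an end of the path, so the eigenfunctions on the path apply.\<close>

lemma local_eigenfunctions:
  assumes \<mu>: "1 \<le> \<bar>\<mu>\<bar>" "\<bar>\<mu>\<bar> \<le> 3" and F: "finite F" "F \<subseteq> carrier W"
  shows "\<exists>\<psi>. (\<forall>x. cmod (\<psi> x) = 1) \<and> (\<forall>x\<in>F. \<psi> (a \<otimes>\<^bsub>W\<^esub> x) + \<psi> (b \<otimes>\<^bsub>W\<^esub> x) +
    \<psi> (c \<otimes>\<^bsub>W\<^esub> x) + \<psi> (d \<otimes>\<^bsub>W\<^esub> x) = (1 + complex_of_real \<mu>) * \<psi> x)"
proof -
  obtain z where z: "cmod z = 1" "cmod (1 + 2 * z) = \<bar>\<mu>\<bar>" using unit_with_modulus[OF \<mu>] by blast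
  have "\<mu> \<noteq> 0" using \<mu> by auto
  define T where "T x = tev \<eta> (from_nat x)" for x
  have T: "T (wcode act [s] \<otimes>\<^bsub>W\<^esub> x) = tree_act \<eta> s \<circ> T x" if xG: "x \<in> carrier W" for s x
  proof -
    obtain w where w: "x = wcode act w" using xG by (auto simp: word_group_simps)
    have "T (wcode act v) = tev \<eta> v" for v
      unfolding T_def by (rule proj) (rule ev_wcode)
    then show ?thesis by (simp add: w word_group_simps)
  qed
  define r where "r = Max (insert 0 ((\<lambda>x. length (from_nat x :: word)) ` F))"
  have r: "length (from_nat x :: word) \<le> r" if "x \<in> F" for x
    unfolding r_def using F(1) that by (intro Max_ge) auto
  have big: "2 * r + 3 < (2 :: nat) ^ (2 * r + 3)" by (rule less_exp)
  then have "Suc r < (2 :: nat) ^ (2 * r + 3)" by linarith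
  from pos_surj[OF this] obtain u where u: "length u = 2 * r + 3" "pos u = Suc r" by blast
  define \<psi> where "\<psi> x = line_fun z \<mu> (pos (T x u))" for x
  have "\<psi> (a \<otimes>\<^bsub>W\<^esub> x) + \<psi> (b \<otimes>\<^bsub>W\<^esub> x) +
      \<psi> (c \<otimes>\<^bsub>W\<^esub> x) + \<psi> (d \<otimes>\<^bsub>W\<^esub> x) = (1 + complex_of_real \<mu>) * \<psi> x"
    if x: "x \<in> F" for x
  proof -
    have xG: "x \<in> carrier W" using F x by blast
    have len: "length (T x u) = 2 * r + 3" by (simp add: T_def u)
    have "pos (T x u) \<le> Suc r + r \<and> Suc r \<le> pos (T x u) + length (from_nat x :: word)"
      using pos_ev_interior[of u r "from_nat x" \<eta>] u r[OF x] big by (simp add: T_def)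
    then have p: "0 < pos (T x u)" "Suc (pos (T x u)) < 2 ^ length (T x u)"
      unfolding len using r[OF x] big by linarith+
    then have ne: "T x u \<noteq> []" by auto
    let ?k = "pos (T x u)"
    have \<psi>s: "\<psi> (wcode act [s] \<otimes>\<^bsub>W\<^esub> x) = line_fun z \<mu> (pos (tree_act \<eta> s (T x u)))" for s
      by (simp add: \<psi>_def T[OF xG])
    obtain z' where z': "tree_act \<eta> (Some z') (T x u) = T x u"
        "\<And>y. y \<noteq> z' \<Longrightarrow> pos (tree_act \<eta> (Some y) (T x u)) = step_V ?k"
      using pos_tree_V[OF p] by blast
    have "\<psi> (b \<otimes>\<^bsub>W\<^esub> x) + \<psi> (c \<otimes>\<^bsub>W\<^esub> x) + \<psi> (d \<otimes>\<^bsub>W\<^esub> x) =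
        2 * line_fun z \<mu> (step_V ?k) + line_fun z \<mu> ?k"
      unfolding \<psi>s using z' by (cases z') auto
    moreover have "\<psi> (a \<otimes>\<^bsub>W\<^esub> x) = line_fun z \<mu> (step_a ?k)"
      unfolding \<psi>s by (simp only: pos_tree_a[OF ne])
    ultimately show ?thesis
      using line_fun_eigen[OF z \<open>\<mu> \<noteq> 0\<close> p(1)] by (simp add: \<psi>_def add.assoc)
  qed
  moreover have "cmod (\<psi> x) = 1" for x
    unfolding \<psi>_def by (rule cmod_line_fun[OF z \<open>\<mu> \<noteq> 0\<close>])
  ultimately show ?thesis by blast
qed

lemma word_group_spectrum:
  assumes "folner_action act"
  shows "sp (W) {a, b, c, d} = complex_of_real ` ({- 1/2..0} \<union> {1/2..1})"
proof
  interpret K: klein_involution_group "W" a b c d by (rule klein_involution_word_group)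
  show "sp (W) {a, b, c, d} \<subseteq> complex_of_real ` ({- 1/2..0} \<union> {1/2..1})"
    by (rule K.spectrum_subset)
  show "complex_of_real ` ({- 1/2..0} \<union> {1/2..1}) \<subseteq> sp (W) {a, b, c, d}"
  proof (rule image_subsetI)
    fix t :: real assume t: "t \<in> {- 1/2..0} \<union> {1/2..1}"
    define \<mu> where "\<mu> = 4 * t - 1"
    have \<mu>: "1 \<le> \<bar>\<mu>\<bar>" "\<bar>\<mu>\<bar> \<le> 3" using t by (auto simp: \<mu>_def abs_if)
    have "4 * complex_of_real t = 1 + complex_of_real \<mu>" by (simp add: \<mu>_def)
    then show "complex_of_real t \<in> sp (W) {a, b, c, d}"
      using folner_word_group[OF assms] local_eigenfunctions[OF \<mu>] letter_codes
      by (intro K.approximate_eigenvalue_in_spectrum) auto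
  qed
qed

lemma word_group_amenable:
  assumes "folner_action act"
  shows "amenable (W)"
proof -
  interpret G: group "W" by (rule group_word_group)
  show ?thesis
    by (rule G.amenable_if_folner[OF _ generate_letters])
       (use folner_word_group[OF assms] letter_codes in \<open>auto simp: word_group_simps\<close>)
qed

lemma cover_epimorphism:
  assumes \<eta>: "\<eta> = seq0 \<omega>"
  shows "\<exists>h\<in>epi (W) (G_omega \<omega>). h a = gen_a \<and> h b = gen_b \<omega> \<and> h c = gen_c \<omega> \<and> h d = gen_d \<omega>"
proof (rule bexI)
  let ?h = "\<lambda>n. tev \<eta> (from_nat n)"
  have h: "?h (wcode act w) = tev \<eta> w" for w by (rule proj) (rule ev_wcode)
  show "?h a = gen_a \<and> ?h b = gen_b \<omega> \<and> ?h c = gen_c \<omega> \<and> ?h d = gen_d \<omega>"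
    unfolding h by (simp add: gen_eqs(2-)[of \<omega>] gen_eqs(1)[of \<omega>] \<eta>)
  show "?h \<in> epi (W) (G_omega \<omega>)"
    unfolding epi_def
  proof (intro CollectI conjI homI)
    show "?h ` carrier W = carrier (G_omega \<omega>)"
      by (simp add: word_group_simps carrier_G_omega image_image h \<eta>[symmetric])
    show "?h x \<in> carrier (G_omega \<omega>)" if "x \<in> carrier W" for x
      by (simp add: carrier_G_omega \<eta>)
    show "?h (x \<otimes>\<^bsub>W\<^esub> y) = ?h x \<otimes>\<^bsub>G_omega \<omega>\<^esub> ?h y"
      if "x \<in> carrier W" "y \<in> carrier W" for x y
      using that by (auto simp: word_group_simps h ev_append G_omega_def tree_aut_def)
  qed
qed

lemma letters_ord: "group.ord (W) (wcode act [s]) = 2"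
proof -
  interpret G: group "W" by (rule group_word_group)
  show ?thesis
    by (rule G.ord_eq_2) (use letters_nontrivial relations in \<open>auto simp: word_group_simps\<close>)
qed

end

lemma covers_layer:
  assumes "two_recurrent \<eta>"
  shows "covers_tree_action (layer_act \<eta> p) \<eta>"
proof -
  interpret klein_action "layer_act \<eta> p" by (rule klein_layer)
  show ?thesis
  proof
    show "tev \<eta> v = tev \<eta> w" if "ev (layer_act \<eta> p) v = ev (layer_act \<eta> p) w" for v w
      using that by (rule layer_determines_tree)
  qed (rule assms)
qed

section \<open>Counting isomorphism classes\<close>

fun word_value :: "('a, 'b) monoid_scheme \<Rightarrow> (letter \<Rightarrow> 'a) \<Rightarrow> word \<Rightarrow> 'a" where
  "word_value G f [] = \<one>\<^bsub>G\<^esub>"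
| "word_value G f (s # w) = f s \<otimes>\<^bsub>G\<^esub> word_value G f w"

lemma iso_word_value:
  assumes act: "klein_action act" and G: "group G" and \<phi>: "\<phi> \<in> iso (word_group act) G"
  shows "ev act w = id \<longleftrightarrow> word_value G (\<lambda>s. \<phi> (wcode act [s])) w = \<one>\<^bsub>G\<^esub>"
proof -
  interpret group_hom "word_group act" G \<phi>
    using klein_action.group_word_group[OF act] G \<phi> by (auto simp: group_hom_def group_hom_axioms_def iso_def)
  have val: "word_value G (\<lambda>s. \<phi> (wcode act [s])) w = \<phi> (wcode act w)" for w
  proof (induction w)
    case Nil
    show ?case using hom_one by (simp add: word_group_simps)
  next
    case (Cons s w)
    have "wcode act (s # w) = wcode act [s] \<otimes>\<^bsub>word_group act\<^esub> wcode act w" by (simp add: word_group_simps)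
    then show ?case using Cons by (simp only: word_value.simps) (rule hom_mult[symmetric]; simp add: word_group_simps)
  qed
  have inj: "inj_on \<phi> (carrier (word_group act))" using \<phi> by (auto simp: iso_def bij_betw_def)
  have "\<phi> (wcode act w) = \<one>\<^bsub>G\<^esub> \<longleftrightarrow> \<phi> (wcode act w) = \<phi> (wcode act [])"
    using hom_one by (simp add: word_group_simps)
  also have "\<dots> \<longleftrightarrow> wcode act w = wcode act []"
    using inj by (rule inj_on_eq_iff) (auto simp: word_group_simps)
  also have "\<dots> \<longleftrightarrow> ev act w = id" by (simp add: wcode_eq_iff)
  finally show ?thesis by (simp add: val)
qed

text \<open>An isomorphism onto \<open>G\<close> is determined on the generators by a quadruple of elements of \<open>G\<close>.  This quadruple decides
which words are trivial, and hence the set \<open>K\<close>; there are only countably many quadruples.\<close>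

lemma countable_isomorphic_members:
  fixes act :: "nat set \<Rightarrow> letter \<Rightarrow> 'x \<Rightarrow> 'x" and v :: "nat \<Rightarrow> word" and G :: "nat monoid"
  assumes act: "\<And>K. klein_action (act K)" and sep: "\<And>k K. ev (act K) (v k) = id \<longleftrightarrow> k \<notin> K" and G: "group G"
  shows "countable {K. word_group (act K) \<cong> G}"
proof (rule countable_subset)
  define img :: "nat \<times> nat \<times> nat \<times> nat \<Rightarrow> letter \<Rightarrow> nat" where "img = (\<lambda>(a, b, c, d) s. case s of None \<Rightarrow> a | Some x \<Rightarrow> (case x of Sym2 \<Rightarrow> b | Sym1 \<Rightarrow> c | Sym0 \<Rightarrow> d))"
  define set_of where "set_of t = {k. word_value G (img t) (v k) \<noteq> \<one>\<^bsub>G\<^esub>}" for t :: "nat \<times> nat \<times> nat \<times> nat"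
  show "countable (range set_of)" by simp
  show "{K. word_group (act K) \<cong> G} \<subseteq> range set_of"
  proof
    fix K assume "K \<in> {K. word_group (act K) \<cong> G}"
    then obtain \<phi> where \<phi>: "\<phi> \<in> iso (word_group (act K)) G" by (auto simp: is_iso_def)
    let ?f = "\<lambda>s. \<phi> (wcode (act K) [s])"
    have "?f = img (?f None, ?f (Some Sym2), ?f (Some Sym1), ?f (Some Sym0))"
    proof
      fix s show "?f s = img (?f None, ?f (Some Sym2), ?f (Some Sym1), ?f (Some Sym0)) s"
        by (cases s) (auto simp: img_def split: symbol.splits)
    qed
    moreover have "K = {k. word_value G ?f (v k) \<noteq> \<one>\<^bsub>G\<^esub>}"
      using iso_word_value[OF act G \<phi>] sep[of K] by auto
    ultimately have "K = set_of (?f None, ?f (Some Sym2), ?f (Some Sym1), ?f (Some Sym0))"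
      unfolding set_of_def by (simp only:)
    then show "K \<in> range set_of" by blast
  qed
qed

lemma infinite_times_self_eqpoll:
  assumes "infinite A"
  shows "A \<times> A \<approx> A"
  using card_of_Times_same_infinite[OF assms] unfolding card_of_ordIso[symmetric] eqpoll_def .

text \<open>The domain embeds into \<open>range f \<times> UNIV\<close>, so the range is infinite, and then this product is no larger than the range.\<close>

lemma countable_to_one_range_eqpoll:
  fixes f :: "nat set \<Rightarrow> 'b"
  assumes "\<And>y. countable {x. f x = y}"
  shows "range f \<approx> (UNIV :: nat set set)"
proof (rule lepoll_antisym)
  have "range f \<lesssim> (UNIV :: nat set set)" by (rule image_lepoll)
  then show "range f \<lesssim> (UNIV :: nat set set)" .
  define code where "code x = (f x, to_nat_on {x'. f x' = f x} x)" for x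
  have "inj code"
  proof (rule injI)
    fix x y assume eq: "code x = code y"
    then have f: "f x = f y" by (simp add: code_def)
    have "inj_on (to_nat_on {x'. f x' = f x}) {x'. f x' = f x}" using assms by (rule inj_on_to_nat_on)
    then show "x = y" using eq f by (auto simp: code_def inj_on_def)
  qed
  then have le: "(UNIV :: nat set set) \<lesssim> range f \<times> (UNIV :: nat set)"
    unfolding lepoll_def by (intro exI[of _ code]) (auto simp: code_def)
  have "infinite (range f)"
  proof
    assume "finite (range f)"
    then have "countable (range f)" by (rule countable_finite)
    then have "countable (range f \<times> (UNIV :: nat set))" by (rule countable_SIGMA) (rule countableI_type)
    then have "countable (UNIV :: nat set set)" using le by (rule countable_lepoll)
    then obtain g :: "nat \<Rightarrow> nat set" where "range g = UNIV"
      using uncountable_def[of "UNIV :: nat set set"] by auto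
    moreover have "{n. n \<notin> g n} \<noteq> g m" for m by blast
    ultimately show False by (metis UNIV_I image_iff)
  qed
  then have "range f \<times> (UNIV :: nat set) \<lesssim> range f \<times> range f"
    by (intro times_lepoll_mono lepoll_refl) (simp only: infinite_le_lepoll)
  also have "range f \<times> range f \<approx> range f" by (rule infinite_times_self_eqpoll) fact
  finally show "(UNIV :: nat set set) \<lesssim> range f" using le by (rule lepoll_trans[rotated])
qed

theorem theorem1p3:
  fixes \<omega> :: symbol_seq
  assumes "\<omega> \<in> Omega2"
  shows "\<exists>F :: nat monoid set.
    F \<approx> (UNIV :: nat set set) \<and>
    (\<forall>G\<in>F. \<forall>H\<in>F. G \<noteq> H \<longrightarrow> \<not> G \<cong> H) \<and>
    (\<forall>G\<in>F. group G \<and> amenable G \<and>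
      (\<exists>a b c d.
        {a, b, c, d} \<subseteq> carrier G \<and>
        generate G {a, b, c, d} = carrier G \<and>
        group.ord G a = 2 \<and> group.ord G b = 2 \<and> group.ord G c = 2 \<and> group.ord G d = 2 \<and>
        b \<otimes>\<^bsub>G\<^esub> c \<otimes>\<^bsub>G\<^esub> d = \<one>\<^bsub>G\<^esub> \<and>
        (\<exists>h\<in>epi G (G_omega \<omega>).
          h a = gen_a \<and> h b = gen_b \<omega> \<and> h c = gen_c \<omega> \<and> h d = gen_d \<omega>) \<and>
        sp G {a, b, c, d} = complex_of_real ` ({- 1/2..0} \<union> {1/2..1})))"
proof -
  define \<eta> where "\<eta> = seq0 \<omega>"
  have \<eta>: "two_recurrent \<eta>" unfolding \<eta>_def by (rule two_recurrent_seq0[OF assms])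
  obtain p v where sep: "\<And>k K. ev (layer_act \<eta> (p K)) (v k) = id \<longleftrightarrow> k \<notin> (K :: nat set)"
    using family_of_layer_actions[OF \<eta>] by metis
  define G where "G K = word_group (layer_act \<eta> (p K))" for K
  have grp: "group (G K)" for K unfolding G_def by (rule klein_action.group_word_group[OF klein_layer])
  \<comment> \<open>\<open>R\<close> selects one index in every isomorphism class.\<close>
  define R where "R K = (SOME K'. G K' \<cong> G K)" for K
  have R: "G (R K) \<cong> G K" for K unfolding R_def by (rule someI[of _ K]) (rule iso_refl)
  have R_eq: "R K = R K'" if "G K \<cong> G K'" for K K'
  proof -
    have "(G L \<cong> G K) = (G L \<cong> G K')" for L
      using that iso_trans group.iso_sym[OF grp] by blast
    then show ?thesis by (simp add: R_def)
  qed
  have fibre: "countable {K. G (R K) = H}" for H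
  proof (cases "\<exists>K. G (R K) = H")
    case True
    then have "group H" using grp by blast
    have "countable {K. G K \<cong> H}"
      unfolding G_def using klein_layer sep \<open>group H\<close> by (rule countable_isomorphic_members)
    moreover have "{K. G (R K) = H} \<subseteq> {K. G K \<cong> H}" using R group.iso_sym[OF grp] by blast
    ultimately show ?thesis by (rule countable_subset[rotated])
  qed simp
  define F where "F = range (\<lambda>K. G (R K))"
  have "F \<approx> (UNIV :: nat set set)" unfolding F_def by (rule countable_to_one_range_eqpoll) (rule fibre)
  moreover have "\<not> H \<cong> H'" if HF: "H \<in> F" "H' \<in> F" and "H \<noteq> H'" for H H'
  proof
    assume iso: "H \<cong> H'"
    obtain K K' where K: "H = G (R K)" "H' = G (R K')" using HF by (auto simp: F_def)
    have "G K \<cong> G (R K)" using R by (rule group.iso_sym[OF grp])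
    also have "G (R K) \<cong> G (R K')" using iso K by simp
    also have "G (R K') \<cong> G K'" by (rule R)
    finally have "R K = R K'" by (rule R_eq)
    then show False using K \<open>H \<noteq> H'\<close> by simp
  qed
  moreover let "\<exists>F :: nat monoid set. ?card F \<and> ?noniso F \<and> (\<forall>G\<in>F. ?cover G)" = ?thesis
  have "?cover H" if HF: "H \<in> F" for H
  proof -
    obtain K where H: "H = word_group (layer_act \<eta> (p K))" using HF by (auto simp: F_def G_def)
    interpret covers_tree_action "layer_act \<eta> (p K)" \<eta> by (rule covers_layer[OF \<eta>])
    have fol: "folner_action (layer_act \<eta> (p K))" by (rule layer_folner[OF \<eta>])
    show ?thesis
      unfolding H
      by (intro conjI exI[of _ a] exI[of _ b] exI[of _ c] exI[of _ d] group_word_group word_group_amenable[OF fol]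
          generate_letters letters_ord relations cover_epimorphism[OF \<eta>_def] word_group_spectrum[OF fol])
         (auto simp: word_group_simps)
  qed
  ultimately show ?thesis by (intro exI[of _ F] conjI ballI impI) blast+
qed

end
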